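(* Suppose that $q_n\in W^{-1}_{2,unif}(\mathbb{R})$, $n\in\mathbb{N}$, is a sequence of real-valued potentials that converges to a real-valued potential $q$ in the $W^{-1}_{2,unif}(\mathbb{R})$-norm, and that $S_n$ and $S$ are the Schrödinger operators corresponding to $q_n$ and $q$. Then $S_n$ converge to $S$ as $n\to\infty$ in the uniform resolvent sense, i.e., $$\|(S_n-\lambda)^{-1}-(S-\lambda)^{-1}\|\to 0\qquad\text{as}\quad n\to\infty$$ for any $\lambda$ in the resolvent set of $S$ and of $S_n$, $n\in\mathbb{N}$.
   Context: $W^{-1}_2(\mathbb{R})$ is the dual of the Sobolev space $W^1_2(\mathbb{R})$, with the dual norm. Let $\phi(t)=2(t+1)^2$ for $t\in[-1,-1/2)$, $\phi(t)=1-2t^2$ for $t\in[-1/2,1/2)$, $\phi(t)=2(t-1)^2$ for $t\in[1/2,1]$, $\phi(t)=0$ otherwise, and $\phi_n(t):=\phi(t-n)$, $n\in\mathbb{Z}$. A distribution $f\in W^{-1}_{2,loc}(\mathbb{R})$ (i.e. $f\psi\in W^{-1}_2(\mathbb{R})$ for every test function $\psi$) belongs to $W^{-1}_{2,unif}(\mathbb{R})$ if $f\phi_n\in W^{-1}_2(\mathbb{R})$ for all $n$ and $\|f\|_{W^{-1}_{2,unif}(\mathbb{R})}:=\sup_{n\in\mathbb{Z}}\|f\phi_n\|_{W^{-1}_2(\mathbb{R})}<\infty$. Any real-valued $q\in W^{-1}_{2,unif}(\mathbb{R})$ can be written (not uniquely) as $q=\sigma'+\tau$ (distributional derivative) with real-valued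 $\sigma,\tau$ satisfying $\sup_{t}\int_t^{t+1}|\sigma|^2\,ds<\infty$ and $\sup_t\int_t^{t+1}|\tau|\,ds<\infty$. The Schrödinger operator $S=-\frac{d^2}{dt^2}+q$ in $L_2(\mathbb{R})$ corresponding to $q$ is defined by $$Su=l(u):=-(u'-\sigma u)'-\sigma u'+\tau u$$ on $$\mathfrak{D}(S)=\{u\in L_2(\mathbb{R})\cap W^1_{1,loc}(\mathbb{R})\mid u'-\sigma u\in W^1_{1,loc}(\mathbb{R}),\ l(u)\in L_2(\mathbb{R})\}.$$ It does not depend on the choice of the decomposition $q=\sigma'+\tau$ and is selfadjoint and bounded below; it coincides with the selfadjoint operator associated with the closed bounded below quadratic form $\mathfrak{t}(u)=(u',u')-(\sigma u',u)-(\sigma u,u')+(\tau u,u)$ with domain $W^1_2(\mathbb{R})$. *)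

theory Defs
  imports "HOL-Analysis.Analysis"
begin

text \<open>
  Elements of \<open>L\<^sub>2\<close>, \<open>L\<^sub>1\<^sub>,\<^sub>l\<^sub>o\<^sub>c\<close> and Sobolev spaces on the line are represented by functions
  \<open>real \<Rightarrow> complex\<close>, considered up to equality almost everywhere.
\<close>

section \<open>Function spaces\<close>

definition square_integrable :: "(real \<Rightarrow> complex) \<Rightarrow> bool" where
  "square_integrable u \<longleftrightarrow>
     u \<in> borel_measurable lborel \<and> integrable lborel (\<lambda>t. (cmod (u t))\<^sup>2)"

definition L2_norm :: "(real \<Rightarrow> complex) \<Rightarrow> real" where
  "L2_norm u = sqrt (LINT t|lborel. (cmod (u t))\<^sup>2)"

definition locally_integrable :: "(real \<Rightarrow> complex) \<Rightarrow> bool" where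
  "locally_integrable u \<longleftrightarrow> (\<forall>a b. set_integrable lborel {a..b} u)"

definition vderiv :: "(real \<Rightarrow> complex) \<Rightarrow> real \<Rightarrow> complex" where
  "vderiv f = (\<lambda>t. vector_derivative f (at t))"

definition test_fun :: "(real \<Rightarrow> complex) \<Rightarrow> bool" where
  "test_fun \<psi> \<longleftrightarrow>
     (\<forall>k t. ((vderiv ^^ k) \<psi>) differentiable (at t)) \<and> bounded {t. \<psi> t \<noteq> 0}"

definition has_weak_deriv :: "(real \<Rightarrow> complex) \<Rightarrow> (real \<Rightarrow> complex) \<Rightarrow> bool" where
  "has_weak_deriv u g \<longleftrightarrow> locally_integrable u \<and> locally_integrable g \<and>
     (\<forall>\<psi>. test_fun \<psi> \<longrightarrow>
        (LINT t|lborel. u t * vderiv \<psi> t) = - (LINT t|lborel. g t * \<psi> t))"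

text \<open>The weak derivative is unique up to a null set, so the norm does not depend on the choice.\<close>

definition weak_deriv :: "(real \<Rightarrow> complex) \<Rightarrow> real \<Rightarrow> complex" where
  "weak_deriv u = (SOME g. has_weak_deriv u g)"

definition W12 :: "(real \<Rightarrow> complex) set" where
  "W12 = {u. square_integrable u \<and> (\<exists>g. has_weak_deriv u g \<and> square_integrable g)}"

definition W12_norm :: "(real \<Rightarrow> complex) \<Rightarrow> real" where
  "W12_norm u = sqrt ((L2_norm u)\<^sup>2 + (L2_norm (weak_deriv u))\<^sup>2)"

section \<open>The dual space and distributions\<close>

text \<open>
  Functionals are complex linear. Values outside the intended domain are irrelevant:
  elements of the dual matter only on \<^const>\<open>W12\<close>, distributions only on test functions.
  Boundedness makes elements of the dual respect equality almost everywhere.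
\<close>

type_synonym functional = "(real \<Rightarrow> complex) \<Rightarrow> complex"

definition W12_dual :: "functional set" where
  "W12_dual = {F.
     (\<forall>u\<in>W12. \<forall>v\<in>W12. F (\<lambda>t. u t + v t) = F u + F v) \<and>
     (\<forall>c. \<forall>u\<in>W12. F (\<lambda>t. c * u t) = c * F u) \<and>
     (\<exists>C. \<forall>u\<in>W12. cmod (F u) \<le> C * W12_norm u)}"

definition dual_norm :: "functional \<Rightarrow> real" where
  "dual_norm F = (SUP u\<in>{u\<in>W12. W12_norm u \<le> 1}. cmod (F u))"

definition distribution :: "functional \<Rightarrow> bool" where
  "distribution f \<longleftrightarrow>
     (\<forall>\<psi> \<eta>. test_fun \<psi> \<longrightarrow> test_fun \<eta> \<longrightarrow> f (\<lambda>t. \<psi> t + \<eta> t) = f \<psi> + f \<eta>) \<and>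
     (\<forall>c \<psi>. test_fun \<psi> \<longrightarrow> f (\<lambda>t. c * \<psi> t) = c * f \<psi>) \<and>
     (\<forall>a. \<exists>C N. \<forall>\<psi>. test_fun \<psi> \<longrightarrow> {t. \<psi> t \<noteq> 0} \<subseteq> {-a..a} \<longrightarrow>
        cmod (f \<psi>) \<le> C * (\<Sum>k\<le>N. SUP t. cmod ((vderiv ^^ k) \<psi> t)))"

definition real_distribution :: "functional \<Rightarrow> bool" where
  "real_distribution f \<longleftrightarrow> (\<forall>\<psi>. test_fun \<psi> \<longrightarrow> (\<forall>t. \<psi> t \<in> \<real>) \<longrightarrow> f \<psi> \<in> \<real>)"

text \<open>
  A distribution lies in \<open>W\<^sub>2\<^sup>-\<^sup>1\<close> if it extends to an element of the dual of \<^const>\<open>W12\<close>;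
  as test functions are dense in \<^const>\<open>W12\<close>, the extension is unique on \<^const>\<open>W12\<close>.
\<close>

definition extends_to :: "functional \<Rightarrow> functional \<Rightarrow> bool" where
  "extends_to f F \<longleftrightarrow> F \<in> W12_dual \<and> (\<forall>\<eta>. test_fun \<eta> \<longrightarrow> F \<eta> = f \<eta>)"

definition dual_extension :: "functional \<Rightarrow> functional" where
  "dual_extension f = (SOME F. extends_to f F)"

definition mult_functional :: "functional \<Rightarrow> (real \<Rightarrow> complex) \<Rightarrow> functional" where
  "mult_functional f m = (\<lambda>u. f (\<lambda>t. m t * u t))"

definition Wm12_loc :: "functional set" where
  "Wm12_loc = {f. distribution f \<and>
     (\<forall>\<psi>. test_fun \<psi> \<longrightarrow> (\<exists>F. extends_to (mult_functional f \<psi>) F))}"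

text \<open>
  The functions \<open>\<phi>\<^sub>n\<close> below are not smooth, so the product \<open>f \<phi>\<^sub>n\<close> is not just \<^const>\<open>mult_functional\<close>.
  For \<open>f\<close> in \<^const>\<open>Wm12_loc\<close> and a multiplier \<open>m\<close> of compact support, \<open>f m\<close> is the product with \<open>m\<close>
  of the element \<open>f \<psi>\<close> of the dual, for any test function \<open>\<psi>\<close> that is 1 near the support of \<open>m\<close>.
  The result does not depend on \<open>\<psi>\<close>.
\<close>

definition cutoff_for :: "(real \<Rightarrow> complex) \<Rightarrow> (real \<Rightarrow> complex) \<Rightarrow> bool" where
  "cutoff_for m \<psi> \<longleftrightarrow> test_fun \<psi> \<and>
     (\<exists>U. open U \<and> closure {t. m t \<noteq> 0} \<subseteq> U \<and> (\<forall>t\<in>U. \<psi> t = 1))"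

definition mult_Wm12_loc :: "functional \<Rightarrow> (real \<Rightarrow> complex) \<Rightarrow> functional" where
  "mult_Wm12_loc f m =
     mult_functional (dual_extension (mult_functional f (SOME \<psi>. cutoff_for m \<psi>))) m"

definition phi :: "real \<Rightarrow> real" where
  "phi t = (if -1 \<le> t \<and> t < -1/2 then 2 * (t + 1)\<^sup>2
            else if -1/2 \<le> t \<and> t < 1/2 then 1 - 2 * t\<^sup>2
            else if 1/2 \<le> t \<and> t \<le> 1 then 2 * (t - 1)\<^sup>2
            else 0)"

definition phi_shift :: "int \<Rightarrow> real \<Rightarrow> complex" where
  "phi_shift n t = complex_of_real (phi (t - of_int n))"

definition Wm12_unif :: "functional set" where
  "Wm12_unif = {f \<in> Wm12_loc.
     (\<forall>n. mult_Wm12_loc f (phi_shift n) \<in> W12_dual) \<and>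
     bdd_above (range (\<lambda>n. dual_norm (mult_Wm12_loc f (phi_shift n))))}"

definition Wm12_unif_norm :: "functional \<Rightarrow> real" where
  "Wm12_unif_norm f = (SUP n. dual_norm (mult_Wm12_loc f (phi_shift n)))"

section \<open>Schroedinger operators\<close>

definition uniformly_locally_integrable :: "(real \<Rightarrow> real) \<Rightarrow> bool" where
  "uniformly_locally_integrable g \<longleftrightarrow>
     (\<forall>t. set_integrable lborel {t..t+1} g) \<and>
     bdd_above (range (\<lambda>t. LINT s:{t..t+1}|lborel. \<bar>g s\<bar>))"

definition decomposition :: "functional \<Rightarrow> (real \<Rightarrow> real) \<Rightarrow> (real \<Rightarrow> real) \<Rightarrow> bool" where
  "decomposition q \<sigma> \<tau> \<longleftrightarrow>
     \<sigma> \<in> borel_measurable lborel \<and>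
     uniformly_locally_integrable (\<lambda>t. (\<sigma> t)\<^sup>2) \<and>
     uniformly_locally_integrable \<tau> \<and>
     (\<forall>\<psi>. test_fun \<psi> \<longrightarrow>
        q \<psi> = - (LINT t|lborel. complex_of_real (\<sigma> t) * vderiv \<psi> t)
              + (LINT t|lborel. complex_of_real (\<tau> t) * \<psi> t))"

text \<open>
  Operators in \<open>L\<^sub>2\<close> are represented by their graphs, which contain all representatives of each pair.
  Below, \<open>u'\<close> and \<open>w'\<close> are the weak derivatives of \<open>u\<close> and of \<open>w = u' - \<sigma> u\<close>, and \<open>v = l(u)\<close>.
\<close>

type_synonym L2_operator = "((real \<Rightarrow> complex) \<times> (real \<Rightarrow> complex)) set"

definition schroedinger_graph :: "(real \<Rightarrow> real) \<Rightarrow> (real \<Rightarrow> real) \<Rightarrow> L2_operator" where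
  "schroedinger_graph \<sigma> \<tau> = {(u, v).
     square_integrable u \<and> square_integrable v \<and>
     (\<exists>u' w'. has_weak_deriv u u' \<and>
        has_weak_deriv (\<lambda>t. u' t - complex_of_real (\<sigma> t) * u t) w' \<and>
        (AE t in lborel. v t = - w' t - complex_of_real (\<sigma> t) * u' t + complex_of_real (\<tau> t) * u t))}"

definition schroedinger_operator :: "functional \<Rightarrow> L2_operator \<Rightarrow> bool" where
  "schroedinger_operator q S \<longleftrightarrow>
     (\<exists>\<sigma> \<tau>. decomposition q \<sigma> \<tau> \<and> S = schroedinger_graph \<sigma> \<tau>)"

section \<open>Resolvents\<close>

definition solves_resolvent_eq ::
  "L2_operator \<Rightarrow> complex \<Rightarrow> (real \<Rightarrow> complex) \<Rightarrow> (real \<Rightarrow> complex) \<Rightarrow> bool" where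
  "solves_resolvent_eq S z f u \<longleftrightarrow>
     (\<exists>v. (u, v) \<in> S \<and> (AE t in lborel. v t - z * u t = f t))"

definition resolvent_set :: "L2_operator \<Rightarrow> complex set" where
  "resolvent_set S = {z.
     (\<forall>f. square_integrable f \<longrightarrow> (\<exists>u. solves_resolvent_eq S z f u)) \<and>
     (\<forall>f u v. square_integrable f \<longrightarrow> solves_resolvent_eq S z f u \<longrightarrow> solves_resolvent_eq S z f v
        \<longrightarrow> (AE t in lborel. u t = v t)) \<and>
     (\<exists>C. \<forall>f u. square_integrable f \<longrightarrow> solves_resolvent_eq S z f u \<longrightarrow> L2_norm u \<le> C * L2_norm f)}"

definition resolvent :: "L2_operator \<Rightarrow> complex \<Rightarrow> (real \<Rightarrow> complex) \<Rightarrow> real \<Rightarrow> complex" where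
  "resolvent S z f = (SOME u. solves_resolvent_eq S z f u)"

definition L2_op_norm :: "((real \<Rightarrow> complex) \<Rightarrow> real \<Rightarrow> complex) \<Rightarrow> real" where
  "L2_op_norm T = (SUP f\<in>{f. square_integrable f \<and> L2_norm f \<le> 1}. L2_norm (T f))"

end

theory Submission
  imports Defs
begin

text \<open>
  Write \<open>r = q\<^sub>n - q\<close>, let \<open>u\<^sub>n\<close> and \<open>u\<close> be the solutions of the two resolvent equations with right-hand
  side \<open>f\<close>, and let \<open>v\<close> solve the unperturbed equation with right-hand side \<open>g\<close>. Testing the equations
  against each other in the bilinear pairing leaves only the perturbation, so that the integral of
  \<open>(u\<^sub>n - u) g\<close> is \<open>-r(u\<^sub>n v)\<close>. With the partition of unity \<open>\<phi>\<^sub>k\<close> and the algebra property of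
  \<open>W\<^sub>2\<^sup>1\<close> on intervals, \<open>\<bar>r(u v)\<bar>\<close> is at most a constant times
  \<open>\<parallel>r\<parallel> \<parallel>u\<parallel> \<parallel>v\<parallel>\<close>, with the \<open>W\<^sub>2\<^sup>-\<^sup>1\<^sub>u\<^sub>n\<^sub>i\<^sub>f\<close>-norm of \<open>r\<close> and the \<open>W\<^sub>2\<^sup>1\<close>-norms of \<open>u\<close>
  and \<open>v\<close>. An energy estimate, which also shows that the domain of the maximal operator lies in
  \<open>W\<^sub>2\<^sup>1\<close>, bounds these norms by \<open>L\<^sub>2\<close>-norms uniformly in \<open>n\<close>. The choice
  \<open>g = cnj (u\<^sub>n - u)\<close> finishes the proof. To evaluate \<open>r \<phi>\<^sub>k\<close>, which is defined by extension from
  test functions, as the form of \<open>\<sigma>' + \<tau>\<close>, one needs the density of test functions.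
\<close>

section \<open>Smooth functions\<close>

text \<open>The decompositions of the potentials \<open>qn n\<close> come with no bounds uniform in
  \<open>n\<close> and need not converge to that of \<open>q\<close>. A quantitative bound on a
  decomposition is therefore extracted only for the limit \<open>q\<close>, whose form has relative
  bound 1/2. The forms of the \<open>qn n\<close> inherit the bound 3/4 once the perturbation,
  measured in the uniform norm, contributes at most 1/4. Similarly, only the resolvent of
  \<open>S\<close> supplies a bound independent of \<open>n\<close>. A bound on the perturbed
  solution is not an input: the difference of the two solutions is small relative to the perturbed
  one, which in turn is the unperturbed solution plus this difference, so for large \<open>n\<close>
  the estimate closes on itself. The other obstacle is the behaviour at infinity. A function in the
  operator domain has at first only a locally square-integrable derivative, and the potential is
  controlled only locally, so each identity is tested with compactly supported functions and the
  cutoff is removed in the limit.\<close>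

definition smooth :: "(real \<Rightarrow> complex) \<Rightarrow> bool" where
  "smooth f \<longleftrightarrow> (\<forall>k t. ((vderiv ^^ k) f) differentiable (at t))"

text \<open>Induction on the order of the derivative, for all functions of the class at once.
  Closure under one differentiation thus replaces formulas for higher derivatives.\<close>

lemma smooth_coinduct:
  assumes "X f"
    and "\<And>f. X f \<Longrightarrow> \<exists>f'. (\<forall>t. (f has_vector_derivative f' t) (at t)) \<and> (X f' \<or> smooth f')"
  shows "smooth f"
proof -
  have vd: "vderiv f = f'" if "\<forall>t. (f has_vector_derivative f' t) (at t)" for f f'
    using that by (auto simp: vderiv_def vector_derivative_at)
  have "\<forall>f. X f \<or> smooth f \<longrightarrow> ((vderiv ^^ k) f) differentiable (at t)" for k t
  proof (induction k)
    case 0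
    have "f differentiable at t" if f: "X f" for f
    proof -
      obtain f' where "\<forall>t. (f has_vector_derivative f' t) (at t)" using assms(2)[OF f] by blast
      then show ?thesis using differentiableI_vector by blast
    qed
    moreover have "f differentiable at t" if "smooth f" for f
      using that unfolding smooth_def by (metis funpow_0)
    ultimately show ?case by auto
  next
    case (Suc k)
    show ?case
    proof (intro allI impI)
      fix f assume f: "X f \<or> smooth f"
      show "(vderiv ^^ Suc k) f differentiable at t"
      proof (cases "smooth f")
        case True then show ?thesis unfolding smooth_def by blast
      next
        case False
        then obtain f' where "\<forall>t. (f has_vector_derivative f' t) (at t)" "X f' \<or> smooth f'"
          using assms(2) f by blast
        then have "(vderiv ^^ k) f' differentiable at t" "vderiv f = f'" using Suc vd by blast+
        then show ?thesis by (simp add: funpow_swap1)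
      qed
    qed
  qed
  then show ?thesis using assms(1) by (simp add: smooth_def)
qed

lemma smooth_deriv:
  assumes "smooth f"
  shows "(f has_vector_derivative vderiv f t) (at t)" "smooth (vderiv f)"
proof -
  have "f differentiable at t" using assms unfolding smooth_def by (metis funpow_0)
  then show "(f has_vector_derivative vderiv f t) (at t)"
    by (simp add: vderiv_def vector_derivative_works)
  show "smooth (vderiv f)"
    unfolding smooth_def
  proof (intro allI)
    fix k t
    show "(vderiv ^^ k) (vderiv f) differentiable at t"
      using assms unfolding smooth_def by (metis funpow_swap1 funpow.simps(2) comp_apply)
  qed
qed

lemma vderiv_eqI: "(\<And>t. (f has_vector_derivative f' t) (at t)) \<Longrightarrow> vderiv f = f'"
  by (auto simp: vderiv_def vector_derivative_at)

lemma smoothI: "(\<And>t. (f has_vector_derivative f' t) (at t)) \<Longrightarrow> smooth f' \<Longrightarrow> smooth f"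
  by (rule smooth_coinduct[where X="\<lambda>g. g = f"]) auto

lemma smooth_const: "smooth (\<lambda>t. c)"
  by (rule smooth_coinduct[where X="\<lambda>g. \<exists>c. g = (\<lambda>t. c)"]) (auto intro!: derivative_eq_intros exI[of _ "\<lambda>t. 0"])

lemma smooth_add:
  assumes "smooth f" "smooth g" shows "smooth (\<lambda>t. f t + g t)"
proof (rule smooth_coinduct[where X="\<lambda>h. \<exists>f g. smooth f \<and> smooth g \<and> h = (\<lambda>t. f t + g t)"])
  fix h assume "\<exists>f g. smooth f \<and> smooth g \<and> h = (\<lambda>t. f t + g t)"
  then obtain f g where "smooth f" "smooth g" "h = (\<lambda>t. f t + g t)" by blast
  then have "(h has_vector_derivative vderiv f t + vderiv g t) (at t)" for t
    by (auto intro!: derivative_eq_intros smooth_deriv)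
  then show "\<exists>f'. (\<forall>t. (h has_vector_derivative f' t) (at t)) \<and> ((\<exists>f g. smooth f \<and> smooth g \<and> f' = (\<lambda>t. f t + g t)) \<or> smooth f')"
    using smooth_deriv(2)[OF \<open>smooth f\<close>] smooth_deriv(2)[OF \<open>smooth g\<close>]
    by (intro exI[of _ "\<lambda>t. vderiv f t + vderiv g t"]) blast
qed (use assms in blast)

text \<open>Products alone are not closed under differentiation, as the product rule creates sums;
  this is the class needed as invariant in \<open>smooth_coinduct\<close>.\<close>

inductive sum_of_smooth_products :: "(real \<Rightarrow> complex) \<Rightarrow> bool" where
  "smooth f \<Longrightarrow> smooth g \<Longrightarrow> sum_of_smooth_products (\<lambda>t. f t * g t)"
| "sum_of_smooth_products f \<Longrightarrow> sum_of_smooth_products g \<Longrightarrow> sum_of_smooth_products (\<lambda>t. f t + g t)"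

lemma smooth_mult:
  assumes "smooth f" "smooth g" shows "smooth (\<lambda>t. f t * g t)"
proof (rule smooth_coinduct[where X=sum_of_smooth_products])
  fix h assume "sum_of_smooth_products h"
  then have "\<exists>f'. (\<forall>t. (h has_vector_derivative f' t) (at t)) \<and> sum_of_smooth_products f'"
  proof induction
    case (1 f g)
    then show ?case
      by (intro exI[of _ "\<lambda>t. f t * vderiv g t + vderiv f t * g t"] conjI allI
          sum_of_smooth_products.intros) (auto intro!: derivative_eq_intros smooth_deriv)
  next
    case (2 f g)
    then obtain f' g' where "\<forall>t. (f has_vector_derivative f' t) (at t)" "sum_of_smooth_products f'"
      "\<forall>t. (g has_vector_derivative g' t) (at t)" "sum_of_smooth_products g'" by blast
    then show ?case
      by (intro exI[of _ "\<lambda>t. f' t + g' t"] conjI allI sum_of_smooth_products.intros)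
         (auto intro!: derivative_eq_intros)
  qed
  then show "\<exists>f'. (\<forall>t. (h has_vector_derivative f' t) (at t)) \<and> (sum_of_smooth_products f' \<or> smooth f')"
    by blast
qed (auto intro: sum_of_smooth_products.intros assms)

lemma has_vector_derivative_affine:
  assumes "(f has_vector_derivative f') (at (a * t + b))"
  shows "((\<lambda>t. f (a * t + b)) has_vector_derivative (of_real a * f')) (at t)"
proof -
  have "((\<lambda>t. a * t + b) has_vector_derivative a) (at t)"
    by (auto intro!: derivative_eq_intros)
  from vector_diff_chain_at[OF this assms] show ?thesis
    by (simp add: o_def scaleR_conv_of_real)
qed

lemma smooth_affine:
  assumes "smooth f" shows "smooth (\<lambda>t. f (a * t + b))"
\<comment> \<open>The scalar \<open>c\<close> collects the powers of \<open>a\<close> produced by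
  the chain rule.\<close>
proof (rule smooth_coinduct[where X="\<lambda>h. \<exists>c f. smooth f \<and> h = (\<lambda>t. c * f (a * t + b))"])
  show "\<exists>c g. smooth g \<and> (\<lambda>t. f (a * t + b)) = (\<lambda>t. c * g (a * t + b))"
    using assms by (intro exI[of _ 1]) auto
next
  fix h assume "\<exists>c f. smooth f \<and> h = (\<lambda>t. c * f (a * t + b))"
  then obtain c f where f: "smooth f" "h = (\<lambda>t. c * f (a * t + b))" by blast
  have "(h has_vector_derivative c * of_real a * vderiv f (a * t + b)) (at t)" for t
    unfolding f using has_vector_derivative_mult_right[OF has_vector_derivative_affine[OF smooth_deriv(1)[OF f(1)]], of c a b]
    by (simp add: mult.assoc)
  then show "\<exists>f'. (\<forall>t. (h has_vector_derivative f' t) (at t)) \<and>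
     ((\<exists>c f. smooth f \<and> f' = (\<lambda>t. c * f (a * t + b))) \<or> smooth f')"
    using smooth_deriv(2)[OF f(1)] by (intro exI[of _ "\<lambda>t. c * of_real a * vderiv f (a * t + b)"]) blast
qed

lemma test_fun_iff: "test_fun \<psi> \<longleftrightarrow> smooth \<psi> \<and> (\<exists>a. \<forall>t. \<bar>t\<bar> > a \<longrightarrow> \<psi> t = 0)"
proof -
  have "bounded {t. \<psi> t \<noteq> 0} \<longleftrightarrow> (\<exists>a. \<forall>t. \<bar>t\<bar> > a \<longrightarrow> \<psi> t = 0)"
    unfolding bounded_iff by (simp add: not_le[symmetric]) blast
  then show ?thesis by (simp add: test_fun_def smooth_def)
qed

lemma smooth_continuous: "smooth f \<Longrightarrow> continuous_on S f"
  using smooth_deriv(1)[of f] by (meson continuous_on_vector_derivative has_vector_derivative_at_within)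

lemma vderiv_compact_support:
  assumes "smooth f" "\<And>t. \<bar>t\<bar> > a \<Longrightarrow> f t = 0" "\<bar>t\<bar> > a"
  shows "vderiv f t = 0"
proof -
  have "open {s::real. \<bar>s\<bar> > a}"
    by (intro open_Collect_less continuous_intros)
  moreover have "((\<lambda>s. 0) has_vector_derivative 0) (at t)" by simp
  ultimately have "(f has_vector_derivative 0) (at t)"
    using has_vector_derivative_transform_within_open[of "\<lambda>_. 0" 0 t "{s. \<bar>s\<bar> > a}" f] assms by simp
  then show ?thesis by (simp add: vderiv_def vector_derivative_at)
qed

lemma test_fun_vderiv: "test_fun f \<Longrightarrow> test_fun (vderiv f)"
  unfolding test_fun_iff using smooth_deriv(2) vderiv_compact_support by metis

lemma test_fun_mult: "smooth f \<Longrightarrow> test_fun g \<Longrightarrow> test_fun (\<lambda>t. f t * g t)"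
  unfolding test_fun_iff using smooth_mult by fastforce

lemma test_fun_bounded:
  assumes "test_fun f" obtains D where "\<And>t. cmod (f t) \<le> D" "D \<ge> 0"
proof -
  obtain a where a: "\<forall>t. \<bar>t\<bar> > a \<longrightarrow> f t = 0" and s: "smooth f" using assms test_fun_iff by blast
  have "bounded (f ` {-a..a})"
    by (intro compact_imp_bounded compact_continuous_image smooth_continuous s) auto
  then obtain D where "\<forall>t\<in>{-a..a}. cmod (f t) \<le> D" by (auto simp: bounded_iff)
  then have "cmod (f t) \<le> max D 0" for t
    using a by (cases "\<bar>t\<bar> > a") (auto simp: abs_le_iff not_less le_max_iff_disj)
  then show thesis using that[of "max D 0"] by auto
qed

section \<open>The flat function exp (-1/t) and its derivatives\<close>

definition flat_exp_poly :: "real poly \<Rightarrow> real \<Rightarrow> real" where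
  "flat_exp_poly P t = (if t \<le> 0 then 0 else poly P (1 / t) * exp (- (1 / t)))"

lemma poly_mult_exp_tendsto_0: "((\<lambda>s. poly P s * exp (- s)) \<longlongrightarrow> 0) (at_top :: real filter)"
proof -
  have "((\<lambda>s. \<Sum>i\<le>degree P. coeff P i * (s ^ i / exp s)) \<longlongrightarrow> (\<Sum>i\<le>degree P. coeff P i * 0)) (at_top :: real filter)"
    by (intro tendsto_intros tendsto_power_div_exp_0)
  moreover have "(\<Sum>i\<le>degree P. coeff P i * (s ^ i / exp s)) = poly P s * exp (- s)" for s
    by (simp add: poly_altdef sum_distrib_right exp_minus field_simps sum_divide_distrib)
  ultimately show ?thesis by simp
qed

text \<open>With s = 1/t, the chain rule contributes the factor s^2, and differentiating P(s)
  exp(-s) gives P' - P up to sign. Hence the family indexed by polynomials is closed under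
  differentiation, also at the gluing point 0.\<close>

lemma flat_exp_poly_deriv:
  "(flat_exp_poly P has_real_derivative flat_exp_poly ([:0, 0, 1:] * (P - pderiv P)) t) (at t)"
proof -
  consider "t > 0" | "t < 0" | "t = 0" by linarith
  then show ?thesis
  proof cases
    case 1
    have "((\<lambda>t. poly P (1 / t) * exp (- (1 / t))) has_real_derivative
        flat_exp_poly ([:0, 0, 1:] * (P - pderiv P)) t) (at t)"
      using 1 unfolding flat_exp_poly_def
      by (auto intro!: derivative_eq_intros poly_DERIV simp: field_simps power2_eq_square)
    then show ?thesis
      by (rule has_field_derivative_transform_within_open[of _ _ _ "{0<..}"]) (use 1 in \<open>auto simp: flat_exp_poly_def\<close>)
  next
    case 2
    have "((\<lambda>t. 0) has_real_derivative 0) (at t)" by simp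
    then have "(flat_exp_poly P has_real_derivative 0) (at t)"
      by (rule has_field_derivative_transform_within_open[of _ _ _ "{..<0}"]) (use 2 in \<open>auto simp: flat_exp_poly_def\<close>)
    then show ?thesis using 2 by (simp add: flat_exp_poly_def)
  next
    case 3
    have "((\<lambda>t. flat_exp_poly P t / t) \<longlongrightarrow> 0) (at_right 0)"
    proof -
      \<comment> \<open>The difference quotient at 0 divides by \<open>t\<close>, which multiplies
        the polynomial in \<open>1 / t\<close> by its variable.\<close>
      have "((\<lambda>t. poly (pCons 0 P) (inverse t) * exp (- inverse t)) \<longlongrightarrow> 0) (at_right (0::real))"
        using filterlim_compose[OF poly_mult_exp_tendsto_0[of "pCons 0 P"] filterlim_inverse_at_top_right] by simp
      then show ?thesis
        by (rule Lim_transform_eventually)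
           (auto simp: eventually_at_right_less flat_exp_poly_def field_simps intro!: eventually_at_rightI[of 0 1])
    qed
    moreover have "((\<lambda>t. flat_exp_poly P t / t) \<longlongrightarrow> 0) (at_left 0)"
      by (rule Lim_transform_eventually[OF tendsto_const]) (auto simp: flat_exp_poly_def intro!: eventually_at_leftI[of "-1"])
    ultimately have "((\<lambda>t. flat_exp_poly P t / t) \<longlongrightarrow> 0) (at 0)"
      by (simp add: filterlim_split_at)
    then show ?thesis using 3 by (simp add: has_field_derivative_iff flat_exp_poly_def)
  qed
qed

definition flat_exp :: "real \<Rightarrow> complex" where
  "flat_exp t = of_real (flat_exp_poly 1 t)"

lemma smooth_flat_exp: "smooth flat_exp"
proof (rule smooth_coinduct[where X="\<lambda>f. \<exists>P. f = (\<lambda>t. of_real (flat_exp_poly P t))"])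
  fix f :: "real \<Rightarrow> complex" assume "\<exists>P. f = (\<lambda>t. of_real (flat_exp_poly P t))"
  then obtain P where f: "f = (\<lambda>t. of_real (flat_exp_poly P t))" by blast
  have "(f has_vector_derivative of_real (flat_exp_poly ([:0, 0, 1:] * (P - pderiv P)) t)) (at t)" for t
    unfolding f using flat_exp_poly_deriv
    by (simp add: has_vector_derivative_of_real has_real_derivative_iff_has_vector_derivative del: mult_pCons_left)
  then show "\<exists>f'. (\<forall>t. (f has_vector_derivative f' t) (at t)) \<and>
      ((\<exists>P. f' = (\<lambda>t. of_real (flat_exp_poly P t))) \<or> smooth f')"
    by (intro exI[of _ "\<lambda>t. of_real (flat_exp_poly ([:0, 0, 1:] * (P - pderiv P)) t)"] conjI allI disjI1) blast+
qed (rule exI[of _ 1], auto simp: flat_exp_def)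

lemma flat_exp_eq: "flat_exp t = (if t \<le> 0 then 0 else of_real (exp (- (1 / t))))"
  by (simp add: flat_exp_def flat_exp_poly_def)

section \<open>Local integrability\<close>

lemma borel_measurable_cnj:
  "f \<in> borel_measurable M \<Longrightarrow> (\<lambda>x. cnj (f x)) \<in> borel_measurable M"
  using measurable_compose[of f M borel cnj borel, OF _ borel_measurable_continuous_onI[OF continuous_on_cnj[OF continuous_on_id]]]
  by simp

text \<open>The function is the pointwise limit of its truncations to \<open>{-n..n}\<close>, which
  are integrable and hence measurable.\<close>

lemma locally_integrable_measurable:
  assumes "locally_integrable f" shows "f \<in> borel_measurable borel"
proof -
  have m: "(\<lambda>t. indicator {-real n..real n} t *\<^sub>R f t) \<in> borel_measurable borel" for n
  proof -
    have "integrable lborel (\<lambda>t. indicator {-real n..real n} t *\<^sub>R f t)"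
      using assms by (simp add: locally_integrable_def set_integrable_def)
    from borel_measurable_integrable[OF this] show ?thesis by simp
  qed
  have "(\<lambda>n. indicator {-real n..real n} t *\<^sub>R f t) \<longlonglongrightarrow> f t" for t
  proof -
    obtain N where N: "\<bar>t\<bar> \<le> real N" using real_arch_simple by blast
    have "indicator {-real n..real n} t *\<^sub>R f t = f t" if "n \<ge> N" for n
    proof -
      have "\<bar>t\<bar> \<le> real n" using N that by (meson of_nat_mono order_trans)
      then show ?thesis by (simp add: indicator_def abs_le_iff)
    qed
    then show ?thesis
      by (intro tendsto_eventually) (auto simp: eventually_sequentially)
  qed
  from borel_measurable_LIMSEQ_metric[OF m this] show ?thesis .
qed

lemma locally_integrable_on: "locally_integrable f \<Longrightarrow> set_integrable lborel {a..b} f"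
  by (simp add: locally_integrable_def)

lemma locally_integrableI:
  fixes g :: "real \<Rightarrow> real"
  assumes "\<And>a b. set_integrable lborel {a..b} g" "f \<in> borel_measurable borel"
    and "\<And>t. cmod (f t) \<le> norm (g t)"
  shows "locally_integrable f"
  unfolding locally_integrable_def
proof (intro allI)
  fix a b
  show "set_integrable lborel {a..b} f"
  proof (rule set_integrable_bound[OF assms(1)])
    show "set_borel_measurable lborel {a..b} f"
      using assms(2) by (simp add: set_borel_measurable_def)
    show "AE t\<in>{a..b} in lborel. cmod (f t) \<le> norm (g t)"
      by (intro AE_I2 impI assms(3))
  qed
qed

lemma locally_integrable_add:
  "locally_integrable f \<Longrightarrow> locally_integrable g \<Longrightarrow> locally_integrable (\<lambda>t. f t + g t)"
  by (simp add: locally_integrable_def)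

lemma locally_integrable_diff:
  "locally_integrable f \<Longrightarrow> locally_integrable g \<Longrightarrow> locally_integrable (\<lambda>t. f t - g t)"
  by (simp add: locally_integrable_def)

lemma locally_integrable_cnj:
  assumes "locally_integrable f" shows "locally_integrable (\<lambda>t. cnj (f t))"
proof (rule locally_integrableI[of "\<lambda>t. cmod (f t)"])
  show "set_integrable lborel {a..b} (\<lambda>t. cmod (f t))" for a b
    by (rule set_integrable_norm[OF locally_integrable_on[OF assms]])
  show "(\<lambda>t. cnj (f t)) \<in> borel_measurable borel"
    by (rule borel_measurable_cnj[OF locally_integrable_measurable[OF assms]])
  show "cmod (cnj (f t)) \<le> norm (cmod (f t))" for t
    by simp
qed

lemma locally_integrable_continuous_mult:
  assumes "continuous_on UNIV u" "locally_integrable f"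
  shows "locally_integrable (\<lambda>t. u t * f t)"
  unfolding locally_integrable_def
proof (intro allI)
  fix a b :: real
  have "bounded (u ` {a..b})"
    by (intro compact_imp_bounded compact_continuous_image continuous_on_subset[OF assms(1)]) auto
  then obtain D where D: "\<forall>t\<in>{a..b}. cmod (u t) \<le> D" by (auto simp: bounded_iff)
  have m: "u \<in> borel_measurable borel" "f \<in> borel_measurable borel"
    using assms borel_measurable_continuous_onI locally_integrable_measurable by auto
  have "set_integrable lborel {a..b} (\<lambda>t. of_real D * f t)"
    using assms(2) by (simp add: locally_integrable_def)
  then show "set_integrable lborel {a..b} (\<lambda>t. u t * f t)"
  proof (rule set_integrable_bound)
    show "AE t\<in>{a..b} in lborel. cmod (u t * f t) \<le> cmod (of_real D * f t)"
    proof (intro AE_I2 impI)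
      fix t assume "t \<in> {a..b}"
      then have "cmod (u t) \<le> \<bar>D\<bar>" using D by force
      then show "cmod (u t * f t) \<le> cmod (of_real D * f t)" by (simp add: norm_mult mult_right_mono)
    qed
  qed (use m in \<open>auto simp: set_borel_measurable_def\<close>)
qed

lemma locally_integrable_continuous:
  assumes "continuous_on UNIV u" shows "locally_integrable u"
  unfolding locally_integrable_def
  using borel_integrable_atLeastAtMost'[OF continuous_on_subset[OF assms]] by blast

lemma integrable_compact_support:
  assumes "locally_integrable f" "\<And>t. \<bar>t\<bar> > a \<Longrightarrow> f t = 0"
  shows "integrable lborel f" "(LINT t|lborel. f t) = (LINT t:{-a..a}|lborel. f t)"
proof -
  have e: "(\<lambda>t. indicator {-a..a} t *\<^sub>R f t) = f"
    using assms(2) by (fastforce simp: indicator_def abs_le_iff not_less[symmetric])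
  show "integrable lborel f" "(LINT t|lborel. f t) = (LINT t:{-a..a}|lborel. f t)"
    using locally_integrable_on[OF assms(1), of "-a" a] unfolding set_integrable_def set_lebesgue_integral_def e by auto
qed

section \<open>Locally square-integrable functions\<close>

definition L2_loc :: "(real \<Rightarrow> complex) \<Rightarrow> bool" where
  "L2_loc f \<longleftrightarrow> f \<in> borel_measurable borel \<and> (\<forall>a b. set_integrable lborel {a..b} (\<lambda>t. (cmod (f t))\<^sup>2))"

lemma L2_loc_measurable: "L2_loc f \<Longrightarrow> f \<in> borel_measurable borel"
  by (simp add: L2_loc_def)

lemma square_integrable_measurable: "square_integrable f \<Longrightarrow> f \<in> borel_measurable borel"
  by (simp add: square_integrable_def)

lemma square_integrable_imp_L2_loc: "square_integrable f \<Longrightarrow> L2_loc f"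
  unfolding square_integrable_def L2_loc_def
  using integrable_mult_indicator[of "{_.._}" lborel "\<lambda>t. (cmod (f t))\<^sup>2"]
  by (auto simp: set_integrable_def)

lemma L2_locI:
  assumes "\<And>a b. set_integrable lborel {a..b} g" "f \<in> borel_measurable borel"
    and "\<And>t. (cmod (f t))\<^sup>2 \<le> (g t :: real)"
  shows "L2_loc f"
  unfolding L2_loc_def
proof (intro conjI allI assms)
  fix a b
  show "set_integrable lborel {a..b} (\<lambda>t. (cmod (f t))\<^sup>2)"
  proof (rule set_integrable_bound[OF assms(1)])
    show "set_borel_measurable lborel {a..b} (\<lambda>t. (cmod (f t))\<^sup>2)"
      using assms(2) by (simp add: set_borel_measurable_def)
    show "AE t\<in>{a..b} in lborel. norm ((cmod (f t))\<^sup>2) \<le> norm (g t)"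
      using order_trans[OF assms(3) abs_ge_self] by (intro AE_I2 impI) simp
  qed
qed

lemma norm_add_squared_le: "(norm (x + y :: 'a :: real_normed_vector))\<^sup>2 \<le> 2 * (norm x)\<^sup>2 + 2 * (norm y)\<^sup>2"
proof -
  have "(norm (x + y))\<^sup>2 \<le> (norm x + norm y)\<^sup>2" by (intro power_mono norm_triangle_ineq) auto
  also have "\<dots> \<le> 2 * (norm x)\<^sup>2 + 2 * (norm y)\<^sup>2"
    using sum_squares_ge_zero[of "norm x - norm y" 0] by (simp add: power2_eq_square algebra_simps)
  finally show ?thesis .
qed

lemma L2_loc_add:
  assumes "L2_loc f" "L2_loc g" shows "L2_loc (\<lambda>t. f t + g t)"
  by (rule L2_locI[of "\<lambda>t. 2 * (cmod (f t))\<^sup>2 + 2 * (cmod (g t))\<^sup>2"])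
     (use assms norm_add_squared_le in \<open>auto simp: L2_loc_def intro!: set_integral_add\<close>)

lemma L2_loc_cmult: "L2_loc f \<Longrightarrow> L2_loc (\<lambda>t. c * f t)"
  by (rule L2_locI[of "\<lambda>t. (cmod c)\<^sup>2 * (cmod (f t))\<^sup>2"])
     (auto simp: L2_loc_def norm_mult power_mult_distrib)

lemma L2_loc_cnj: "L2_loc f \<Longrightarrow> L2_loc (\<lambda>t. cnj (f t))"
  by (rule L2_locI[of "\<lambda>t. (cmod (f t))\<^sup>2"]) (auto simp: L2_loc_def intro: borel_measurable_cnj)

lemma mult_le_sum_squares: "x * y \<le> (x\<^sup>2 + y\<^sup>2) / (2::real)"
  using sum_squares_ge_zero[of "x - y" 0] by (simp add: power2_eq_square algebra_simps)

lemma L2_loc_mult: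
  assumes "L2_loc f" "L2_loc g" shows "locally_integrable (\<lambda>t. f t * g t)"
proof (rule locally_integrableI[of "\<lambda>t. ((cmod (f t))\<^sup>2 + (cmod (g t))\<^sup>2) / 2"])
  show "cmod (f t * g t) \<le> norm (((cmod (f t))\<^sup>2 + (cmod (g t))\<^sup>2) / 2)" for t
    using mult_le_sum_squares[of "cmod (f t)" "cmod (g t)"] by (simp add: norm_mult)
qed (use assms in \<open>auto simp: L2_loc_def intro!: set_integral_add set_integrable_divide\<close>)

lemma L2_loc_continuous:
  assumes "continuous_on UNIV u" shows "L2_loc u"
  unfolding L2_loc_def
proof (intro conjI allI)
  show "u \<in> borel_measurable borel" using assms by (rule borel_measurable_continuous_onI)
  show "set_integrable lborel {a..b} (\<lambda>t. (cmod (u t))\<^sup>2)" for a b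
    by (intro borel_integrable_atLeastAtMost' continuous_intros continuous_on_subset[OF assms]) auto
qed

lemma L2_loc_imp_locally_integrable:
  assumes "L2_loc f" shows "locally_integrable f"
  using L2_loc_mult[OF L2_loc_continuous[of "\<lambda>_. 1"] assms] by simp

lemma L2_loc_squared: "L2_loc f \<Longrightarrow> locally_integrable (\<lambda>t. complex_of_real ((cmod (f t))\<^sup>2))"
  by (rule locally_integrableI[of "\<lambda>t. (cmod (f t))\<^sup>2"]) (auto simp: L2_loc_def norm_power)

lemma L2_loc_continuous_mult:
  assumes "continuous_on UNIV u" "L2_loc f" shows "L2_loc (\<lambda>t. u t * f t)"
proof -
  have c: "continuous_on UNIV (\<lambda>t. complex_of_real ((cmod (u t))\<^sup>2))"
    by (intro continuous_intros assms)
  have m: "u \<in> borel_measurable borel" "f \<in> borel_measurable borel"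
    using assms borel_measurable_continuous_onI L2_loc_measurable by auto
  have "set_integrable lborel {a..b} (\<lambda>t. norm (complex_of_real ((cmod (u t))\<^sup>2) * complex_of_real ((cmod (f t))\<^sup>2)))" for a b
    using locally_integrable_on[OF locally_integrable_continuous_mult[OF c L2_loc_squared[OF assms(2)]]]
    by (rule set_integrable_norm)
  then show ?thesis
    by (rule L2_locI) (use m in \<open>auto simp: norm_mult norm_power power_mult_distrib\<close>)
qed

lemma L2_loc_compact_support:
  assumes "L2_loc f" "\<And>t. \<bar>t\<bar> > a \<Longrightarrow> f t = 0" shows "square_integrable f"
proof -
  have "integrable lborel (\<lambda>t. complex_of_real ((cmod (f t))\<^sup>2))"
    by (rule integrable_compact_support(1)[OF L2_loc_squared[OF assms(1)], of a]) (simp add: assms)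
  then have "integrable lborel (\<lambda>t. (cmod (f t))\<^sup>2)"
    by (simp only: complex_of_real_integrable_eq)
  then show ?thesis using assms(1) by (simp add: square_integrable_def L2_loc_def)
qed

section \<open>Locally absolutely continuous functions\<close>

text \<open>Local absolute continuity, encoded by the fundamental theorem of calculus with the
  derivative as an explicit second argument. Differentiability almost everywhere never has to be
  discussed, and \<open>u\<close> has genuine point values.\<close>

definition ac_deriv :: "(real \<Rightarrow> complex) \<Rightarrow> (real \<Rightarrow> complex) \<Rightarrow> bool" where
  "ac_deriv u g \<longleftrightarrow> locally_integrable g \<and> (\<forall>a b. a \<le> b \<longrightarrow> (LINT t:{a..b}|lborel. g t) = u b - u a)"

lemma ac_deriv_continuous:
  assumes "ac_deriv u g" shows "continuous_on S u"
proof -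
  have "continuous (at x) u" for x
  proof -
    have i: "g integrable_on {x - 1..b}" for b
      using assms set_borel_integral_eq_integral(1) by (auto simp: ac_deriv_def locally_integrable_def)
    have "continuous_on {x - 1..x + 1} (\<lambda>y. u (x - 1) + integral {x - 1..y} g)"
      by (intro continuous_intros indefinite_integral_continuous_1 i)
    also have "?this \<longleftrightarrow> continuous_on {x - 1..x + 1} u"
    proof (intro continuous_on_cong refl)
      fix y assume "y \<in> {x - 1..x + 1}"
      moreover have "set_integrable lborel {x - 1..y} g"
        using assms by (simp add: ac_deriv_def locally_integrable_def)
      ultimately show "u (x - 1) + integral {x - 1..y} g = u y"
        using assms set_borel_integral_eq_integral(2)[of "{x - 1..y}" g]
        by (auto simp: ac_deriv_def) (metis add_diff_cancel_left' add_diff_eq)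
    qed
    finally show ?thesis by (rule continuous_on_interior) simp
  qed
  then show ?thesis by (simp add: continuous_at_imp_continuous_on)
qed

lemma ac_deriv_locally_integrable:
  assumes "ac_deriv u g" shows "locally_integrable g" "locally_integrable u"
  using assms locally_integrable_continuous[OF ac_deriv_continuous[OF assms]] by (simp_all add: ac_deriv_def)

lemma ac_deriv_measurable:
  assumes "ac_deriv u g" shows "u \<in> borel_measurable borel" "g \<in> borel_measurable borel"
  using ac_deriv_locally_integrable[OF assms] locally_integrable_measurable by simp_all

lemma ac_deriv_add: "ac_deriv u g \<Longrightarrow> ac_deriv v h \<Longrightarrow> ac_deriv (\<lambda>t. u t + v t) (\<lambda>t. g t + h t)"
  by (auto simp: ac_deriv_def locally_integrable_def)

lemma ac_deriv_cmult: "ac_deriv u g \<Longrightarrow> ac_deriv (\<lambda>t. c * u t) (\<lambda>t. c * g t)"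
  by (auto simp: ac_deriv_def locally_integrable_def right_diff_distrib)

lemma ac_deriv_cnj: "ac_deriv u g \<Longrightarrow> ac_deriv (\<lambda>t. cnj (u t)) (\<lambda>t. cnj (g t))"
proof -
  have "(LINT t:A|lborel. cnj (g t)) = cnj (LINT t:A|lborel. g t)" for A
  proof -
    have "(LINT t|lborel. indicator A t *\<^sub>R cnj (g t)) = (LINT t|lborel. cnj (indicator A t *\<^sub>R g t))"
      by simp
    then show ?thesis unfolding set_lebesgue_integral_def by (simp only: Bochner_Integration.integral_cnj)
  qed
  then show "ac_deriv u g \<Longrightarrow> ac_deriv (\<lambda>t. cnj (u t)) (\<lambda>t. cnj (g t))"
    using locally_integrable_cnj[of g] by (simp add: ac_deriv_def)
qed

lemma ac_derivI:
  assumes "\<And>t. (u has_vector_derivative g t) (at t)" "continuous_on UNIV g"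
  shows "ac_deriv u g"
  unfolding ac_deriv_def
proof (intro conjI allI impI)
  show "locally_integrable g" by (rule locally_integrable_continuous[OF assms(2)])
  fix a b :: real assume "a \<le> b"
  then show "(LINT t:{a..b}|lborel. g t) = u b - u a"
    unfolding set_lebesgue_integral_def
    by (rule integral_FTC_Icc)
       (use has_vector_derivative_at_within[OF assms(1)] continuous_on_subset[OF assms(2)] in auto)
qed

lemma ac_deriv_smooth: "smooth f \<Longrightarrow> ac_deriv f (vderiv f)"
  by (intro ac_derivI smooth_deriv smooth_continuous)

lemma ac_deriv_integral:
  assumes "locally_integrable g"
  obtains u where "ac_deriv u g" "u c = 0"
proof -
  \<comment> \<open>At least one of the two intervals is empty or a single point, so this is the
    oriented integral from \<open>c\<close> to \<open>t\<close>.\<close>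
  define u where "u t = (LINT s:{c..t}|lborel. g s) - (LINT s:{t..c}|lborel. g s)" for t
  have uc: "u c = 0" by (simp add: u_def)
  have *: "(LINT s:{a..b}|lborel. g s) + (LINT s:{b..d}|lborel. g s) = (LINT s:{a..d}|lborel. g s)"
    if "a \<le> b" "b \<le> d" for a b d
  proof -
    have "(LINT s:{a..b} \<union> {b..d}|lborel. g s) = (LINT s:{a..b}|lborel. g s) + (LINT s:{b..d}|lborel. g s)"
    proof (rule set_integral_Un_AE)
      show "AE x in lborel. \<not> (x \<in> {a..b} \<and> x \<in> {b..d})"
        using AE_lborel_singleton[of b] by eventually_elim auto
    qed (use assms in \<open>auto simp: locally_integrable_def\<close>)
    moreover have "{a..b} \<union> {b..d} = {a..d}" using that by auto
    ultimately show ?thesis by simp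
  qed
  have z: "(LINT s:{a..b}|lborel. g s) = 0" if "b \<le> a" for a b
  proof (cases "b = a")
    case True
    then show ?thesis using *[of a a a] by simp
  qed (use that in \<open>simp add: set_lebesgue_integral_def\<close>)
  have "ac_deriv u g"
    unfolding ac_deriv_def
  proof (intro conjI allI impI assms)
    fix a b :: real assume "a \<le> b"
    consider "c \<le> a" | "b \<le> c" | "a \<le> c" "c \<le> b" using \<open>a \<le> b\<close> by linarith
    then show "(LINT t:{a..b}|lborel. g t) = u b - u a"
    proof cases
      case 1 then show ?thesis using *[of c a b] z[of c a] z[of c b] \<open>a \<le> b\<close> by (simp add: u_def algebra_simps)
    next
      case 2 then show ?thesis using *[of a b c] z[of b c] z[of a c] \<open>a \<le> b\<close> by (simp add: u_def algebra_simps)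
    next
      case 3 then show ?thesis using *[of a c b] z[of a c] z[of c b] by (simp add: u_def algebra_simps)
    qed
  qed
  then show thesis using uc by (rule that)
qed

lemma ac_deriv_unique:
  assumes "ac_deriv u g" "ac_deriv v g" "u c = v c" shows "u = v"
proof (rule ext)
  fix t
  show "u t = v t"
  proof (cases "c \<le> t")
    case True
    then have "u t - u c = v t - v c" using assms(1,2) unfolding ac_deriv_def by metis
    then show ?thesis using assms(3) by simp
  next
    case False
    then have "u c - u t = v c - v t" using assms(1,2) unfolding ac_deriv_def by (metis nle_le)
    then show ?thesis using assms(3) by simp
  qed
qed

text \<open>Fubini for \<open>G s * H t\<close>, with the plane cut along the diagonal. Both halves
  contain the diagonal, which is harmless because for fixed \<open>s\<close> it is a single
  point.\<close>

lemma integral_triangle: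
  fixes G H :: "real \<Rightarrow> complex"
  assumes [measurable]: "integrable lborel G" "integrable lborel H"
  shows "(LINT t|lborel. (LINT s:{..t}|lborel. G s) * H t) + (LINT s|lborel. G s * (LINT t:{..s}|lborel. H t))
    = (LINT s|lborel. G s) * (LINT t|lborel. H t)"
    and "integrable lborel (\<lambda>t. (LINT s:{..t}|lborel. G s) * H t)"
    and "integrable lborel (\<lambda>s. G s * (LINT t:{..s}|lborel. H t))"
proof -
  have [measurable]: "G \<in> borel_measurable borel" "H \<in> borel_measurable borel"
    using assms borel_measurable_integrable by auto
  have int_prod: "integrable (lborel \<Otimes>\<^sub>M lborel) (case_prod (\<lambda>s t. G s * H t))"
  proof (rule lborel_pair.Fubini_integrable)
    show "integrable lborel (\<lambda>x. LINT y|lborel. norm (case_prod (\<lambda>s t. G s * H t) (x, y)))"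
      using assms by (simp add: norm_mult)
  qed (use assms in \<open>auto intro!: AE_I2\<close>)
  define F where "F s t = (if s \<le> t then G s * H t else 0)" for s t
  define F' where "F' s t = (if t \<le> s then G s * H t else 0)" for s t
  have iF: "integrable (lborel \<Otimes>\<^sub>M lborel) (case_prod F)" "integrable (lborel \<Otimes>\<^sub>M lborel) (case_prod F')"
  proof -
    have [measurable]: "case_prod F \<in> borel_measurable (lborel \<Otimes>\<^sub>M lborel)"
      "case_prod F' \<in> borel_measurable (lborel \<Otimes>\<^sub>M lborel)"
      unfolding F_def[abs_def] F'_def[abs_def] by measurable
    show "integrable (lborel \<Otimes>\<^sub>M lborel) (case_prod F)" "integrable (lborel \<Otimes>\<^sub>M lborel) (case_prod F')"
      by (rule Bochner_Integration.integrable_bound[OF int_prod]; auto simp: F_def F'_def)+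
  qed
  have a: "(LINT s|lborel. F s t) = (LINT s:{..t}|lborel. G s) * H t" for t
    by (simp add: set_lebesgue_integral_def F_def flip: Bochner_Integration.integral_mult_left_zero)
       (auto intro!: Bochner_Integration.integral_cong simp: indicator_def)
  have b: "(LINT t|lborel. F' s t) = G s * (LINT t:{..s}|lborel. H t)" for s
    by (simp add: set_lebesgue_integral_def F'_def flip: Bochner_Integration.integral_mult_right_zero)
       (auto intro!: Bochner_Integration.integral_cong simp: indicator_def)
  have c: "(LINT t|lborel. F s t) + (LINT t|lborel. F' s t) = G s * (LINT t|lborel. H t)" for s
  proof -
    have i: "integrable lborel (F s)" "integrable lborel (F' s)"
      unfolding F_def[abs_def] F'_def[abs_def]
      by (rule Bochner_Integration.integrable_bound[of lborel "\<lambda>t. G s * H t"], use assms in auto)+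
    have "(LINT t|lborel. F s t) + (LINT t|lborel. F' s t) = (LINT t|lborel. F s t + F' s t)"
      using i by simp
    also have "\<dots> = (LINT t|lborel. G s * H t)"
    proof (rule integral_cong_AE)
      show "AE t in lborel. F s t + F' s t = G s * H t"
        using AE_lborel_singleton[of s] by eventually_elim (auto simp: F_def F'_def)
    qed (auto simp: F_def F'_def)
    finally show ?thesis by simp
  qed
  show "integrable lborel (\<lambda>t. (LINT s:{..t}|lborel. G s) * H t)"
    using lborel_pair.integrable_snd[OF iF(1)] by (simp add: a)
  show i2: "integrable lborel (\<lambda>s. G s * (LINT t:{..s}|lborel. H t))"
    using lborel_pair.integrable_fst[OF iF(2)] by (simp add: b)
  have i1: "integrable lborel (\<lambda>s. LINT t|lborel. F s t)"
    using lborel_pair.integrable_fst[OF iF(1)] by simp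
  have "(LINT t|lborel. (LINT s:{..t}|lborel. G s) * H t) = (LINT t|lborel. LINT s|lborel. F s t)"
    by (simp add: a)
  also have "\<dots> = (LINT s|lborel. LINT t|lborel. F s t)"
    by (rule lborel_pair.Fubini_integral[OF iF(1)])
  finally have "(LINT t|lborel. (LINT s:{..t}|lborel. G s) * H t) + (LINT s|lborel. G s * (LINT t:{..s}|lborel. H t))
    = (LINT s|lborel. (LINT t|lborel. F s t) + (LINT t|lborel. F' s t))"
    using i1 i2 by (simp add: b)
  then show "(LINT t|lborel. (LINT s:{..t}|lborel. G s) * H t) + (LINT s|lborel. G s * (LINT t:{..s}|lborel. H t))
    = (LINT s|lborel. G s) * (LINT t|lborel. H t)"
    by (simp add: c)
qed

text \<open>\<open>integral_triangle\<close> for the derivatives restricted to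
  \<open>{a..b}\<close>: the inner integrals are the increments \<open>u t - u a\<close> and
  \<open>v t - v a\<close>, and rearranging the resulting identity is integration by parts.\<close>

lemma ac_deriv_mult:
  assumes u: "ac_deriv u g" and v: "ac_deriv v h"
  shows "ac_deriv (\<lambda>t. u t * v t) (\<lambda>t. g t * v t + u t * h t)"
  unfolding ac_deriv_def
proof (intro conjI allI impI)
  have l: "locally_integrable (\<lambda>t. g t * v t)" "locally_integrable (\<lambda>t. u t * h t)"
    using locally_integrable_continuous_mult[OF ac_deriv_continuous[OF v] ac_deriv_locally_integrable(1)[OF u]]
      locally_integrable_continuous_mult[OF ac_deriv_continuous[OF u] ac_deriv_locally_integrable(1)[OF v]]
    by (auto simp: mult.commute)
  show "locally_integrable (\<lambda>t. g t * v t + u t * h t)"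
    by (rule locally_integrable_add[OF l])
  fix a b :: real assume ab: "a \<le> b"
  define G where "G t = indicator {a..b} t *\<^sub>R g t" for t
  define H where "H t = indicator {a..b} t *\<^sub>R h t" for t
  have GH: "integrable lborel G" "integrable lborel H"
    using ac_deriv_locally_integrable(1)[OF u] ac_deriv_locally_integrable(1)[OF v]
    by (auto simp: locally_integrable_def set_integrable_def G_def[abs_def] H_def[abs_def])
  have G1: "(LINT s:{..t}|lborel. G s) = u t - u a" if "t \<in> {a..b}" for t
  proof -
    have "(LINT s:{..t}|lborel. G s) = (LINT s:{a..t}|lborel. g s)"
      using that unfolding set_lebesgue_integral_def G_def
      by (intro Bochner_Integration.integral_cong) (auto simp: indicator_def)
    then show ?thesis using u that by (simp add: ac_deriv_def)
  qed
  have H1: "(LINT s:{..t}|lborel. H s) = v t - v a" if "t \<in> {a..b}" for t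
  proof -
    have "(LINT s:{..t}|lborel. H s) = (LINT s:{a..t}|lborel. h s)"
      using that unfolding set_lebesgue_integral_def H_def
      by (intro Bochner_Integration.integral_cong) (auto simp: indicator_def)
    then show ?thesis using v that by (simp add: ac_deriv_def)
  qed
  have 1: "(LINT t|lborel. (LINT s:{..t}|lborel. G s) * H t) = (LINT t:{a..b}|lborel. (u t - u a) * h t)"
    unfolding set_lebesgue_integral_def[of lborel "{a..b}"]
    by (intro Bochner_Integration.integral_cong refl) (auto simp: G1 H_def indicator_def)
  have 2: "(LINT s|lborel. G s * (LINT t:{..s}|lborel. H t)) = (LINT t:{a..b}|lborel. g t * (v t - v a))"
    unfolding set_lebesgue_integral_def[of lborel "{a..b}"]
    by (intro Bochner_Integration.integral_cong refl) (auto simp: H1 G_def indicator_def)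
  have ig: "(LINT t|lborel. G t) = u b - u a" "(LINT t|lborel. H t) = v b - v a"
    using u v ab by (auto simp: G_def H_def ac_deriv_def set_lebesgue_integral_def)
  have si: "set_integrable lborel {a..b} (\<lambda>t. g t * v t)" "set_integrable lborel {a..b} (\<lambda>t. u t * h t)"
    "set_integrable lborel {a..b} g" "set_integrable lborel {a..b} h"
    using l u v by (simp_all add: locally_integrable_def ac_deriv_def)
  have e1: "(LINT t:{a..b}|lborel. (u t - u a) * h t) = (LINT t:{a..b}|lborel. u t * h t) - u a * (v b - v a)"
    using si v ab by (simp add: left_diff_distrib ac_deriv_def)
  have e2: "(LINT t:{a..b}|lborel. g t * (v t - v a)) = (LINT t:{a..b}|lborel. g t * v t) - (u b - u a) * v a"
    using si u ab by (simp add: right_diff_distrib ac_deriv_def)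
  have e: "(LINT t:{a..b}|lborel. u t * h t) - u a * (v b - v a) + ((LINT t:{a..b}|lborel. g t * v t) - (u b - u a) * v a)
      = (u b - u a) * (v b - v a)"
    using integral_triangle(1)[OF GH] unfolding 1 2 ig e1 e2 .
  have "(LINT t:{a..b}|lborel. g t * v t + u t * h t) = (LINT t:{a..b}|lborel. g t * v t) + (LINT t:{a..b}|lborel. u t * h t)"
    using l by (simp add: locally_integrable_def)
  then show "(LINT t:{a..b}|lborel. g t * v t + u t * h t) = u b * v b - u a * v a"
    using e by (simp add: algebra_simps)
qed

lemma ac_deriv_integral_zero:
  assumes "ac_deriv u g" "\<And>t. \<bar>t\<bar> > a \<Longrightarrow> u t = 0" "\<And>t. \<bar>t\<bar> > a \<Longrightarrow> g t = 0"
  shows "integrable lborel g" "(LINT t|lborel. g t) = 0"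
proof -
  show "integrable lborel g"
    using integrable_compact_support(1)[of g a] assms by (simp add: ac_deriv_def)
  \<comment> \<open>The endpoints are moved out because \<open>u\<close> vanishes only strictly
    beyond \<open>a\<close>, and \<open>a\<close> may be negative.\<close>
  have "(LINT t|lborel. g t) = (LINT t:{-(\<bar>a\<bar> + 1)..\<bar>a\<bar> + 1}|lborel. g t)"
    using integrable_compact_support(2)[of g "\<bar>a\<bar> + 1"] assms by (simp add: ac_deriv_def)
  also have "\<dots> = u (\<bar>a\<bar> + 1) - u (-(\<bar>a\<bar> + 1))"
    using assms(1) by (simp add: ac_deriv_def)
  also have "\<dots> = 0" using assms(2) by simp
  finally show "(LINT t|lborel. g t) = 0" .
qed

lemma ac_deriv_has_vector_derivative:
  assumes "ac_deriv u g" "continuous_on UNIV g"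
  shows "(u has_vector_derivative g x) (at x)"
proof -
  have "((\<lambda>y. integral {x - 1..y} g) has_vector_derivative g x) (at x within {x - 1..x + 1})"
    by (rule integral_has_vector_derivative[OF continuous_on_subset[OF assms(2)]]) auto
  then have "((\<lambda>y. integral {x - 1..y} g) has_vector_derivative g x) (at x)"
    by (subst (asm) at_within_Icc_at) auto
  then have d: "((\<lambda>y. u (x - 1) + integral {x - 1..y} g) has_vector_derivative g x) (at x)"
    using has_vector_derivative_add[OF has_vector_derivative_const] by fastforce
  have e: "u (x - 1) + integral {x - 1..y} g = u y" if "y \<in> {x - 1<..<x + 1}" for y
  proof -
    have "set_integrable lborel {x - 1..y} g"
      using assms(1) by (simp add: ac_deriv_def locally_integrable_def)
    then have "integral {x - 1..y} g = u y - u (x - 1)"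
      using assms(1) that set_borel_integral_eq_integral(2)[of "{x - 1..y}" g]
      by (simp add: ac_deriv_def)
    then show ?thesis by simp
  qed
  show ?thesis
    by (rule has_vector_derivative_transform_within_open[OF d, of "{x - 1<..<x + 1}"]) (use e in auto)
qed

section \<open>Test functions\<close>

lemma test_fun_continuous: "test_fun \<psi> \<Longrightarrow> continuous_on S \<psi>"
  by (simp add: test_fun_iff smooth_continuous)

lemma test_fun_measurable: "test_fun \<psi> \<Longrightarrow> \<psi> \<in> borel_measurable borel"
  by (rule borel_measurable_continuous_onI[OF test_fun_continuous])

text \<open>A flat exponential rising at \<open>c\<close> times one falling at \<open>d\<close>. The
  factor \<open>Suc n\<close> makes both steeper, so that these functions tend to the indicator of
  the open interval from below.\<close>

definition interval_test :: "real \<Rightarrow> real \<Rightarrow> nat \<Rightarrow> real \<Rightarrow> complex" where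
  "interval_test c d n t = flat_exp (real (Suc n) * t + - (real (Suc n) * c)) * flat_exp (- real (Suc n) * t + real (Suc n) * d)"

lemma interval_test_eq:
  "interval_test c d n t = (if c < t \<and> t < d then
     of_real (exp (- (1 / (real (Suc n) * (t - c)))) * exp (- (1 / (real (Suc n) * (d - t))))) else 0)"
proof -
  have "real (Suc n) * t + - (real (Suc n) * c) = real (Suc n) * (t - c)"
    "- real (Suc n) * t + real (Suc n) * d = real (Suc n) * (d - t)"
    by (simp_all add: algebra_simps)
  then show ?thesis
    unfolding interval_test_def flat_exp_eq by (simp add: mult_le_0_iff not_le not_less)
qed

lemma test_fun_interval_test: "test_fun (interval_test c d n)"
  unfolding test_fun_iff
proof
  show "smooth (interval_test c d n)"
    unfolding interval_test_def[abs_def] by (intro smooth_mult smooth_affine smooth_flat_exp)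
  show "\<exists>a. \<forall>t. a < \<bar>t\<bar> \<longrightarrow> interval_test c d n t = 0"
    by (intro exI[of _ "\<bar>c\<bar> + \<bar>d\<bar>"]) (auto simp: interval_test_eq)
qed

lemma norm_interval_test: "cmod (interval_test c d n t) \<le> indicator {c<..<d} t"
proof (cases "c < t \<and> t < d")
  case True
  then have "exp (- (1 / (real (Suc n) * (t - c)))) * exp (- (1 / (real (Suc n) * (d - t)))) \<le> 1 * (1 :: real)"
    by (intro mult_mono) auto
  then show ?thesis using True by (simp add: interval_test_eq norm_mult)
qed (auto simp: interval_test_eq)

lemma interval_test_tendsto: "(\<lambda>n. interval_test c d n t) \<longlonglongrightarrow> indicator {c<..<d} t"
proof (cases "c < t \<and> t < d")
  case True
  have e: "(\<lambda>n. exp (- (1 / (real (Suc n) * s)))) \<longlonglongrightarrow> 1" if "s > 0" for s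
  proof -
    have "(\<lambda>n. exp (- (inverse (real (Suc n)) * (1 / s)))) \<longlonglongrightarrow> exp (- (0 * (1 / s)))"
      by (intro tendsto_intros LIMSEQ_inverse_real_of_nat)
    then show ?thesis using that by (simp add: field_simps)
  qed
  have "(\<lambda>n. complex_of_real (exp (- (1 / (real (Suc n) * (t - c)))) * exp (- (1 / (real (Suc n) * (d - t)))))) \<longlonglongrightarrow> of_real (1 * 1)"
    by (intro tendsto_intros e) (use True in auto)
  then show ?thesis using True by (simp add: interval_test_eq)
next
  case False
  then show ?thesis by (auto simp: interval_test_eq)
qed

section \<open>Set functions vanishing on intervals, and the fundamental lemma of the calculus of
  variations\<close>

lemma borel_eq_box_real: "borel = sigma UNIV (range (\<lambda>(a, b). {a<..<b::real}))"
  using borel_eq_box[where 'a=real] by (simp add: box_real)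

text \<open>Dynkin's argument, stated for an abstract complex set function because it serves twice:
  for set integrals of a function, and for a functional on \<open>L2\<close> evaluated at
  indicators. Countable additivity appears as finite additivity plus continuity along increasing
  sequences.\<close>

lemma countably_additive_eq_0:
  fixes \<Lambda> :: "real set \<Rightarrow> complex"
  assumes un: "\<And>A B. A \<in> sets borel \<Longrightarrow> B \<in> sets borel \<Longrightarrow> A \<inter> B = {} \<Longrightarrow> \<Lambda> (A \<union> B) = \<Lambda> A + \<Lambda> B"
    and lim: "\<And>B. range B \<subseteq> sets borel \<Longrightarrow> incseq B \<Longrightarrow> (\<lambda>n. \<Lambda> (B n)) \<longlonglongrightarrow> \<Lambda> (\<Union>n. B n)"
    and int: "\<And>c d. \<Lambda> {c<..<d} = 0" and A: "A \<in> sets borel"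
  shows "\<Lambda> A = 0"
proof -
  have UNIV: "\<Lambda> UNIV = 0"
  proof -
    have "incseq (\<lambda>n. {-real n<..<real n})"
      by (auto simp: incseq_def)
    moreover have "(\<Union>n. {-real n<..<real n}) = UNIV"
    proof -
      have "\<exists>n. t \<in> {-real n<..<real n}" for t
      proof -
        obtain n where "\<bar>t\<bar> < real n" using reals_Archimedean2 by blast
        then show ?thesis by (intro exI[of _ n]) auto
      qed
      then show ?thesis by auto
    qed
    ultimately have "(\<lambda>n. \<Lambda> {-real n<..<real n}) \<longlonglongrightarrow> \<Lambda> UNIV"
      using lim[of "\<lambda>n. {-real n<..<real n}"] by (simp add: image_subset_iff)
    then show ?thesis using int LIMSEQ_unique[OF _ tendsto_const] by force
  qed
  let ?G = "range (\<lambda>(a, b). {a<..<b::real})"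
  have A: "A \<in> sigma_sets UNIV ?G"
    using A by (simp add: borel_eq_box_real)
  have "Int_stable ?G"
  proof (rule Int_stableI)
    fix a b assume "a \<in> ?G" "b \<in> ?G"
    then obtain c d c' d' where "a = {c<..<d}" "b = {c'<..<d'}" by auto
    then have "a \<inter> b = {max c c'<..<min d d'}" by auto
    then show "a \<inter> b \<in> ?G" by auto
  qed
  moreover have "?G \<subseteq> Pow UNIV" by simp
  ultimately show ?thesis using A
  proof (induction rule: sigma_sets_induct_disjoint)
    case (basic A)
    then show ?case using int by auto
  next
    case empty
    then show ?case using int[of 0 0] by simp
  next
    case (compl A)
    then have "A \<in> sets borel" by (simp add: borel_eq_box_real)
    then show ?case using un[of A "UNIV - A"] UNIV compl by simp
  next
    case (union A)
    \<comment> \<open>The partial unions turn the disjoint union into an increasing one, to which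
      \<open>lim\<close> applies.\<close>
    define B where "B n = (\<Union>k<n. A k)" for n
    have A: "A n \<in> sets borel" for n using union(2) by (auto simp: borel_eq_box_real)
    have B: "B n \<in> sets borel" for n unfolding B_def using A by auto
    have "\<Lambda> (B n) = 0" for n
    proof (induction n)
      case 0
      then show ?case using int[of 0 0] by (simp add: B_def)
    next
      case (Suc n)
      have "A k \<inter> A n = {}" if "k < n" for k
        using disjoint_family_onD[OF union(1), of k n] that by simp
      then have "B n \<inter> A n = {}" unfolding B_def by blast
      moreover have "B (Suc n) = B n \<union> A n" by (auto simp: B_def less_Suc_eq)
      ultimately show ?case using un[OF B A] Suc union(3) by simp
    qed
    moreover have "(\<lambda>n. \<Lambda> (B n)) \<longlonglongrightarrow> \<Lambda> (\<Union>n. B n)"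
    proof (rule lim)
      show "incseq B" unfolding B_def incseq_def by (intro allI impI UN_mono) auto
    qed (use B in auto)
    moreover have "(\<Union>n. B n) = (\<Union>n. A n)" by (auto simp: B_def)
    ultimately show ?case using LIMSEQ_unique[OF _ tendsto_const] by force
  qed
qed

text \<open>The test functions \<open>interval_test\<close> converge to indicators under a
  dominating function, so \<open>h\<close> has integral zero over every bounded open interval;
  \<open>countably_additive_eq_0\<close> passes to Borel sets, and a function all of whose set
  integrals vanish is zero almost everywhere.\<close>

lemma AE_eq_0_if_test_integrals_eq_0:
  assumes h: "locally_integrable h" and z: "\<And>\<psi>. test_fun \<psi> \<Longrightarrow> (LINT t|lborel. h t * \<psi> t) = 0"
  shows "AE t in lborel. h t = 0"
proof -
  have [measurable]: "h \<in> borel_measurable borel" by (rule locally_integrable_measurable[OF h])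
  have [measurable]: "interval_test c d n \<in> borel_measurable borel" for c d n
    by (rule test_fun_measurable[OF test_fun_interval_test])
  have int0: "(LINT t:{c<..<d}|lborel. h t) = 0" for c d
  proof -
    have "(\<lambda>n. LINT t|lborel. h t * interval_test c d n t) \<longlonglongrightarrow> (LINT t|lborel. h t * indicator {c<..<d} t)"
    proof (rule integral_dominated_convergence[where w="\<lambda>t. norm (indicator {c..d} t *\<^sub>R h t)"])
      show "integrable lborel (\<lambda>t. norm (indicator {c..d} t *\<^sub>R h t))"
        using locally_integrable_on[OF h] unfolding set_integrable_def by (rule integrable_norm)
      show "AE t in lborel. (\<lambda>n. h t * interval_test c d n t) \<longlonglongrightarrow> h t * indicator {c<..<d} t"
        by (intro AE_I2 tendsto_mult[OF tendsto_const interval_test_tendsto])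
      show "AE t in lborel. norm (h t * interval_test c d n t) \<le> norm (indicator {c..d} t *\<^sub>R h t)" for n
      proof (intro AE_I2)
        fix t
        have "cmod (h t) * cmod (interval_test c d n t) \<le> cmod (h t) * indicator {c<..<d} t"
          by (intro mult_left_mono norm_interval_test) auto
        then show "norm (h t * interval_test c d n t) \<le> norm (indicator {c..d} t *\<^sub>R h t)"
          using mult_left_mono[OF norm_interval_test[of c d n t], of "cmod (h t)"]
          by (cases "t \<in> {c<..<d}") (auto simp: norm_mult indicator_def interval_test_eq)
      qed
    qed auto
    then have "(LINT t|lborel. h t * indicator {c<..<d} t) = 0"
      using z[OF test_fun_interval_test] LIMSEQ_unique[OF _ tendsto_const] by force
    moreover have "(LINT t|lborel. h t * indicator {c<..<d} t) = (LINT t:{c<..<d}|lborel. h t)"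
      unfolding set_lebesgue_integral_def
      by (intro Bochner_Integration.integral_cong) (auto simp: indicator_def)
    ultimately show ?thesis by simp
  qed
  have "AE t in lborel. indicator {-real n<..<real n} t *\<^sub>R h t = 0" for n
  proof (rule sigma_finite_measure.density_zero[OF lborel.sigma_finite_measure_axioms])
    let ?f = "\<lambda>t. indicator {-real n<..<real n} t *\<^sub>R h t"
    have "set_integrable lborel {-real n<..<real n} h"
      by (rule set_integrable_subset[OF locally_integrable_on[OF h, of "-real n" "real n"]]) auto
    then show i: "integrable lborel ?f" by (simp add: set_integrable_def)
    fix A :: "real set" assume "A \<in> sets lborel"
    show "set_lebesgue_integral lborel A ?f = 0"
    proof (rule countably_additive_eq_0[where \<Lambda>="\<lambda>A. set_lebesgue_integral lborel A ?f"])
      fix B :: "nat \<Rightarrow> real set" assume B: "range B \<subseteq> sets borel" "incseq B"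
      show "(\<lambda>n. set_lebesgue_integral lborel (B n) ?f) \<longlonglongrightarrow> set_lebesgue_integral lborel (\<Union>n. B n) ?f"
      proof (rule set_integral_cont_up)
        show "set_integrable lborel (\<Union>n. B n) ?f"
          unfolding set_integrable_def by (rule integrable_mult_indicator) (use B i in auto)
      qed (use B in auto)
    next
      fix A B :: "real set" assume "A \<in> sets borel" "B \<in> sets borel" "A \<inter> B = {}"
      then show "set_lebesgue_integral lborel (A \<union> B) ?f = set_lebesgue_integral lborel A ?f + set_lebesgue_integral lborel B ?f"
      proof (intro set_integral_Un)
        show "set_integrable lborel A ?f" "set_integrable lborel B ?f"
          unfolding set_integrable_def
          by (rule integrable_mult_indicator[OF _ i], simp add: \<open>A \<in> sets borel\<close> \<open>B \<in> sets borel\<close>)+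
      qed simp
    next
      fix c d :: real
      have "set_lebesgue_integral lborel {c<..<d} ?f = (LINT t:{max c (-real n)<..<min d (real n)}|lborel. h t)"
        unfolding set_lebesgue_integral_def
        by (intro Bochner_Integration.integral_cong) (auto simp: indicator_def)
      then show "set_lebesgue_integral lborel {c<..<d} ?f = 0" by (simp add: int0)
    qed (use \<open>A \<in> sets lborel\<close> in simp)
  qed
  then have "AE t in lborel. \<forall>n. indicator {-real n<..<real n} t *\<^sub>R h t = 0"
    by (intro AE_all_countable[THEN iffD2] allI)
  then show ?thesis
  proof eventually_elim
    case (elim t)
    obtain n where "\<bar>t\<bar> < real n" using reals_Archimedean2 by blast
    then show ?case using elim[rule_format, of n] by (auto simp: indicator_def abs_less_iff split: if_splits)
  qed
qed

section \<open>Test functions of unit mass and plateau functions\<close>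

lemma unit_mass_test_fun:
  obtains b where "test_fun b" "\<And>t. \<bar>t\<bar> \<ge> 1 \<Longrightarrow> b t = 0" "(LINT t|lborel. b t) = 1"
proof -
  let ?b = "interval_test (-1) 1 0"
  have tb: "test_fun ?b" by (rule test_fun_interval_test)
  have m: "?b \<in> borel_measurable borel"
    by (rule test_fun_measurable[OF tb])
  have nz: "(LINT t|lborel. ?b t) \<noteq> 0"
  proof
    assume "(LINT t|lborel. ?b t) = 0"
    have e: "?b t = of_real (cmod (?b t))" for t by (simp add: interval_test_eq norm_mult)
    have i: "integrable lborel ?b"
      by (rule integrable_compact_support(1)[of _ 1]) (use tb in \<open>auto simp: test_fun_iff interval_test_eq intro: locally_integrable_continuous smooth_continuous\<close>)
    have "complex_of_real (LINT t|lborel. cmod (?b t)) = (LINT t|lborel. ?b t)"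
      by (subst (2) e) simp
    then have "(LINT t|lborel. cmod (?b t)) = 0"
      using \<open>(LINT t|lborel. ?b t) = 0\<close> by simp
    then have "AE t in lborel. cmod (?b t) = 0"
      using i by (subst (asm) integral_nonneg_eq_0_iff_AE) auto
    then have "AE t in lborel. t \<notin> {-1<..<1::real}"
      by (rule eventually_mono) (auto simp: interval_test_eq)
    then have "{-1<..<1::real} \<in> null_sets lborel"
      by (subst (asm) AE_iff_null_sets[symmetric]) auto
    then show False by (simp add: null_sets_def)
  qed
  show thesis
  proof (rule that)
    show "test_fun (\<lambda>t. inverse (LINT t|lborel. ?b t) * ?b t)"
      by (intro test_fun_mult smooth_const tb)
    show "(LINT t|lborel. inverse (LINT t|lborel. ?b t) * ?b t) = 1"
      using nz by simp
    show "inverse (LINT t|lborel. ?b t) * ?b t = 0" if "\<bar>t\<bar> \<ge> 1" for t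
      using that by (auto simp: interval_test_eq[of _ _ _ t])
  qed
qed

definition bump :: "real \<Rightarrow> complex" where
  "bump = (SOME \<psi>. smooth \<psi> \<and> (\<forall>t. \<bar>t\<bar> \<le> 1 \<longrightarrow> \<psi> t = 1) \<and> (\<forall>t. \<bar>t\<bar> \<ge> 2 \<longrightarrow> \<psi> t = 0))"

lemma bump_props: "smooth bump \<and> (\<forall>t. \<bar>t\<bar> \<le> 1 \<longrightarrow> bump t = 1) \<and> (\<forall>t. \<bar>t\<bar> \<ge> 2 \<longrightarrow> bump t = 0)"
proof -
  obtain b where b: "test_fun b" "\<And>t. \<bar>t\<bar> \<ge> 1 \<Longrightarrow> b t = 0" "(LINT t|lborel. b t) = 1"
    by (rule unit_mass_test_fun) blast
  have sb: "smooth b" using b(1) by (simp add: test_fun_iff)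
  obtain H where H: "ac_deriv H b" "H (-1) = 0"
    by (rule ac_deriv_integral[OF locally_integrable_continuous[OF smooth_continuous[OF sb]]])
  have sH: "smooth H"
    by (rule smoothI[OF ac_deriv_has_vector_derivative[OF H(1) smooth_continuous[OF sb]] sb])
  have H0: "H t = 0" if "t \<le> -1" for t
  proof -
    have "(LINT s:{t..-1}|lborel. b s) = (LINT s:{t..-1}|lborel. 0)"
      by (intro set_lebesgue_integral_cong) (auto intro!: b(2))
    then have "(LINT s:{t..-1}|lborel. b s) = 0" by simp
    moreover have "(LINT s:{t..-1}|lborel. b s) = H (-1) - H t" using H(1) that unfolding ac_deriv_def by blast
    ultimately show ?thesis using H(2) by simp
  qed
  have H1: "H t = 1" if "t \<ge> 1" for t
  proof -
    have "(LINT s|lborel. b s) = (LINT s:{-t..t}|lborel. b s)"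
      using that b(2) by (intro integrable_compact_support(2) locally_integrable_continuous smooth_continuous sb) auto
    also have "\<dots> = H t - H (-t)" using H(1) that by (simp add: ac_deriv_def)
    finally show ?thesis using H0[of "-t"] that b(3) by simp
  qed
  \<comment> \<open>\<open>H\<close> climbs from 0 to 1 on \<open>{-1..1}\<close>. The first factor
    moves this climb to \<open>{-2..-1}\<close>, the second reflects it to
    \<open>{1..2}\<close>.\<close>
  have "smooth (\<lambda>t. H (2 * t + 3) * H ((-2) * t + 3)) \<and> (\<forall>t. \<bar>t\<bar> \<le> 1 \<longrightarrow> H (2 * t + 3) * H ((-2) * t + 3) = 1)
    \<and> (\<forall>t. \<bar>t\<bar> \<ge> 2 \<longrightarrow> H (2 * t + 3) * H ((-2) * t + 3) = 0)"
  proof (intro conjI allI impI)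
    show "smooth (\<lambda>t. H (2 * t + 3) * H ((-2) * t + 3))"
      by (intro smooth_mult smooth_affine sH)
    fix t :: real
    show "\<bar>t\<bar> \<le> 1 \<Longrightarrow> H (2 * t + 3) * H ((-2) * t + 3) = 1" by (simp add: H1 abs_le_iff)
    assume "2 \<le> \<bar>t\<bar>"
    then have "2 * t + 3 \<le> -1 \<or> (-2) * t + 3 \<le> -1" by linarith
    then show "H (2 * t + 3) * H ((-2) * t + 3) = 0" using H0 by auto
  qed
  then have "\<exists>\<psi>. smooth \<psi> \<and> (\<forall>t. \<bar>t\<bar> \<le> 1 \<longrightarrow> \<psi> t = 1) \<and> (\<forall>t. \<bar>t\<bar> \<ge> 2 \<longrightarrow> \<psi> t = 0)"
    by (rule exI[where x="\<lambda>t. H (2 * t + 3) * H ((-2) * t + 3)"])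
  from someI_ex[OF this] show ?thesis unfolding bump_def .
qed

lemma smooth_bump: "smooth bump"
  and bump_eq_1: "\<bar>t\<bar> \<le> 1 \<Longrightarrow> bump t = 1"
  and bump_eq_0: "\<bar>t\<bar> \<ge> 2 \<Longrightarrow> bump t = 0"
  using bump_props by auto

lemma test_fun_bump_affine:
  assumes "a \<noteq> 0" shows "test_fun (\<lambda>t. bump (a * t + b))"
  unfolding test_fun_iff
proof
  show "smooth (\<lambda>t. bump (a * t + b))" by (intro smooth_affine smooth_bump)
  have "bump (a * t + b) = 0" if "\<bar>t\<bar> > (2 + \<bar>b\<bar>) / \<bar>a\<bar>" for t
  proof (rule bump_eq_0)
    have "\<bar>a\<bar> * \<bar>t\<bar> > 2 + \<bar>b\<bar>" using that assms by (simp add: field_simps)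
    then show "2 \<le> \<bar>a * t + b\<bar>" using abs_triangle_ineq2[of "a * t" "-b"] by (simp add: abs_mult)
  qed
  then show "\<exists>c. \<forall>t. c < \<bar>t\<bar> \<longrightarrow> bump (a * t + b) = 0" by blast
qed

section \<open>Weak derivatives\<close>

lemma ac_deriv_test_fun: "test_fun \<psi> \<Longrightarrow> ac_deriv \<psi> (vderiv \<psi>)"
  by (simp add: test_fun_iff ac_deriv_smooth)

lemma ac_deriv_imp_has_weak_deriv:
  assumes "ac_deriv u g" shows "has_weak_deriv u g"
  unfolding has_weak_deriv_def
proof (intro conjI allI impI ac_deriv_locally_integrable[OF assms])
  fix \<psi> assume \<psi>: "test_fun \<psi>"
  then obtain a where a: "\<And>t. \<bar>t\<bar> > a \<Longrightarrow> \<psi> t = 0" and s: "smooth \<psi>" by (auto simp: test_fun_iff)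
  have a': "vderiv \<psi> t = 0" if "\<bar>t\<bar> > a" for t
    using vderiv_compact_support[OF s a that] by simp
  have i: "integrable lborel (\<lambda>t. g t * \<psi> t)" "integrable lborel (\<lambda>t. u t * vderiv \<psi> t)"
    using locally_integrable_continuous_mult[OF smooth_continuous[OF s] ac_deriv_locally_integrable(1)[OF assms]]
      locally_integrable_continuous_mult[OF smooth_continuous[OF smooth_deriv(2)[OF s]] ac_deriv_locally_integrable(2)[OF assms]]
    by (auto intro!: integrable_compact_support(1)[of _ a] simp: a a' mult.commute)
  have "(LINT t|lborel. g t * \<psi> t + u t * vderiv \<psi> t) = 0"
    by (rule ac_deriv_integral_zero(2)[OF ac_deriv_mult[OF assms ac_deriv_test_fun[OF \<psi>]], of a]) (auto simp: a a')
  then show "(LINT t|lborel. u t * vderiv \<psi> t) = - (LINT t|lborel. g t * \<psi> t)"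
    using i by (simp add: add_eq_0_iff)
qed

text \<open>The zero mean of \<open>g\<close> is what brings the primitive back to zero on the right
  of the support.\<close>

lemma ac_deriv_compact_support:
  assumes u: "ac_deriv u g" "u (-a) = 0" and g: "\<And>t. \<bar>t\<bar> \<ge> a \<Longrightarrow> g t = 0" "(LINT t|lborel. g t) = 0"
    and t: "\<bar>t\<bar> \<ge> a"
  shows "u t = 0"
proof -
  have left: "u s = 0" if "s \<le> -a" for s
  proof (cases "a \<ge> 0")
    case True
    have "(LINT r:{s..-a}|lborel. g r) = (LINT r:{s..-a}|lborel. 0)"
      by (intro set_lebesgue_integral_cong) (use True in \<open>auto intro!: g(1)\<close>)
    moreover have "(LINT r:{s..-a}|lborel. g r) = u (-a) - u s"
      using u(1) that unfolding ac_deriv_def by blast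
    ultimately show ?thesis using u(2) by simp
  next
    case False
    have "(LINT r:{s..-a}|lborel. g r) = (LINT r:{s..-a}|lborel. 0)"
      by (intro set_lebesgue_integral_cong) (use False in \<open>auto intro!: g(1)\<close>)
    moreover have "(LINT r:{s..-a}|lborel. g r) = u (-a) - u s"
      using u(1) that unfolding ac_deriv_def by blast
    ultimately show ?thesis using u(2) by simp
  qed
  show ?thesis
  proof (cases "t \<le> -a")
    case True then show ?thesis by (rule left)
  next
    case False
    then have ta: "t \<ge> a" using t by linarith
    show ?thesis
    proof (cases "t \<ge> 0")
      case True
      have "(LINT r|lborel. g r) = (LINT r:{-t..t}|lborel. g r)"
        by (rule integrable_compact_support(2)) (use u(1) ta in \<open>auto simp: ac_deriv_def intro!: g(1)\<close>)
      also have "\<dots> = u t - u (-t)" using u(1) True by (simp add: ac_deriv_def)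
      finally show ?thesis using left[of "-t"] ta g(2) by simp
    next
      case False
      have "(LINT r:{t..-a}|lborel. g r) = u (-a) - u t" if "t \<le> -a"
        using u(1) that unfolding ac_deriv_def by blast
      then show ?thesis using left ta False by (cases "t \<le> -a") auto
    qed
  qed
qed

lemma primitive_of_test_fun:
  assumes "test_fun \<eta>" "ac_deriv \<psi> \<eta>" "\<psi> (-a) = 0" "\<And>t. \<bar>t\<bar> \<ge> a \<Longrightarrow> \<eta> t = 0" "(LINT t|lborel. \<eta> t) = 0"
  shows "test_fun \<psi>" "vderiv \<psi> = \<eta>"
proof -
  have s: "smooth \<eta>" using assms(1) by (simp add: test_fun_iff)
  note d = ac_deriv_has_vector_derivative[OF assms(2) smooth_continuous[OF s]]
  show "vderiv \<psi> = \<eta>" by (rule vderiv_eqI[OF d])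
  show "test_fun \<psi>"
    unfolding test_fun_iff
    using smoothI[OF d s] ac_deriv_compact_support[OF assms(2-5)] less_imp_le by metis
qed

lemma integrable_mult_test_fun:
  assumes "locally_integrable h" "test_fun \<psi>" shows "integrable lborel (\<lambda>t. h t * \<psi> t)"
proof -
  obtain a where "\<And>t. \<bar>t\<bar> > a \<Longrightarrow> \<psi> t = 0" and s: "smooth \<psi>" using assms(2) by (auto simp: test_fun_iff)
  then show ?thesis
    using locally_integrable_continuous_mult[OF smooth_continuous[OF s] assms(1)]
    by (intro integrable_compact_support(1)[of _ a]) (auto simp: mult.commute)
qed

lemma test_fun_lincomb: "test_fun f \<Longrightarrow> test_fun g \<Longrightarrow> test_fun (\<lambda>t. f t + c * g t)"
proof -
  assume f: "test_fun f" and g: "test_fun g"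
  obtain a b where "\<forall>t. \<bar>t\<bar> > a \<longrightarrow> f t = 0" "\<forall>t. \<bar>t\<bar> > b \<longrightarrow> g t = 0"
    using f g by (auto simp: test_fun_iff)
  then have "\<forall>t. \<bar>t\<bar> > max a b \<longrightarrow> f t + c * g t = 0" by simp
  then show ?thesis using f g unfolding test_fun_iff
    by (intro conjI smooth_add smooth_mult smooth_const) blast+
qed

text \<open>The lemma of du Bois-Reymond. The difference \<open>h\<close> of \<open>u\<close> and a
  primitive of \<open>g\<close> is orthogonal to all derivatives of test functions, that is, to all
  test functions of zero mean. Subtracting a multiple of a fixed \<open>b\<close> of unit mass
  reduces any test function to that case, so \<open>h\<close> is constant.\<close>

lemma has_weak_deriv_imp_ac_deriv:
  assumes "has_weak_deriv u g"
  obtains v where "ac_deriv v g" "AE t in lborel. u t = v t"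
proof -
  have lu: "locally_integrable u" and lg: "locally_integrable g"
    using assms by (auto simp: has_weak_deriv_def)
  obtain v where v: "ac_deriv v g" by (rule ac_deriv_integral[OF lg, of 0])
  define h where "h t = u t - v t" for t
  have lh: "locally_integrable h"
    unfolding h_def[abs_def] by (rule locally_integrable_diff[OF lu ac_deriv_locally_integrable(2)[OF v]])
  have h0: "(LINT t|lborel. h t * vderiv \<psi> t) = 0" if "test_fun \<psi>" for \<psi>
  proof -
    have "(LINT t|lborel. u t * vderiv \<psi> t) = (LINT t|lborel. v t * vderiv \<psi> t)"
      using assms ac_deriv_imp_has_weak_deriv[OF v] that by (simp add: has_weak_deriv_def)
    then show ?thesis
      using integrable_mult_test_fun[OF lu test_fun_vderiv[OF that]]
        integrable_mult_test_fun[OF ac_deriv_locally_integrable(2)[OF v] test_fun_vderiv[OF that]]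
      by (simp add: h_def left_diff_distrib)
  qed
  obtain b where b: "test_fun b" "\<And>t. \<bar>t\<bar> \<ge> 1 \<Longrightarrow> b t = 0" "(LINT t|lborel. b t) = 1"
    by (rule unit_mass_test_fun) blast
  \<comment> \<open>If \<open>h\<close> is constant, its value must be its integral against a
    function of unit mass.\<close>
  define c where "c = (LINT t|lborel. h t * b t)"
  have one: "locally_integrable (\<lambda>t. k)" for k :: complex by (intro locally_integrable_continuous continuous_intros)
  have "AE t in lborel. h t - c = 0"
  proof (rule AE_eq_0_if_test_integrals_eq_0)
    show "locally_integrable (\<lambda>t. h t - c)" by (rule locally_integrable_diff[OF lh one])
    fix \<eta> assume \<eta>: "test_fun \<eta>"
    define m where "m = (LINT t|lborel. \<eta> t)"
    obtain a where a: "\<And>t. \<bar>t\<bar> > a \<Longrightarrow> \<eta> t = 0" using \<eta> by (auto simp: test_fun_iff)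
    have i\<eta>: "integrable lborel \<eta>" and ib: "integrable lborel b"
      using integrable_mult_test_fun[OF one[of 1]] \<eta> b(1) by auto
    let ?\<eta> = "\<lambda>t. \<eta> t + (- m) * b t"
    have t: "test_fun ?\<eta>" by (rule test_fun_lincomb[OF \<eta> b(1)])
    have "locally_integrable ?\<eta>"
      using t by (intro locally_integrable_continuous smooth_continuous) (simp add: test_fun_iff)
    \<comment> \<open>The base point lies to the left of the supports of both \<open>\<eta>\<close>
      and \<open>b\<close>.\<close>
    then obtain \<psi> where \<psi>: "ac_deriv \<psi> ?\<eta>" "\<psi> (- (max (a + 1) 1)) = 0"
      by (rule ac_deriv_integral)
    have "(LINT t|lborel. ?\<eta> t) = 0" using i\<eta> ib b(3) by (simp add: m_def)
    then have "test_fun \<psi>" "vderiv \<psi> = ?\<eta>"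
      using a b(2) by (intro primitive_of_test_fun[OF t \<psi>]; auto)+
    then have "(LINT t|lborel. h t * ?\<eta> t) = 0" using h0 by metis
    moreover have "(LINT t|lborel. h t * ?\<eta> t) = (LINT t|lborel. h t * \<eta> t) - m * c"
      using integrable_mult_test_fun[OF lh \<eta>] integrable_mult_test_fun[OF lh b(1)]
      by (simp add: c_def right_diff_distrib mult.left_commute)
    moreover have "(LINT t|lborel. (h t - c) * \<eta> t) = (LINT t|lborel. h t * \<eta> t) - c * m"
      using integrable_mult_test_fun[OF lh \<eta>] i\<eta> by (simp add: left_diff_distrib m_def)
    ultimately show "(LINT t|lborel. (h t - c) * \<eta> t) = 0" by (simp add: mult.commute)
  qed
  then have "AE t in lborel. u t = v t + c" by eventually_elim (simp add: h_def algebra_simps)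
  moreover have "ac_deriv (\<lambda>t. v t + c) g" using v by (simp add: ac_deriv_def)
  ultimately show thesis using that by blast
qed

lemma has_weak_deriv_unique:
  assumes "has_weak_deriv u g" "has_weak_deriv u h"
  shows "AE t in lborel. g t = h t"
proof -
  have lg: "locally_integrable g" and lh: "locally_integrable h"
    using assms by (auto simp: has_weak_deriv_def)
  have "AE t in lborel. g t - h t = 0"
  proof (rule AE_eq_0_if_test_integrals_eq_0)
    show "locally_integrable (\<lambda>t. g t - h t)" by (rule locally_integrable_diff[OF lg lh])
    fix \<psi> assume \<psi>: "test_fun \<psi>"
    then have "(LINT t|lborel. g t * \<psi> t) = (LINT t|lborel. h t * \<psi> t)"
      using assms by (simp add: has_weak_deriv_def)
    then show "(LINT t|lborel. (g t - h t) * \<psi> t) = 0"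
      using integrable_mult_test_fun[OF lg \<psi>] integrable_mult_test_fun[OF lh \<psi>] by (simp add: left_diff_distrib)
  qed
  then show ?thesis by eventually_elim simp
qed

lemma has_weak_deriv_AE_cong:
  assumes "has_weak_deriv u g" "AE t in lborel. u t = v t" "v \<in> borel_measurable borel"
  shows "has_weak_deriv v g"
proof -
  have [measurable]: "u \<in> borel_measurable borel" "v \<in> borel_measurable borel"
    using assms locally_integrable_measurable by (auto simp: has_weak_deriv_def)
  have "locally_integrable v"
    unfolding locally_integrable_def
  proof (intro allI)
    fix a b
    have "set_integrable lborel {a..b} u" using assms(1) by (simp add: has_weak_deriv_def locally_integrable_def)
    then show "set_integrable lborel {a..b} v"
      unfolding set_integrable_def
      by (rule integrable_cong_AE_imp) (use assms(2) in \<open>auto elim!: eventually_mono\<close>)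
  qed
  moreover have "(LINT t|lborel. v t * vderiv \<psi> t) = (LINT t|lborel. u t * vderiv \<psi> t)" if "test_fun \<psi>" for \<psi>
  proof (rule integral_cong_AE)
    have [measurable]: "vderiv \<psi> \<in> borel_measurable borel"
      by (rule test_fun_measurable[OF test_fun_vderiv[OF that]])
    show "(\<lambda>t. v t * vderiv \<psi> t) \<in> borel_measurable lborel" "(\<lambda>t. u t * vderiv \<psi> t) \<in> borel_measurable lborel"
      by auto
    show "AE t in lborel. v t * vderiv \<psi> t = u t * vderiv \<psi> t"
      using assms(2) by eventually_elim simp
  qed
  ultimately show ?thesis using assms(1) by (simp add: has_weak_deriv_def)
qed

section \<open>Square-integrable functions\<close>

lemma L2_norm_nonneg: "L2_norm f \<ge> 0"
  by (simp add: L2_norm_def)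

lemma L2_norm_squared: "(L2_norm f)\<^sup>2 = (LINT t|lborel. (cmod (f t))\<^sup>2)"
  by (simp add: L2_norm_def)

lemma square_integrable_integrable: "square_integrable f \<Longrightarrow> integrable lborel (\<lambda>t. (cmod (f t))\<^sup>2)"
  by (simp add: square_integrable_def)

lemma square_integrableI:
  assumes "integrable lborel g" "f \<in> borel_measurable borel" "\<And>t. (cmod (f t))\<^sup>2 \<le> g t"
  shows "square_integrable f"
  unfolding square_integrable_def
proof
  show "integrable lborel (\<lambda>t. (cmod (f t))\<^sup>2)"
    by (rule Bochner_Integration.integrable_bound[OF assms(1)])
       (use assms(2) order_trans[OF assms(3) abs_ge_self] in auto)
qed (use assms(2) in simp)

lemma square_integrable_add:
  assumes "square_integrable f" "square_integrable g"
  shows "square_integrable (\<lambda>t. f t + g t)" "(L2_norm (\<lambda>t. f t + g t))\<^sup>2 \<le> 2 * (L2_norm f)\<^sup>2 + 2 * (L2_norm g)\<^sup>2"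
proof -
  have i: "integrable lborel (\<lambda>t. 2 * (cmod (f t))\<^sup>2 + 2 * (cmod (g t))\<^sup>2)"
    using assms by (simp add: square_integrable_def)
  show s: "square_integrable (\<lambda>t. f t + g t)"
    by (rule square_integrableI[OF i])
       (use assms norm_add_squared_le in \<open>auto dest: square_integrable_measurable intro: borel_measurable_add\<close>)
  have "(L2_norm (\<lambda>t. f t + g t))\<^sup>2 \<le> (LINT t|lborel. 2 * (cmod (f t))\<^sup>2 + 2 * (cmod (g t))\<^sup>2)"
    unfolding L2_norm_squared by (intro integral_mono square_integrable_integrable[OF s] i norm_add_squared_le)
  then show "(L2_norm (\<lambda>t. f t + g t))\<^sup>2 \<le> 2 * (L2_norm f)\<^sup>2 + 2 * (L2_norm g)\<^sup>2"
    using assms by (simp add: square_integrable_def L2_norm_squared)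
qed

lemma square_integrable_cmult: "square_integrable f \<Longrightarrow> square_integrable (\<lambda>t. c * f t)"
  by (auto simp: square_integrable_def norm_mult power_mult_distrib intro: borel_measurable_times)

lemma L2_norm_cmult: "L2_norm (\<lambda>t. c * f t) = cmod c * L2_norm f"
  by (simp add: L2_norm_def norm_mult power_mult_distrib real_sqrt_mult)

lemma square_integrable_diff:
  assumes "square_integrable f" "square_integrable g" shows "square_integrable (\<lambda>t. f t - g t)"
  using square_integrable_add(1)[OF assms(1) square_integrable_cmult[OF assms(2), of "-1"]] by simp

lemma square_integrable_cnj: "square_integrable f \<Longrightarrow> square_integrable (\<lambda>t. cnj (f t))"
  by (auto simp: square_integrable_def intro: borel_measurable_cnj)

lemma L2_norm_cnj: "L2_norm (\<lambda>t. cnj (f t)) = L2_norm f"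
  by (simp add: L2_norm_def)

lemma square_integrable_mult:
  assumes "square_integrable f" "square_integrable g"
  shows "integrable lborel (\<lambda>t. f t * g t)"
proof (rule Bochner_Integration.integrable_bound)
  show "integrable lborel (\<lambda>t. ((cmod (f t))\<^sup>2 + (cmod (g t))\<^sup>2) / 2)"
    using assms by (simp add: square_integrable_def)
  show "AE t in lborel. norm (f t * g t) \<le> norm (((cmod (f t))\<^sup>2 + (cmod (g t))\<^sup>2) / 2)"
    using mult_le_sum_squares by (auto simp: norm_mult)
qed (use assms in \<open>auto dest: square_integrable_measurable intro: borel_measurable_times\<close>)

text \<open>The inequality is homogeneous, so it suffices to use \<open>2 x y \<le> s x\<^sup>2 + y\<^sup>2 / s\<close> with the optimal \<open>s\<close>.\<close>

lemma L2_Cauchy_Schwarz: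
  assumes f: "square_integrable f" and g: "square_integrable g"
  shows "(LINT t|lborel. cmod (f t) * cmod (g t)) \<le> L2_norm f * L2_norm g"
proof -
  have i: "integrable lborel (\<lambda>t. cmod (f t) * cmod (g t))"
    using integrable_norm[OF square_integrable_mult[OF f g]] by (simp add: norm_mult)
  define I where "I = (LINT t|lborel. cmod (f t) * cmod (g t))"
  have I0: "I \<ge> 0" by (simp add: I_def)
  have "2 * I \<le> s * (L2_norm f)\<^sup>2 + (L2_norm g)\<^sup>2 / s" if "s > 0" for s
  proof -
    have "(LINT t|lborel. 2 * (cmod (f t) * cmod (g t))) \<le> (LINT t|lborel. s * (cmod (f t))\<^sup>2 + (cmod (g t))\<^sup>2 / s)"
    proof (rule integral_mono)
      fix t
      have "0 \<le> (s * cmod (f t) - cmod (g t))\<^sup>2 / s" using that by simp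
      also have "\<dots> = s * (cmod (f t))\<^sup>2 + (cmod (g t))\<^sup>2 / s - 2 * (cmod (f t) * cmod (g t))"
        using that by (simp add: power2_eq_square field_simps)
      finally show "2 * (cmod (f t) * cmod (g t)) \<le> s * (cmod (f t))\<^sup>2 + (cmod (g t))\<^sup>2 / s" by simp
    qed (use i f g in \<open>auto simp: square_integrable_def\<close>)
    then show ?thesis using f g by (simp add: square_integrable_def I_def L2_norm_squared)
  qed
  note * = this
  have pos: "(L2_norm h)\<^sup>2 + 1 > 0" for h by (rule add_nonneg_pos) auto
  consider "L2_norm f = 0" | "L2_norm g = 0" | "L2_norm f > 0" "L2_norm g > 0"
    using L2_norm_nonneg[of f] L2_norm_nonneg[of g] by linarith
  then have "I \<le> L2_norm f * L2_norm g"
  proof cases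
    case 1
    have "I \<le> 0"
    proof (rule ccontr)
      assume "\<not> I \<le> 0"
      \<comment> \<open>The optimal \<open>s\<close> would be infinite here;
        \<open>((L2_norm g)\<^sup>2 + 1) / I\<close> is large enough, and the summand 1 keeps it
        positive. The other degenerate case takes the analogous small \<open>s\<close>.\<close>
      then have "2 * I \<le> I * (L2_norm g)\<^sup>2 / ((L2_norm g)\<^sup>2 + 1)"
        using *[OF divide_pos_pos[OF pos[of g], of I]] 1 by (simp add: mult.commute)
      also have "\<dots> \<le> I * 1"
        using I0 pos[of g] by (simp only: times_divide_eq_right[symmetric], intro mult_left_mono) (simp_all only: divide_le_eq_1, linarith)
      finally show False using \<open>\<not> I \<le> 0\<close> by simp
    qed
    then show ?thesis using 1 by simp
  next
    case 2
    have "I \<le> 0"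
    proof (rule ccontr)
      assume "\<not> I \<le> 0"
      then have "2 * I \<le> I * (L2_norm f)\<^sup>2 / ((L2_norm f)\<^sup>2 + 1)"
        using *[OF divide_pos_pos[OF _ pos[of f], of I]] 2 by simp
      also have "\<dots> \<le> I * 1"
        using I0 pos[of f] by (simp only: times_divide_eq_right[symmetric], intro mult_left_mono) (simp_all only: divide_le_eq_1, linarith)
      finally show False using \<open>\<not> I \<le> 0\<close> by simp
    qed
    then show ?thesis using 2 by simp
  next
    case 3
    then show ?thesis using *[of "L2_norm g / L2_norm f"] by (simp add: power2_eq_square)
  qed
  then show ?thesis by (simp add: I_def)
qed

lemma L2_Cauchy_Schwarz_integral:
  assumes "square_integrable f" "square_integrable g"
  shows "cmod (LINT t|lborel. f t * g t) \<le> L2_norm f * L2_norm g"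
proof -
  have "cmod (LINT t|lborel. f t * g t) \<le> (LINT t|lborel. cmod (f t * g t))" by (rule integral_norm_bound)
  also have "\<dots> = (LINT t|lborel. cmod (f t) * cmod (g t))" by (simp add: norm_mult)
  finally show ?thesis using L2_Cauchy_Schwarz[OF assms] by linarith
qed

lemma square_integrable_AE_cong:
  assumes "square_integrable f" "AE t in lborel. f t = g t" "g \<in> borel_measurable borel"
  shows "square_integrable g" "L2_norm g = L2_norm f"
proof -
  have [measurable]: "f \<in> borel_measurable borel" "g \<in> borel_measurable borel"
    using assms by (auto dest: square_integrable_measurable)
  have ae: "AE t in lborel. (cmod (f t))\<^sup>2 = (cmod (g t))\<^sup>2" using assms(2) by eventually_elim simp
  show "square_integrable g"
    unfolding square_integrable_def
    by (intro conjI integrable_cong_AE_imp[OF square_integrable_integrable[OF assms(1)] _ ae]) auto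
  show "L2_norm g = L2_norm f"
    unfolding L2_norm_def using ae by (intro arg_cong[where f=sqrt] integral_cong_AE) (auto elim: eventually_mono)
qed

lemma square_integrable_bounded_mult:
  assumes "square_integrable f" "m \<in> borel_measurable borel" "\<And>t. cmod (m t) \<le> D"
  shows "square_integrable (\<lambda>t. m t * f t)" "(L2_norm (\<lambda>t. m t * f t))\<^sup>2 \<le> D\<^sup>2 * (L2_norm f)\<^sup>2"
proof -
  have i: "integrable lborel (\<lambda>t. D\<^sup>2 * (cmod (f t))\<^sup>2)"
    using assms by (simp add: square_integrable_def)
  have b: "(cmod (m t * f t))\<^sup>2 \<le> D\<^sup>2 * (cmod (f t))\<^sup>2" for t
    by (simp add: norm_mult power_mult_distrib mult_right_mono power_mono assms(3))
  show s: "square_integrable (\<lambda>t. m t * f t)"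
    by (rule square_integrableI[OF i _ b]) (use assms in \<open>auto dest: square_integrable_measurable\<close>)
  have "(L2_norm (\<lambda>t. m t * f t))\<^sup>2 \<le> (LINT t|lborel. D\<^sup>2 * (cmod (f t))\<^sup>2)"
    unfolding L2_norm_squared by (intro integral_mono square_integrable_integrable[OF s] i b)
  then show "(L2_norm (\<lambda>t. m t * f t))\<^sup>2 \<le> D\<^sup>2 * (L2_norm f)\<^sup>2"
    by (simp add: L2_norm_squared)
qed

lemma square_integrable_indicator: "square_integrable (indicator {a..b})" "a \<le> b \<Longrightarrow> L2_norm (indicator {a..b}) = sqrt (b - a)"
proof -
  have e: "(cmod (indicator {a..b} t))\<^sup>2 = indicator {a..b} t" for t :: real by (simp add: indicator_def)
  show "square_integrable (indicator {a..b})"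
    unfolding square_integrable_def e by (auto simp: emeasure_lborel_Icc_eq)
  show "L2_norm (indicator {a..b}) = sqrt (b - a)" if "a \<le> b"
    unfolding L2_norm_def e using that by simp
qed

section \<open>Density of test functions in the square-integrable functions on an interval\<close>

lemma L2_dominated_convergence:
  assumes "\<And>n. f n \<in> borel_measurable borel" "g \<in> borel_measurable borel" "square_integrable w"
    and "\<And>t. (\<lambda>n. f n t) \<longlonglongrightarrow> g t" "\<And>n t. cmod (f n t) \<le> cmod (w t)"
  shows "\<And>n. square_integrable (f n)" "square_integrable g" "(\<lambda>n. L2_norm (\<lambda>t. f n t - g t)) \<longlonglongrightarrow> 0"
proof -
  have g: "cmod (g t) \<le> cmod (w t)" for t
    by (rule LIMSEQ_le_const2[OF tendsto_norm[OF assms(4)]]) (use assms(5) in auto)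
  show "square_integrable (f n)" for n
    by (rule square_integrableI[OF square_integrable_integrable[OF assms(3)] assms(1)]) (simp add: power_mono assms(5))
  show "square_integrable g"
    by (rule square_integrableI[OF square_integrable_integrable[OF assms(3)] assms(2)]) (simp add: power_mono g)
  have "(\<lambda>n. LINT t|lborel. (cmod (f n t - g t))\<^sup>2) \<longlonglongrightarrow> (LINT t|lborel. (cmod (g t - g t))\<^sup>2)"
  proof (rule integral_dominated_convergence[where w="\<lambda>t. 4 * (cmod (w t))\<^sup>2"])
    show "AE t in lborel. (\<lambda>n. (cmod (f n t - g t))\<^sup>2) \<longlonglongrightarrow> (cmod (g t - g t))\<^sup>2"
      by (intro AE_I2 tendsto_power tendsto_norm tendsto_diff assms(4) tendsto_const)
    show "AE t in lborel. norm ((cmod (f n t - g t))\<^sup>2) \<le> 4 * (cmod (w t))\<^sup>2" for n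
    proof (intro AE_I2)
      fix t
      have "cmod (f n t - g t) \<le> 2 * cmod (w t)"
        using norm_triangle_ineq4[of "f n t" "g t"] assms(5)[of n t] g[of t] by linarith
      then have "(cmod (f n t - g t))\<^sup>2 \<le> (2 * cmod (w t))\<^sup>2" by (intro power_mono) auto
      then show "norm ((cmod (f n t - g t))\<^sup>2) \<le> 4 * (cmod (w t))\<^sup>2" by (simp add: power_mult_distrib)
    qed
  qed (use assms in \<open>auto simp: square_integrable_def\<close>)
  then have "(\<lambda>n. sqrt (LINT t|lborel. (cmod (f n t - g t))\<^sup>2)) \<longlonglongrightarrow> sqrt 0"
    by (intro tendsto_real_sqrt) simp
  then show "(\<lambda>n. L2_norm (\<lambda>t. f n t - g t)) \<longlonglongrightarrow> 0"
    by (simp add: L2_norm_def)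
qed

text \<open>Density in dual form, which avoids mollification. The vanishing of \<open>L\<close> is
  carried from \<open>interval_test\<close> to indicators of intervals, to indicators of Borel sets,
  to simple functions and to \<open>g\<close>; each passage to a limit is continuity of
  \<open>L\<close> under dominated convergence.\<close>

lemma L2_functional_eq_0_if_test_eq_0:
  fixes L :: "(real \<Rightarrow> complex) \<Rightarrow> complex" and a :: real
  defines "X \<equiv> {g. square_integrable g \<and> (\<forall>t. \<bar>t\<bar> \<ge> a \<longrightarrow> g t = 0)}"
  assumes a: "a > 0"
    and add: "\<And>f g. f \<in> X \<Longrightarrow> g \<in> X \<Longrightarrow> L (\<lambda>t. f t + g t) = L f + L g"
    and cmult: "\<And>c f. f \<in> X \<Longrightarrow> L (\<lambda>t. c * f t) = c * L f"
    and bound: "\<And>f. f \<in> X \<Longrightarrow> cmod (L f) \<le> C * L2_norm f"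
    and test: "\<And>\<eta>. test_fun \<eta> \<Longrightarrow> \<eta> \<in> X \<Longrightarrow> L \<eta> = 0"
    and g: "g \<in> X"
  shows "L g = 0"
proof -
  have X_cmult: "(\<lambda>t. c * f t) \<in> X" if "f \<in> X" for c f
    using that square_integrable_cmult by (auto simp: X_def)
  have X_add: "(\<lambda>t. f t + g t) \<in> X" if "f \<in> X" "g \<in> X" for f g
    using that square_integrable_add(1) by (auto simp: X_def)
  \<comment> \<open>The only analytic step, used for intervals, for increasing unions and for the
    final approximation. The dominating \<open>w\<close> keeps all functions involved in
    \<open>X\<close>.\<close>
  have lim: "(\<lambda>n. L (f n)) \<longlonglongrightarrow> L h"
    if m: "\<And>n. f n \<in> borel_measurable borel" "h \<in> borel_measurable borel" and w: "w \<in> X"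
      and p: "\<And>t. (\<lambda>n. f n t) \<longlonglongrightarrow> h t" and b: "\<And>n t. cmod (f n t) \<le> cmod (w t)" for f h w
  proof -
    have w': "square_integrable w" "\<And>t. \<bar>t\<bar> \<ge> a \<Longrightarrow> w t = 0" using w by (auto simp: X_def)
    note dc = L2_dominated_convergence[OF m w'(1) p b]
    have f: "f n \<in> X" for n
      unfolding X_def
    proof (intro CollectI conjI allI impI dc(1))
      show "f n t = 0" if "\<bar>t\<bar> \<ge> a" for t using b[of n t] w'(2)[OF that] by simp
    qed
    have "h t = 0" if "\<bar>t\<bar> \<ge> a" for t
      using p[of t] f that LIMSEQ_unique[OF _ tendsto_const] by (force simp: X_def)
    then have h: "h \<in> X" using dc(2) by (simp add: X_def)
    have "L (f n) - L h = L (\<lambda>t. f n t + (-1) * h t)" for n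
      unfolding add[OF f X_cmult[OF h]] cmult[OF h] by simp
    then have "cmod (L (f n) - L h) \<le> C * L2_norm (\<lambda>t. f n t - h t)" for n
      using bound[OF X_add[OF f[of n] X_cmult[OF h, of "-1"]]] by simp
    moreover have "(\<lambda>n. C * L2_norm (\<lambda>t. f n t - h t)) \<longlonglongrightarrow> 0"
      using tendsto_mult_left[OF dc(3), of C] by simp
    ultimately have "(\<lambda>n. L (f n) - L h) \<longlonglongrightarrow> 0"
      by (intro Lim_null_comparison[of "\<lambda>n. L (f n) - L h" "\<lambda>n. C * L2_norm (\<lambda>t. f n t - h t)"]) auto
    then show ?thesis by (simp add: LIM_zero_iff)
  qed
  let ?I = "{-a<..<a}"
  have ind_X: "(\<lambda>t. indicator (A \<inter> ?I) t) \<in> X" if "A \<in> sets borel" for A :: "real set"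
  proof -
    have "square_integrable (indicator (A \<inter> ?I))"
      by (rule square_integrableI[OF square_integrable_integrable[OF square_integrable_indicator(1)[of "-a" a]]])
         (use that in \<open>auto simp: indicator_def\<close>)
    moreover have "indicator (A \<inter> ?I) t = (0::complex)" if "\<bar>t\<bar> \<ge> a" for t
      using that by (auto simp: indicator_def)
    ultimately show ?thesis by (simp add: X_def del: indicator_simps)
  qed
  have interval: "L (indicator ({c<..<d} \<inter> ?I)) = 0" for c d
  proof -
    \<comment> \<open>Shrinking the interval to its part in \<open>?I\<close> keeps these test
      functions in \<open>X\<close>; if that part is empty, they vanish.\<close>
    let ?f = "interval_test (max c (-a)) (min d a)"
    have i: "indicator ({c<..<d} \<inter> ?I) = (indicator {max c (-a)<..<min d a} :: real \<Rightarrow> complex)"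
      by (auto simp: indicator_def fun_eq_iff)
    have wX: "(\<lambda>t. indicator (UNIV \<inter> ?I) t) \<in> X" by (rule ind_X) simp
    have b: "cmod (?f n t) \<le> cmod (indicator (UNIV \<inter> ?I) t)" for n t
      by (rule order_trans[OF norm_interval_test]) (auto simp: indicator_def)
    have "?f n \<in> X" for n
      unfolding X_def
    proof (intro CollectI conjI allI impI)
      show "square_integrable (?f n)"
        by (rule square_integrableI[OF square_integrable_integrable[of "indicator (UNIV \<inter> ?I)"]])
           (use wX b in \<open>auto simp: X_def power_mono intro: test_fun_measurable test_fun_interval_test\<close>)
      show "?f n t = 0" if "\<bar>t\<bar> \<ge> a" for t using that by (auto simp: interval_test_eq)
    qed
    then have "L (?f n) = 0" for n by (rule test[OF test_fun_interval_test])
    moreover have "(\<lambda>n. L (?f n)) \<longlonglongrightarrow> L (indicator ({c<..<d} \<inter> ?I))"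
      by (rule lim[OF _ _ wX _ b]) (auto simp: i intro: test_fun_measurable test_fun_interval_test interval_test_tendsto)
    ultimately show ?thesis using LIMSEQ_unique[OF _ tendsto_const] by force
  qed
  have sets: "L (indicator (A \<inter> ?I)) = 0" if "A \<in> sets borel" for A
  proof (rule countably_additive_eq_0[where \<Lambda>="\<lambda>A. L (indicator (A \<inter> ?I))"])
    fix A B :: "real set" assume AB: "A \<in> sets borel" "B \<in> sets borel" "A \<inter> B = {}"
    have "indicator ((A \<union> B) \<inter> ?I) = (\<lambda>t. indicator (A \<inter> ?I) t + indicator (B \<inter> ?I) t :: complex)"
      using AB(3) by (auto simp: indicator_def fun_eq_iff)
    then show "L (indicator ((A \<union> B) \<inter> ?I)) = L (indicator (A \<inter> ?I)) + L (indicator (B \<inter> ?I))"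
      using add[OF ind_X[OF AB(1)] ind_X[OF AB(2)]] by simp
  next
    fix B :: "nat \<Rightarrow> real set" assume B: "range B \<subseteq> sets borel" "incseq B"
    have Bn: "B n \<in> sets borel" for n using B(1) by auto
    show "(\<lambda>n. L (indicator (B n \<inter> ?I))) \<longlonglongrightarrow> L (indicator ((\<Union>n. B n) \<inter> ?I))"
    proof (rule lim[OF _ _ ind_X[of UNIV]])
      show "(\<lambda>n. indicator (B n \<inter> ?I) t) \<longlonglongrightarrow> (indicator ((\<Union>n. B n) \<inter> ?I) t :: complex)" for t
      proof -
        have "incseq (\<lambda>n. B n \<inter> ?I)" using B(2) by (auto simp: incseq_def)
        moreover have "(\<Union>n. B n \<inter> ?I) = (\<Union>n. B n) \<inter> ?I" by auto
        ultimately show ?thesis using LIMSEQ_indicator_incseq[of "\<lambda>n. B n \<inter> ?I" t] by simp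
      qed
      show "indicator (B n \<inter> ?I) \<in> borel_measurable borel" for n using Bn by auto
      show "indicator ((\<Union>n. B n) \<inter> ?I) \<in> borel_measurable borel" using Bn by auto
    qed (auto simp: indicator_def)
  qed (use that interval in auto)
  have simple: "L s = 0" if s: "simple_function borel s" "s \<in> X" for s
  proof -
    have fin: "finite (s ` UNIV)" using s(1) by (simp add: simple_function_def)
    have pre: "s -` {y} \<in> sets borel" for y
      using s(1) borel_measurable_simple_function[OF s(1)] by (metis borel_singleton measurable_sets_borel sets.empty_sets sets.insert_in_sets)
    have sum: "(\<lambda>t. \<Sum>y\<in>S. y * indicator (s -` {y} \<inter> ?I) t) \<in> X \<and> L (\<lambda>t. \<Sum>y\<in>S. y * indicator (s -` {y} \<inter> ?I) t) = 0"
      if "finite S" for S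
      using that
    proof (induction S rule: finite_induct)
      case empty
      have "(\<lambda>t. 0 * indicator (UNIV \<inter> ?I) t) \<in> X" by (intro X_cmult ind_X) simp
      moreover have "L (\<lambda>t. 0 * indicator (UNIV \<inter> ?I) t) = 0"
        using cmult[OF ind_X[of UNIV], of 0] by simp
      ultimately show ?case by simp
    next
      case (insert y S)
      have y1: "(\<lambda>t. y * indicator (s -` {y} \<inter> ?I) t) \<in> X" by (intro X_cmult ind_X pre)
      have y0: "L (\<lambda>t. y * indicator (s -` {y} \<inter> ?I) t) = 0"
        by (subst cmult[OF ind_X[OF pre]]) (simp add: sets[OF pre])
      have S: "(\<lambda>t. \<Sum>y\<in>S. y * indicator (s -` {y} \<inter> ?I) t) \<in> X" "L (\<lambda>t. \<Sum>y\<in>S. y * indicator (s -` {y} \<inter> ?I) t) = 0"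
        using insert.IH by auto
      show ?case
        unfolding sum.insert[OF insert.hyps] add[OF y1 S(1)] y0 S(2)
        by (rule conjI[OF X_add[OF y1 S(1)]]) simp
    qed
    have "s = (\<lambda>t. \<Sum>y\<in>s ` UNIV. y * indicator (s -` {y} \<inter> ?I) t)"
    proof
      fix t
      show "s t = (\<Sum>y\<in>s ` UNIV. y * indicator (s -` {y} \<inter> ?I) t)"
      proof (cases "t \<in> ?I")
        case True
        have "(\<Sum>y\<in>s ` UNIV. y * indicator (s -` {y} \<inter> ?I) t) = (\<Sum>y\<in>s ` UNIV. if y = s t then s t else 0)"
          using True by (intro sum.cong) (auto simp: indicator_def)
        then show ?thesis using fin by simp
      next
        case False
        then have "s t = 0" using s(2) by (auto simp: X_def)
        then show ?thesis using False by simp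
      qed
    qed
    then show ?thesis using sum[OF fin] by metis
  qed
  have gm: "g \<in> borel_measurable borel" using g by (auto simp: X_def dest: square_integrable_measurable)
  obtain F where F: "\<And>i. simple_function borel (F i)" "\<And>t. (\<lambda>i. F i t) \<longlonglongrightarrow> g t" "\<And>i t. dist (F i t) 0 \<le> 2 * dist (g t) 0"
    using borel_measurable_implies_sequence_metric[OF gm, of 0] by auto
  have wX: "(\<lambda>t. 2 * g t) \<in> X" by (rule X_cmult[OF g])
  have b: "cmod (F i t) \<le> cmod (2 * g t)" for i t using F(3)[of i t] by (simp add: norm_mult)
  have Fm: "F i \<in> borel_measurable borel" for i using F(1) by (rule borel_measurable_simple_function)
  have "(\<lambda>i. L (F i)) \<longlonglongrightarrow> L g" by (rule lim[OF Fm gm wX F(2) b])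
  moreover have "F i \<in> X" for i
    unfolding X_def
  proof (intro CollectI conjI allI impI)
    show "square_integrable (F i)"
      using L2_dominated_convergence(1)[OF Fm gm _ F(2) b] wX by (simp add: X_def)
    show "F i t = 0" if "\<bar>t\<bar> \<ge> a" for t using b[of i t] g that by (simp add: X_def)
  qed
  then have "L (F i) = 0" for i using simple F(1) by blast
  ultimately show ?thesis using LIMSEQ_unique[OF _ tendsto_const] by force
qed

section \<open>Sobolev functions and their continuous representatives\<close>

text \<open>An element of \<open>W12\<close> as its continuous representative together with one
  chosen derivative: point values, the product rule and the form of a potential all become available
  without an almost-everywhere qualification.\<close>

definition sobolev_pair :: "(real \<Rightarrow> complex) \<Rightarrow> (real \<Rightarrow> complex) \<Rightarrow> bool" where
  "sobolev_pair u g \<longleftrightarrow> ac_deriv u g \<and> square_integrable u \<and> square_integrable g"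

definition sobolev_norm :: "(real \<Rightarrow> complex) \<Rightarrow> (real \<Rightarrow> complex) \<Rightarrow> real" where
  "sobolev_norm u g = sqrt ((L2_norm u)\<^sup>2 + (L2_norm g)\<^sup>2)"

lemma sobolev_norm_nonneg: "sobolev_norm u g \<ge> 0"
  by (simp add: sobolev_norm_def)

lemma sobolev_norm_squared: "(sobolev_norm u g)\<^sup>2 = (L2_norm u)\<^sup>2 + (L2_norm g)\<^sup>2"
  by (simp add: sobolev_norm_def)

lemma W12_norm_eq:
  assumes "has_weak_deriv u g" "square_integrable g"
  shows "W12_norm u = sobolev_norm u g"
proof -
  have w: "has_weak_deriv u (weak_deriv u)" unfolding weak_deriv_def by (rule someI[of "has_weak_deriv u", OF assms(1)])
  then have m: "weak_deriv u \<in> borel_measurable borel"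
    by (auto simp: has_weak_deriv_def intro: locally_integrable_measurable)
  show ?thesis
    using square_integrable_AE_cong(2)[OF assms(2) has_weak_deriv_unique[OF assms(1) w] m]
    by (simp add: W12_norm_def sobolev_norm_def)
qed

lemma sobolev_pair_W12:
  assumes "sobolev_pair u g" shows "u \<in> W12" "W12_norm u = sobolev_norm u g"
  using assms ac_deriv_imp_has_weak_deriv[of u g] W12_norm_eq[of u g]
  by (auto simp: W12_def sobolev_pair_def)

lemma W12_sobolev_pair:
  assumes "u \<in> W12"
  obtains v g where "sobolev_pair v g" "AE t in lborel. u t = v t" "W12_norm u = sobolev_norm v g"
proof -
  obtain g where g: "square_integrable u" "has_weak_deriv u g" "square_integrable g"
    using assms by (auto simp: W12_def)
  obtain v where v: "ac_deriv v g" "AE t in lborel. u t = v t"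
    using has_weak_deriv_imp_ac_deriv[OF g(2)] by blast
  note c = square_integrable_AE_cong[OF g(1) v(2) ac_deriv_measurable(1)[OF v(1)]]
  show thesis
  proof (rule that)
    show "sobolev_pair v g" using v c g by (simp add: sobolev_pair_def)
    show "W12_norm u = sobolev_norm v g" using W12_norm_eq[OF g(2,3)] c(2) by (simp add: sobolev_norm_def)
  qed (rule v)
qed

lemma sobolev_pair_cmult: "sobolev_pair u g \<Longrightarrow> sobolev_pair (\<lambda>t. c * u t) (\<lambda>t. c * g t)"
  by (simp add: sobolev_pair_def ac_deriv_cmult square_integrable_cmult)

lemma sobolev_norm_cmult: "sobolev_norm (\<lambda>t. c * u t) (\<lambda>t. c * g t) = cmod c * sobolev_norm u g"
  by (simp add: sobolev_norm_def L2_norm_cmult power_mult_distrib real_sqrt_mult flip: distrib_left)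

lemma W12_cmult: "u \<in> W12 \<Longrightarrow> (\<lambda>t. c * u t) \<in> W12"
proof -
  assume u: "u \<in> W12"
  obtain v g where v: "sobolev_pair v g" "AE t in lborel. u t = v t" using W12_sobolev_pair[OF u] by blast
  have m: "(\<lambda>t. c * u t) \<in> borel_measurable borel"
    using u by (auto simp: W12_def intro!: borel_measurable_times dest: square_integrable_measurable)
  have ae: "AE t in lborel. c * v t = c * u t" using v(2) by eventually_elim simp
  have s: "sobolev_pair (\<lambda>t. c * v t) (\<lambda>t. c * g t)" by (rule sobolev_pair_cmult[OF v(1)])
  then have "has_weak_deriv (\<lambda>t. c * u t) (\<lambda>t. c * g t)"
    by (intro has_weak_deriv_AE_cong[OF _ ae m] ac_deriv_imp_has_weak_deriv) (simp add: sobolev_pair_def)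
  moreover have "square_integrable (\<lambda>t. c * u t)" using u by (simp add: W12_def square_integrable_cmult)
  ultimately show ?thesis using s by (auto simp: W12_def sobolev_pair_def)
qed

section \<open>Functionals on \<open>W12\<close>\<close>

lemma W12_dual_add: "F \<in> W12_dual \<Longrightarrow> u \<in> W12 \<Longrightarrow> v \<in> W12 \<Longrightarrow> F (\<lambda>t. u t + v t) = F u + F v"
  by (simp add: W12_dual_def)

lemma W12_dual_cmult: "F \<in> W12_dual \<Longrightarrow> u \<in> W12 \<Longrightarrow> F (\<lambda>t. c * u t) = c * F u"
  by (simp add: W12_dual_def)

text \<open>The difference has norm zero, so boundedness kills it. This lets a functional be
  evaluated at the continuous representative.\<close>

lemma W12_dual_AE_cong:
  assumes F: "F \<in> W12_dual" and u: "u \<in> W12" and v: "v \<in> W12" and ae: "AE t in lborel. u t = v t"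
  shows "F u = F v"
proof -
  define w where "w t = u t + (-1) * v t" for t
  have mu: "u \<in> borel_measurable borel" "v \<in> borel_measurable borel"
    using u v by (auto simp: W12_def dest: square_integrable_measurable)
  have m: "w \<in> borel_measurable borel"
    unfolding w_def[abs_def] using mu by (intro borel_measurable_add borel_measurable_times) auto
  have z: "AE t in lborel. 0 = w t" using ae by eventually_elim (simp add: w_def)
  have z': "sobolev_pair (\<lambda>t. 0) (\<lambda>t. 0)"
    by (simp add: sobolev_pair_def square_integrable_def ac_deriv_def locally_integrable_def set_integrable_def)
  have hw: "has_weak_deriv w (\<lambda>t. 0)"
    by (rule has_weak_deriv_AE_cong[OF ac_deriv_imp_has_weak_deriv z m]) (use z' in \<open>simp add: sobolev_pair_def\<close>)
  have sq: "square_integrable w" "L2_norm w = 0"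
    using square_integrable_AE_cong[OF _ z m] z' by (auto simp: sobolev_pair_def L2_norm_def)
  have W: "w \<in> W12" using hw sq z' by (auto simp: W12_def sobolev_pair_def)
  have "W12_norm w = 0"
    using W12_norm_eq[OF hw] z' sq(2) by (simp add: sobolev_pair_def sobolev_norm_def L2_norm_def)
  moreover obtain C where "cmod (F w) \<le> C * W12_norm w" using F W by (auto simp: W12_dual_def)
  ultimately have "F w = 0" by simp
  moreover have "F w = F u + (-1) * F v"
    unfolding w_def[abs_def] W12_dual_add[OF F u W12_cmult[OF v]] W12_dual_cmult[OF F v] ..
  ultimately show ?thesis by simp
qed

section \<open>The form of a potential\<close>

text \<open>The pairing of the distribution \<open>\<sigma>' + \<tau>\<close> with a function \<open>p\<close> whose derivative is \<open>p'\<close>.\<close>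

definition potential_form :: "(real \<Rightarrow> real) \<Rightarrow> (real \<Rightarrow> real) \<Rightarrow> (real \<Rightarrow> complex) \<Rightarrow> (real \<Rightarrow> complex) \<Rightarrow> complex" where
  "potential_form \<sigma> \<tau> p p' = (LINT t|lborel. of_real (\<tau> t) * p t - of_real (\<sigma> t) * p' t)"

text \<open>Purely local integrability, just enough for the form to make sense on compactly
  supported functions, and stable under differences. The uniform bounds of a decomposition enter
  only in \<open>potential_form_relative_bound\<close>.\<close>

definition admissible :: "(real \<Rightarrow> real) \<Rightarrow> (real \<Rightarrow> real) \<Rightarrow> bool" where
  "admissible \<sigma> \<tau> \<longleftrightarrow> L2_loc (\<lambda>t. complex_of_real (\<sigma> t)) \<and> locally_integrable (\<lambda>t. complex_of_real (\<tau> t))"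

lemma potential_form_integrable:
  fixes p p' :: "real \<Rightarrow> complex"
  assumes "admissible \<sigma> \<tau>" "continuous_on UNIV p" "L2_loc p'"
    and "\<And>t. \<bar>t\<bar> > a \<Longrightarrow> p t = 0" "\<And>t. \<bar>t\<bar> > a \<Longrightarrow> p' t = 0"
  shows "integrable lborel (\<lambda>t. of_real (\<tau> t) * p t)" "integrable lborel (\<lambda>t. of_real (\<sigma> t) * p' t)"
proof -
  have "locally_integrable (\<lambda>t. p t * of_real (\<tau> t))"
    using assms by (intro locally_integrable_continuous_mult) (auto simp: admissible_def)
  then show "integrable lborel (\<lambda>t. of_real (\<tau> t) * p t)"
    by (intro integrable_compact_support(1)[of _ a]) (auto simp: assms mult.commute)
  have "locally_integrable (\<lambda>t. of_real (\<sigma> t) * p' t)"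
    using assms by (intro L2_loc_mult) (auto simp: admissible_def)
  then show "integrable lborel (\<lambda>t. of_real (\<sigma> t) * p' t)"
    by (intro integrable_compact_support(1)[of _ a]) (auto simp: assms)
qed

lemma potential_form_add:
  assumes "admissible \<sigma> \<tau>"
    and "continuous_on UNIV p" "L2_loc p'" "\<And>t. \<bar>t\<bar> > a \<Longrightarrow> p t = 0" "\<And>t. \<bar>t\<bar> > a \<Longrightarrow> p' t = 0"
    and "continuous_on UNIV r" "L2_loc r'" "\<And>t. \<bar>t\<bar> > a \<Longrightarrow> r t = 0" "\<And>t. \<bar>t\<bar> > a \<Longrightarrow> r' t = 0"
  shows "potential_form \<sigma> \<tau> (\<lambda>t. p t + r t) (\<lambda>t. p' t + r' t) = potential_form \<sigma> \<tau> p p' + potential_form \<sigma> \<tau> r r'"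
proof -
  have "potential_form \<sigma> \<tau> p p' + potential_form \<sigma> \<tau> r r' =
    (LINT t|lborel. (of_real (\<tau> t) * p t - of_real (\<sigma> t) * p' t) + (of_real (\<tau> t) * r t - of_real (\<sigma> t) * r' t))"
    unfolding potential_form_def
    using potential_form_integrable[OF assms(1-5)] potential_form_integrable[OF assms(1,6-9)]
    by (intro Bochner_Integration.integral_add[symmetric] Bochner_Integration.integrable_diff) auto
  then show ?thesis by (simp add: potential_form_def algebra_simps)
qed

lemma potential_form_cmult: "potential_form \<sigma> \<tau> (\<lambda>t. c * p t) (\<lambda>t. c * p' t) = c * potential_form \<sigma> \<tau> p p'"
proof -
  have "(LINT t|lborel. of_real (\<tau> t) * (c * p t) - of_real (\<sigma> t) * (c * p' t))
    = (LINT t|lborel. c * (of_real (\<tau> t) * p t - of_real (\<sigma> t) * p' t))"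
    by (simp add: algebra_simps)
  then show ?thesis by (simp add: potential_form_def)
qed

text \<open>A qualitative bound by Cauchy-Schwarz on \<open>{-a..a}\<close>. \<open>K\<close>
  depends on \<open>a\<close> and on the size of the potential there, so it only provides continuity
  for the density argument in \<open>extension_eq_potential_form\<close>.\<close>

lemma potential_form_bound:
  assumes "admissible \<sigma> \<tau>"
  obtains K where "K \<ge> 0" "\<And>p p' M. continuous_on UNIV p \<Longrightarrow> square_integrable p' \<Longrightarrow>
    (\<And>t. \<bar>t\<bar> > a \<Longrightarrow> p t = 0) \<Longrightarrow> (\<And>t. \<bar>t\<bar> > a \<Longrightarrow> p' t = 0) \<Longrightarrow> (\<And>t. cmod (p t) \<le> M) \<Longrightarrow>
    cmod (potential_form \<sigma> \<tau> p p') \<le> K * (M + L2_norm p')"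
proof -
  define s where "s t = indicator {-a..a} t * complex_of_real (\<sigma> t)" for t
  have l\<tau>: "locally_integrable (\<lambda>t. complex_of_real (\<tau> t))" and l\<sigma>: "L2_loc (\<lambda>t. complex_of_real (\<sigma> t))"
    using assms by (auto simp: admissible_def)
  have i\<tau>: "integrable lborel (\<lambda>t. indicator {-a..a} t * complex_of_real (\<tau> t))"
  proof -
    have "(\<lambda>t. indicator {-a..a} t * complex_of_real (\<tau> t)) = (\<lambda>t. indicator {-a..a} t *\<^sub>R complex_of_real (\<tau> t))"
      by (auto simp: indicator_def)
    then show ?thesis using locally_integrable_on[OF l\<tau>] by (simp add: set_integrable_def)
  qed
  define I where "I = (LINT t|lborel. cmod (indicator {-a..a} t * complex_of_real (\<tau> t)))"
  have I0: "I \<ge> 0" by (simp add: I_def)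
  have s: "square_integrable s"
    unfolding square_integrable_def
  proof
    show "s \<in> borel_measurable lborel"
      unfolding s_def[abs_def] using L2_loc_measurable[OF l\<sigma>] by (intro borel_measurable_times) auto
    have "(\<lambda>t. (cmod (s t))\<^sup>2) = (\<lambda>t. indicator {-a..a} t *\<^sub>R (cmod (complex_of_real (\<sigma> t)))\<^sup>2)"
      by (auto simp: s_def indicator_def)
    then show "integrable lborel (\<lambda>t. (cmod (s t))\<^sup>2)"
      using l\<sigma> by (simp add: L2_loc_def set_integrable_def)
  qed
  show thesis
  proof (rule that[of "I + L2_norm s"])
    show "I + L2_norm s \<ge> 0" using I0 L2_norm_nonneg[of s] by simp
    fix p p' M
    assume p: "continuous_on UNIV p" "square_integrable p'" "\<And>t. \<bar>t\<bar> > a \<Longrightarrow> p t = 0" "\<And>t. \<bar>t\<bar> > a \<Longrightarrow> p' t = 0"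
      and M: "\<And>t. cmod (p t) \<le> M"
    have M0: "M \<ge> 0" using M[of 0] norm_ge_zero order_trans by blast
    note i = potential_form_integrable[OF assms p(1) square_integrable_imp_L2_loc[OF p(2)] p(3,4)]
    have "cmod (LINT t|lborel. of_real (\<tau> t) * p t) \<le> (LINT t|lborel. cmod (of_real (\<tau> t) * p t))"
      by (rule integral_norm_bound)
    also have "\<dots> \<le> (LINT t|lborel. M * cmod (indicator {-a..a} t * complex_of_real (\<tau> t)))"
    proof (rule integral_mono)
      fix t
      show "cmod (of_real (\<tau> t) * p t) \<le> M * cmod (indicator {-a..a} t * complex_of_real (\<tau> t))"
        using p(3)[of t] M[of t] M0 by (auto simp: norm_mult indicator_def abs_le_iff mult.commute[of M] intro!: mult_left_mono)
    qed (use integrable_norm[OF i(1)] integrable_norm[OF i\<tau>] in auto)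
    also have "\<dots> = M * I" by (simp add: I_def)
    finally have 1: "cmod (LINT t|lborel. of_real (\<tau> t) * p t) \<le> M * I" .
    have e: "of_real (\<sigma> t) * p' t = s t * p' t" for t
      by (cases "\<bar>t\<bar> > a") (auto simp: p(4) s_def indicator_def abs_le_iff not_less)
    then have 2: "cmod (LINT t|lborel. of_real (\<sigma> t) * p' t) \<le> L2_norm s * L2_norm p'"
      using L2_Cauchy_Schwarz_integral[OF s p(2)] by (simp only: e)
    have "potential_form \<sigma> \<tau> p p' = (LINT t|lborel. of_real (\<tau> t) * p t) - (LINT t|lborel. of_real (\<sigma> t) * p' t)"
      using i by (simp add: potential_form_def)
    then have "cmod (potential_form \<sigma> \<tau> p p') \<le> M * I + L2_norm s * L2_norm p'"
      using norm_triangle_ineq4[of "LINT t|lborel. of_real (\<tau> t) * p t" "LINT t|lborel. of_real (\<sigma> t) * p' t"] 1 2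
      by (simp only: mult.commute[of _ I])
    also have "\<dots> \<le> (I + L2_norm s) * (M + L2_norm p')"
      using mult_nonneg_nonneg[OF I0 L2_norm_nonneg[of p']] mult_nonneg_nonneg[OF L2_norm_nonneg[of s] M0]
      by (simp add: algebra_simps)
    finally show "cmod (potential_form \<sigma> \<tau> p p') \<le> (I + L2_norm s) * (M + L2_norm p')" .
  qed
qed

definition represents :: "functional \<Rightarrow> (real \<Rightarrow> real) \<Rightarrow> (real \<Rightarrow> real) \<Rightarrow> bool" where
  "represents r \<sigma> \<tau> \<longleftrightarrow> admissible \<sigma> \<tau> \<and> (\<forall>\<psi>. test_fun \<psi> \<longrightarrow> r \<psi> = potential_form \<sigma> \<tau> \<psi> (vderiv \<psi>))"

lemma vderiv_mult: "smooth f \<Longrightarrow> smooth g \<Longrightarrow> vderiv (\<lambda>t. f t * g t) = (\<lambda>t. vderiv f t * g t + f t * vderiv g t)"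
proof (rule vderiv_eqI)
  fix t assume "smooth f" "smooth g"
  then show "((\<lambda>t. f t * g t) has_vector_derivative vderiv f t * g t + f t * vderiv g t) (at t)"
    using has_vector_derivative_mult[OF smooth_deriv(1) smooth_deriv(1), of f g t] by (simp add: add.commute)
qed

lemma continuous_square_integrable:
  assumes "continuous_on UNIV u" "\<And>t. \<bar>t\<bar> > a \<Longrightarrow> u t = 0" shows "square_integrable u"
  by (rule L2_loc_compact_support[OF L2_loc_continuous[OF assms(1)]]) (rule assms(2))

lemma L2_norm_le_sup:
  assumes "continuous_on UNIV u" "\<And>t. \<bar>t\<bar> > a \<Longrightarrow> u t = 0" "\<And>t. cmod (u t) \<le> M" "a \<ge> 0"
  shows "L2_norm u \<le> sqrt (2 * a) * M"
proof -
  have M: "M \<ge> 0" using assms(3)[of 0] norm_ge_zero order_trans by blast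
  have "(L2_norm u)\<^sup>2 \<le> (LINT t|lborel. M\<^sup>2 * indicator {-a..a} t)"
    unfolding L2_norm_squared
  proof (rule integral_mono)
    show "integrable lborel (\<lambda>t. (cmod (u t))\<^sup>2)"
      by (rule square_integrable_integrable[OF continuous_square_integrable[OF assms(1,2)]])
    show "integrable lborel (\<lambda>t. M\<^sup>2 * indicator {-a..a} t)"
      by (auto simp: emeasure_lborel_Icc_eq)
    show "(cmod (u t))\<^sup>2 \<le> M\<^sup>2 * indicator {-a..a} t" for t
      using assms(2)[of t] assms(3)[of t] by (auto simp: indicator_def abs_le_iff intro!: power_mono)
  qed
  also have "\<dots> = (sqrt (2 * a) * M)\<^sup>2" using assms(4) by (simp add: power_mult_distrib)
  finally show ?thesis by (rule power2_le_imp_le) (use M assms(4) in auto)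
qed


text \<open>
  Both sides are continuous in \<open>g\<close> with respect to the \<open>L\<^sub>2\<close>-norm. To apply the density of test functions
  to all \<open>g\<close>, including those of nonzero mean, the mean is removed by subtracting a multiple of a fixed
  test function \<open>b\<close> before integrating.
\<close>

lemma extension_eq_potential_form:
  assumes r: "represents r \<sigma> \<tau>" and \<psi>: "test_fun \<psi>" and F: "extends_to (mult_functional r \<psi>) F"
    and Y: "ac_deriv Y g" "square_integrable g" and supp: "\<And>t. \<bar>t\<bar> \<ge> a \<Longrightarrow> Y t = 0" "\<And>t. \<bar>t\<bar> \<ge> a \<Longrightarrow> g t = 0"
    and a: "a \<ge> 1"
  shows "F Y = potential_form \<sigma> \<tau> (\<lambda>t. \<psi> t * Y t) (\<lambda>t. vderiv \<psi> t * Y t + \<psi> t * g t)"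
proof -
  have adm: "admissible \<sigma> \<tau>" using r by (simp add: represents_def)
  have s\<psi>: "smooth \<psi>" using \<psi> by (simp add: test_fun_iff)
  obtain b where b: "test_fun b" "\<And>t. \<bar>t\<bar> \<ge> 1 \<Longrightarrow> b t = 0" "(LINT t|lborel. b t) = 1"
    by (rule unit_mass_test_fun) blast
  have b_sq: "square_integrable b"
    by (rule continuous_square_integrable[OF test_fun_continuous[OF b(1)], of 1]) (simp add: b(2))
  define X where "X = {h. square_integrable h \<and> (\<forall>t. \<bar>t\<bar> \<ge> a \<longrightarrow> h t = 0)}"
  define G where "G h t = h t + (- (LINT s|lborel. h s)) * b t" for h t
  \<comment> \<open>An explicit integral rather than some chosen primitive, so that \<open>T\<close>
    inherits linearity in \<open>h\<close> from \<open>G\<close>.\<close>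
  define T where "T h t = (LINT s:{-a..t}|lborel. G h s)" for h t
  define P where "P h = potential_form \<sigma> \<tau> (\<lambda>t. \<psi> t * T h t) (\<lambda>t. vderiv \<psi> t * T h t + \<psi> t * G h t)" for h
  have X: "square_integrable h" "\<And>t. \<bar>t\<bar> \<ge> a \<Longrightarrow> h t = 0" if "h \<in> X" for h
    using that by (auto simp: X_def)
  have Xint: "integrable lborel h" if "h \<in> X" for h
    using X[OF that] by (intro integrable_compact_support(1)[of h a] L2_loc_imp_locally_integrable square_integrable_imp_L2_loc) auto
  have bX: "b \<in> X" using b_sq b(2) a by (auto simp: X_def)
  have G0: "G h t = 0" if "h \<in> X" "\<bar>t\<bar> \<ge> a" for h t
    using X(2)[OF that] X(2)[OF bX that(2)] by (simp add: G_def)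
  have Gsq: "square_integrable (G h)" if "h \<in> X" for h
    unfolding G_def[abs_def] using X(1)[OF that] square_integrable_cmult[OF b_sq] by (rule square_integrable_add(1))
  have GX: "G h \<in> X" if "h \<in> X" for h using Gsq[OF that] G0[OF that] by (simp add: X_def)
  have Gint: "(LINT t|lborel. G h t) = 0" if "h \<in> X" for h
    using Xint[OF that] Xint[OF bX] b(3) by (simp add: G_def)
  have T: "ac_deriv (T h) (G h)" "\<And>t. \<bar>t\<bar> \<ge> a \<Longrightarrow> T h t = 0" if h: "h \<in> X" for h
  proof -
    have lG: "locally_integrable (G h)"
      by (intro L2_loc_imp_locally_integrable square_integrable_imp_L2_loc Gsq h)
    obtain v where v: "ac_deriv v (G h)" "v (-a) = 0" by (rule ac_deriv_integral[OF lG])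
    have v0: "v t = 0" if "\<bar>t\<bar> \<ge> a" for t
      by (rule ac_deriv_compact_support[OF v _ Gint[OF h] that]) (rule G0[OF h])
    have "v = T h"
    proof (rule ext)
      fix t
      show "v t = T h t"
      proof (cases "-a \<le> t")
        case True then show ?thesis using v by (simp add: T_def ac_deriv_def)
      next
        case False then show ?thesis using v0[of t] by (simp add: T_def set_lebesgue_integral_def)
      qed
    qed
    then show "ac_deriv (T h) (G h)" "\<And>t. \<bar>t\<bar> \<ge> a \<Longrightarrow> T h t = 0" using v v0 by auto
  qed
  have Tcont: "continuous_on S (T h)" if "h \<in> X" for h S by (rule ac_deriv_continuous[OF T(1)[OF that]])
  have Tsq: "square_integrable (T h)" if "h \<in> X" for h
    using T(2)[OF that] by (intro continuous_square_integrable[OF Tcont[OF that], of a]) auto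
  have Tsob: "sobolev_pair (T h) (G h)" if "h \<in> X" for h
    using T(1) Tsq Gsq that by (simp add: sobolev_pair_def)
  define p' where "p' h t = vderiv \<psi> t * T h t + \<psi> t * G h t" for h t
  have pcont: "continuous_on UNIV (\<lambda>t. \<psi> t * T h t)" if "h \<in> X" for h
    by (intro continuous_intros smooth_continuous s\<psi> Tcont that)
  have p'sq: "square_integrable (p' h)" if "h \<in> X" for h
  proof -
    have "L2_loc (p' h)" unfolding p'_def[abs_def]
      by (intro L2_loc_add L2_loc_continuous_mult smooth_continuous s\<psi> smooth_deriv(2) L2_loc_continuous[OF Tcont]
          square_integrable_imp_L2_loc Gsq that)
    then show ?thesis by (rule L2_loc_compact_support[of _ a]) (use T(2) G0 that in \<open>auto simp: p'_def\<close>)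
  qed
  have supp0: "\<psi> t * T h t = 0" "p' h t = 0" if "h \<in> X" "\<bar>t\<bar> > a" for h t
    using T(2)[OF that(1), of t] G0[OF that(1), of t] that(2) by (auto simp: p'_def)
  have P_eq: "P h = potential_form \<sigma> \<tau> (\<lambda>t. \<psi> t * T h t) (p' h)" for h
    by (simp add: P_def p'_def[abs_def])
  have G_add: "G (\<lambda>t. h t + k t) = (\<lambda>t. G h t + G k t)" if "h \<in> X" "k \<in> X" for h k
    using Xint[OF that(1)] Xint[OF that(2)] by (simp add: G_def fun_eq_iff algebra_simps)
  have G_cmult: "G (\<lambda>t. c * h t) = (\<lambda>t. c * G h t)" for c h
    by (simp add: G_def fun_eq_iff algebra_simps)
  have T_add: "T (\<lambda>t. h t + k t) = (\<lambda>t. T h t + T k t)" if "h \<in> X" "k \<in> X" for h k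
  proof -
    have "set_integrable lborel {-a..t} (G h)" "set_integrable lborel {-a..t} (G k)" for t
      using T(1)[OF that(1)] T(1)[OF that(2)] by (auto simp: ac_deriv_def locally_integrable_def)
    then show ?thesis by (simp add: T_def[abs_def] G_add[OF that])
  qed
  have T_cmult: "T (\<lambda>t. c * h t) = (\<lambda>t. c * T h t)" for c h
    by (simp add: T_def[abs_def] G_cmult)
  have FW: "F \<in> W12_dual" using F by (simp add: extends_to_def)
  have TW: "T h \<in> W12" if "h \<in> X" for h by (rule sobolev_pair_W12(1)[OF Tsob[OF that]])
  have FT_add: "F (T (\<lambda>t. h t + k t)) = F (T h) + F (T k)" if "h \<in> X" "k \<in> X" for h k
    unfolding T_add[OF that] by (rule W12_dual_add[OF FW TW[OF that(1)] TW[OF that(2)]])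
  have FT_cmult: "F (T (\<lambda>t. c * h t)) = c * F (T h)" if "h \<in> X" for c h
    unfolding T_cmult by (rule W12_dual_cmult[OF FW TW[OF that]])
  have P_add: "P (\<lambda>t. h t + k t) = P h + P k" if "h \<in> X" "k \<in> X" for h k
  proof -
    have "P (\<lambda>t. h t + k t) = potential_form \<sigma> \<tau> (\<lambda>t. \<psi> t * T h t + \<psi> t * T k t) (\<lambda>t. p' h t + p' k t)"
      unfolding P_def T_add[OF that] G_add[OF that] p'_def by (simp add: algebra_simps)
    also have "\<dots> = P h + P k"
      unfolding P_eq
      by (rule potential_form_add[OF adm, where a=a])
         (use supp0 that in \<open>auto intro: pcont square_integrable_imp_L2_loc p'sq\<close>)
    finally show ?thesis .
  qed
  have P_cmult: "P (\<lambda>t. c * h t) = c * P h" for c h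
    unfolding P_def T_cmult G_cmult potential_form_cmult[symmetric] by (simp add: algebra_simps)
  obtain D where D: "\<And>t. cmod (\<psi> t) \<le> D" "D \<ge> 0" by (rule test_fun_bounded[OF \<psi>]) blast
  obtain D' where D': "\<And>t. cmod (vderiv \<psi> t) \<le> D'" "D' \<ge> 0" by (rule test_fun_bounded[OF test_fun_vderiv[OF \<psi>]]) blast
  \<comment> \<open>Cauchy-Schwarz on \<open>{-a..a}\<close> bounds the squared mean of
    \<open>h\<close> by \<open>2 * a\<close> times its squared norm;
    \<open>square_integrable_add\<close> supplies the two further factors 2.\<close>
  define K1 where "K1 = sqrt (2 + 4 * a * (L2_norm b)\<^sup>2)"
  have K1: "L2_norm (G h) \<le> K1 * L2_norm h" if h: "h \<in> X" for h
  proof -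
    have "(LINT s|lborel. h s) = (LINT s|lborel. indicator {-a..a} s * h s)"
    proof (rule Bochner_Integration.integral_cong[OF refl])
      show "h s = indicator {-a..a} s * h s" for s
        by (cases "\<bar>s\<bar> \<ge> a") (auto simp: X(2)[OF h] indicator_def not_le abs_less_iff)
    qed
    also have "cmod \<dots> \<le> sqrt (a - (-a)) * L2_norm h"
      using L2_Cauchy_Schwarz_integral[OF square_integrable_indicator(1)[of "-a" a] X(1)[OF h]] square_integrable_indicator(2)[of "-a" a] a
      by simp
    finally have "(cmod (LINT s|lborel. h s))\<^sup>2 \<le> (sqrt (2 * a) * L2_norm h)\<^sup>2" by (intro power_mono) auto
    also have "\<dots> = 2 * a * (L2_norm h)\<^sup>2" using a by (simp add: power_mult_distrib)
    finally have m: "(cmod (LINT s|lborel. h s))\<^sup>2 \<le> 2 * a * (L2_norm h)\<^sup>2" .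
    have "(L2_norm (G h))\<^sup>2 \<le> 2 * (L2_norm h)\<^sup>2 + 2 * (L2_norm (\<lambda>t. (- (LINT s|lborel. h s)) * b t))\<^sup>2"
      unfolding G_def[abs_def] by (rule square_integrable_add(2)[OF X(1)[OF h] square_integrable_cmult[OF b_sq]])
    also have "\<dots> = 2 * (L2_norm h)\<^sup>2 + 2 * ((cmod (LINT s|lborel. h s))\<^sup>2 * (L2_norm b)\<^sup>2)"
      by (simp only: L2_norm_cmult power_mult_distrib norm_minus_cancel)
    also have "\<dots> \<le> 2 * (L2_norm h)\<^sup>2 + 2 * (2 * a * (L2_norm h)\<^sup>2 * (L2_norm b)\<^sup>2)"
      by (intro add_left_mono mult_left_mono mult_right_mono m) auto
    also have "\<dots> = (K1 * L2_norm h)\<^sup>2"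
      using a by (simp add: K1_def power_mult_distrib algebra_simps)
    finally show ?thesis by (rule power2_le_imp_le) (use a in \<open>auto simp: K1_def L2_norm_nonneg\<close>)
  qed
  have K1_0: "K1 \<ge> 0" using a by (simp add: K1_def)
  have T_bound: "cmod (T h t) \<le> sqrt (2 * a) * K1 * L2_norm h" if h: "h \<in> X" for h t
  proof (cases "\<bar>t\<bar> \<ge> a")
    case True
    then show ?thesis using T(2)[OF h True] a K1_0 L2_norm_nonneg[of h] by simp
  next
    case False
    have "T h t = (LINT s|lborel. indicator {-a..t} s * G h s)"
      unfolding T_def set_lebesgue_integral_def by (intro Bochner_Integration.integral_cong) (auto simp: indicator_def)
    also have "cmod \<dots> \<le> sqrt (t - (-a)) * L2_norm (G h)"
      using L2_Cauchy_Schwarz_integral[OF square_integrable_indicator(1)[of "-a" t] Gsq[OF h]] square_integrable_indicator(2)[of "-a" t] False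
      by simp
    also have "\<dots> \<le> sqrt (2 * a) * (K1 * L2_norm h)"
      using K1[OF h] False by (intro mult_mono) (auto simp: L2_norm_nonneg)
    finally show ?thesis by (simp add: mult.assoc)
  qed
  define K2 where "K2 = sqrt (2 * a) * K1"
  have K2_0: "K2 \<ge> 0" using K1_0 a by (simp add: K2_def)
  have T_L2: "L2_norm (T h) \<le> sqrt (2 * a) * K2 * L2_norm h" if h: "h \<in> X" for h
    using L2_norm_le_sup[OF Tcont[OF h], of a "K2 * L2_norm h"] T(2)[OF h] T_bound[OF h] a
    by (simp add: K2_def mult.assoc)
  obtain C where C: "\<forall>u\<in>W12. cmod (F u) \<le> C * W12_norm u"
    using F by (auto simp: extends_to_def W12_dual_def)
  define K3 where "K3 = sqrt ((sqrt (2 * a) * K2)\<^sup>2 + K1\<^sup>2)"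
  have FT: "cmod (F (T h)) \<le> \<bar>C\<bar> * K3 * L2_norm h" if h: "h \<in> X" for h
  proof -
    have "(sobolev_norm (T h) (G h))\<^sup>2 \<le> (sqrt (2 * a) * K2 * L2_norm h)\<^sup>2 + (K1 * L2_norm h)\<^sup>2"
      unfolding sobolev_norm_squared using K1[OF h] T_L2[OF h] by (intro add_mono power_mono) (auto simp: L2_norm_nonneg)
    also have "\<dots> = (K3 * L2_norm h)\<^sup>2"
      by (simp add: K3_def power_mult_distrib algebra_simps)
    finally have "sobolev_norm (T h) (G h) \<le> K3 * L2_norm h"
      by (rule power2_le_imp_le) (auto simp: K3_def L2_norm_nonneg)
    moreover have "cmod (F (T h)) \<le> \<bar>C\<bar> * sobolev_norm (T h) (G h)"
      using C sobolev_pair_W12[OF Tsob[OF h]] mult_right_mono[OF abs_ge_self[of C] sobolev_norm_nonneg[of "T h" "G h"]]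
      by (metis order_trans)
    ultimately show ?thesis
      using mult_left_mono[of "sobolev_norm (T h) (G h)" "K3 * L2_norm h" "\<bar>C\<bar>"] by (simp add: mult.assoc)
  qed
  obtain K where K: "K \<ge> 0" "\<And>p p' M. continuous_on UNIV p \<Longrightarrow> square_integrable p' \<Longrightarrow>
    (\<And>t. \<bar>t\<bar> > a \<Longrightarrow> p t = 0) \<Longrightarrow> (\<And>t. \<bar>t\<bar> > a \<Longrightarrow> p' t = 0) \<Longrightarrow> (\<And>t. cmod (p t) \<le> M) \<Longrightarrow>
    cmod (potential_form \<sigma> \<tau> p p') \<le> K * (M + L2_norm p')"
    using potential_form_bound[OF adm, of a] by blast
  define K4 where "K4 = sqrt (2 * (D'\<^sup>2 * (sqrt (2 * a) * K2)\<^sup>2) + 2 * (D\<^sup>2 * K1\<^sup>2))"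
  have P_bound: "cmod (P h) \<le> K * (D * K2 + K4) * L2_norm h" if h: "h \<in> X" for h
  proof -
    have "(L2_norm (p' h))\<^sup>2 \<le> 2 * (L2_norm (\<lambda>t. vderiv \<psi> t * T h t))\<^sup>2 + 2 * (L2_norm (\<lambda>t. \<psi> t * G h t))\<^sup>2"
      unfolding p'_def[abs_def]
      by (intro square_integrable_add(2) square_integrable_bounded_mult(1)[OF _ _ D'(1)] square_integrable_bounded_mult(1)[OF _ _ D(1)]
          Tsq Gsq h test_fun_measurable test_fun_vderiv \<psi>)
    also have "\<dots> \<le> 2 * (D'\<^sup>2 * (L2_norm (T h))\<^sup>2) + 2 * (D\<^sup>2 * (L2_norm (G h))\<^sup>2)"
      by (intro add_mono mult_left_mono square_integrable_bounded_mult(2)[OF _ _ D'(1)] square_integrable_bounded_mult(2)[OF _ _ D(1)]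
          Tsq Gsq h test_fun_measurable test_fun_vderiv \<psi>) auto
    also have "\<dots> \<le> 2 * (D'\<^sup>2 * (sqrt (2 * a) * K2 * L2_norm h)\<^sup>2) + 2 * (D\<^sup>2 * (K1 * L2_norm h)\<^sup>2)"
      using K1[OF h] T_L2[OF h] by (intro add_mono mult_left_mono power_mono) (auto simp: L2_norm_nonneg)
    also have "\<dots> = (K4 * L2_norm h)\<^sup>2"
      by (simp add: K4_def power_mult_distrib algebra_simps)
    finally have p': "L2_norm (p' h) \<le> K4 * L2_norm h"
      by (rule power2_le_imp_le) (auto simp: K4_def L2_norm_nonneg)
    have pb: "cmod (\<psi> t * T h t) \<le> D * (K2 * L2_norm h)" for t
      unfolding norm_mult using D T_bound[OF h, of t] K2_0 by (intro mult_mono) (auto simp: K2_def L2_norm_nonneg)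
    have "cmod (P h) \<le> K * (D * (K2 * L2_norm h) + L2_norm (p' h))"
      unfolding P_eq by (intro K(2) pcont[OF h] p'sq[OF h] supp0[OF h] pb)
    also have "\<dots> \<le> K * (D * (K2 * L2_norm h) + K4 * L2_norm h)"
      using p' K(1) by (intro mult_left_mono) auto
    finally show ?thesis by (simp add: algebra_simps)
  qed
  have gX: "g \<in> X" using Y(2) supp(2) by (simp add: X_def)
  have "F (T g) - P g = 0"
  proof (rule L2_functional_eq_0_if_test_eq_0[where L="\<lambda>h. F (T h) - P h" and a=a and C="\<bar>C\<bar> * K3 + K * (D * K2 + K4)", folded X_def])
    show "F (T (\<lambda>t. h t + k t)) - P (\<lambda>t. h t + k t) = F (T h) - P h + (F (T k) - P k)" if "h \<in> X" "k \<in> X" for h k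
      using FT_add[OF that] P_add[OF that] by simp
    show "F (T (\<lambda>t. c * h t)) - P (\<lambda>t. c * h t) = c * (F (T h) - P h)" if "h \<in> X" for c h
      using FT_cmult[OF that] P_cmult by (simp add: algebra_simps)
    show "cmod (F (T h) - P h) \<le> (\<bar>C\<bar> * K3 + K * (D * K2 + K4)) * L2_norm h" if "h \<in> X" for h
      using FT[OF that] P_bound[OF that] norm_triangle_ineq4[of "F (T h)" "P h"] by (simp add: distrib_right)
    \<comment> \<open>Here \<open>T \<eta>\<close> is itself a test function, where \<open>F\<close>
      is prescribed by \<open>r\<close> and \<open>r\<close> is the form.\<close>
    show "F (T \<eta>) - P \<eta> = 0" if \<eta>: "test_fun \<eta>" "\<eta> \<in> X" for \<eta>
    proof -
      have tG: "test_fun (G \<eta>)" unfolding G_def[abs_def] by (rule test_fun_lincomb[OF \<eta>(1) b(1)])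
      have tT: "test_fun (T \<eta>)" "vderiv (T \<eta>) = G \<eta>"
        using T(2)[OF \<eta>(2), of "-a"] a G0[OF \<eta>(2)]
        by (intro primitive_of_test_fun[OF tG T(1)[OF \<eta>(2)] _ _ Gint[OF \<eta>(2)], of a]; simp)+
      have sT: "smooth (T \<eta>)" using tT(1) by (simp add: test_fun_iff)
      have "F (T \<eta>) = r (\<lambda>t. \<psi> t * T \<eta> t)"
        using F tT(1) by (simp add: extends_to_def mult_functional_def)
      also have "\<dots> = potential_form \<sigma> \<tau> (\<lambda>t. \<psi> t * T \<eta> t) (vderiv (\<lambda>t. \<psi> t * T \<eta> t))"
        using r test_fun_mult[OF s\<psi> tT(1)] by (simp add: represents_def)
      also have "\<dots> = P \<eta>" unfolding vderiv_mult[OF s\<psi> sT] tT(2) P_def ..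
      finally show ?thesis by simp
    qed
  qed (use a gX in auto)
  \<comment> \<open>As the derivative of a compactly supported function, \<open>g\<close> has zero
    mean already: no multiple of \<open>b\<close> is subtracted, and \<open>T g\<close> is
    \<open>Y\<close>.\<close>
  moreover have "(LINT t|lborel. g t) = 0"
    by (rule ac_deriv_integral_zero(2)[OF Y(1), of a]) (use supp in auto)
  then have Gg: "G g = g" by (simp add: G_def fun_eq_iff)
  moreover have "T g = Y"
    by (rule ac_deriv_unique[of _ g _ "-a"]) (use T[OF gX] Gg Y supp a in auto)
  ultimately show ?thesis by (simp add: P_def)
qed

section \<open>The partition of unity\<close>

definition ramp :: "real \<Rightarrow> real" where
  "ramp t = max 0 t"

lemma ramp_squared_deriv: "((\<lambda>t. (ramp t)\<^sup>2) has_real_derivative 2 * ramp t) (at t)"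
proof -
  consider "t > 0" | "t < 0" | "t = 0" by linarith
  then show ?thesis
  proof cases
    case 1
    have "((\<lambda>t. t\<^sup>2) has_real_derivative 2 * t) (at t)" by (auto intro!: derivative_eq_intros)
    then have "((\<lambda>t. (ramp t)\<^sup>2) has_real_derivative 2 * t) (at t)"
      by (rule has_field_derivative_transform_within_open[of _ _ _ "{0<..}"]) (use 1 in \<open>auto simp: ramp_def\<close>)
    then show ?thesis using 1 by (simp add: ramp_def)
  next
    case 2
    have "((\<lambda>t. 0) has_real_derivative 0) (at t)" by simp
    then have "((\<lambda>t. (ramp t)\<^sup>2) has_real_derivative 0) (at t)"
      by (rule has_field_derivative_transform_within_open[of _ _ _ "{..<0}"]) (use 2 in \<open>auto simp: ramp_def\<close>)
    then show ?thesis using 2 by (simp add: ramp_def)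
  next
    case 3
    have "((\<lambda>h. (ramp h)\<^sup>2 / h) \<longlongrightarrow> 0) (at 0)"
    proof (rule Lim_null_comparison)
      show "\<forall>\<^sub>F h in at 0. norm ((ramp h)\<^sup>2 / h) \<le> \<bar>h\<bar>"
        by (auto simp: ramp_def max_def power2_eq_square)
      show "((\<lambda>h::real. \<bar>h\<bar>) \<longlongrightarrow> 0) (at 0)" by (rule tendsto_eq_intros refl | simp)+
    qed
    then show ?thesis using 3 by (simp add: has_field_derivative_iff ramp_def)
  qed
qed

text \<open>\<open>phi\<close> is a quadratic spline with knots -1, -1/2, 1/2, 1. Its second
  derivative jumps there by 4, -8, 8, -4, and half of each jump is the coefficient of the truncated
  square.\<close>

lemma phi_ramp: "phi t = 2 * (ramp (t + 1))\<^sup>2 - 4 * (ramp (t + 1/2))\<^sup>2 + 4 * (ramp (t - 1/2))\<^sup>2 - 2 * (ramp (t - 1))\<^sup>2"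
  by (auto simp: phi_def ramp_def max_def power2_eq_square field_simps)

definition phi_deriv :: "real \<Rightarrow> real" where
  "phi_deriv t = 4 * ramp (t + 1) - 8 * ramp (t + 1/2) + 8 * ramp (t - 1/2) - 4 * ramp (t - 1)"

lemma phi_has_derivative: "(phi has_real_derivative phi_deriv t) (at t)"
proof -
  have d: "((\<lambda>t. (ramp (t + c))\<^sup>2) has_real_derivative 2 * ramp (t + c)) (at t)" for c
  proof -
    have "((\<lambda>t. t + c) has_real_derivative 1) (at t)" by (auto intro!: derivative_eq_intros)
    from DERIV_chain2[OF ramp_squared_deriv this] show ?thesis by simp
  qed
  have "((\<lambda>t. 2 * (ramp (t + 1))\<^sup>2 - 4 * (ramp (t + 1/2))\<^sup>2 + 4 * (ramp (t + (- 1/2)))\<^sup>2 - 2 * (ramp (t + (- 1)))\<^sup>2)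
    has_real_derivative 2 * (2 * ramp (t + 1)) - 4 * (2 * ramp (t + 1/2)) + 4 * (2 * ramp (t + (- 1/2))) - 2 * (2 * ramp (t + (- 1)))) (at t)"
    by (intro DERIV_diff DERIV_add DERIV_cmult d)
  then show ?thesis by (simp add: phi_ramp[abs_def] phi_deriv_def)
qed

lemma phi_eq_0: "\<bar>t\<bar> \<ge> 1 \<Longrightarrow> phi t = 0" "\<bar>t\<bar> \<ge> 1 \<Longrightarrow> phi_deriv t = 0"
  by (auto simp: phi_def phi_deriv_def ramp_def max_def abs_if split: if_splits)

lemma phi_pos: "\<bar>t\<bar> < 1 \<Longrightarrow> phi t > 0"
proof -
  assume t: "\<bar>t\<bar> < 1"
  have "2 * t\<^sup>2 < 1" if "\<bar>t\<bar> \<le> 1/2"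
    using power_mono[OF that, of 2] by (simp add: power2_eq_square)
  then show ?thesis using t by (auto simp: phi_def abs_if split: if_splits)
qed

lemma phi_add_shift: "0 \<le> t \<Longrightarrow> t < 1 \<Longrightarrow> phi t + phi (t - 1) = 1"
  by (auto simp: phi_ramp ramp_def max_def power2_eq_square field_simps)

text \<open>At a given \<open>t\<close> only the translates by \<open>\<lfloor>t\<rfloor>\<close>
  and \<open>\<lfloor>t\<rfloor> + 1\<close> survive. Stated for a general \<open>f\<close> to cover
  both \<open>phi\<close>, with sum 1, and its derivative, with sum 0.\<close>

lemma sum_integer_translates:
  fixes f :: "real \<Rightarrow> real"
  assumes f: "\<And>t. \<bar>t\<bar> \<ge> 1 \<Longrightarrow> f t = 0" "\<And>t. 0 \<le> t \<Longrightarrow> t < 1 \<Longrightarrow> f t + f (t - 1) = c"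
    and t: "\<bar>t\<bar> < of_int N"
  shows "(\<Sum>k\<in>{-N..N}. f (t - of_int k)) = c"
proof -
  let ?k = "\<lfloor>t\<rfloor>"
  have b: "of_int ?k \<le> t" "t < of_int ?k + 1" by linarith+
  have k: "?k \<in> {-N..N}" "?k + 1 \<in> {-N..N}" using t by (auto simp: floor_less_iff le_floor_iff; linarith)+
  have z: "f (t - of_int j) = 0" if "j \<notin> {?k, ?k + 1}" for j
  proof (rule f(1))
    have "j \<le> ?k - 1 \<or> j \<ge> ?k + 2" using that by auto
    then have "of_int j \<le> (of_int ?k - 1 :: real) \<or> (of_int j :: real) \<ge> of_int ?k + 2" by linarith
    then show "\<bar>t - of_int j\<bar> \<ge> 1" using b by linarith
  qed
  have "(\<Sum>j\<in>{-N..N}. f (t - of_int j)) = (\<Sum>j\<in>{?k, ?k + 1}. f (t - of_int j))"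
    by (rule sum.mono_neutral_right) (use k z in auto)
  also have "\<dots> = f (t - of_int ?k) + f (t - of_int ?k - 1)"
    by (simp add: algebra_simps)
  also have "\<dots> = c" using f(2)[of "t - of_int ?k"] b by simp
  finally show ?thesis .
qed

definition phi_shift_deriv :: "int \<Rightarrow> real \<Rightarrow> complex" where
  "phi_shift_deriv n t = complex_of_real (phi_deriv (t - of_int n))"

lemma phi_deriv_add_shift: "0 \<le> t \<Longrightarrow> t < 1 \<Longrightarrow> phi_deriv t + phi_deriv (t - 1) = 0"
  by (auto simp: phi_deriv_def ramp_def max_def)

lemma sum_phi_shift:
  assumes "\<bar>t\<bar> < of_int N"
  shows "(\<Sum>k\<in>{-N..N}. phi_shift k t) = 1" "(\<Sum>k\<in>{-N..N}. phi_shift_deriv k t) = 0"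
  using sum_integer_translates[of phi 1, OF phi_eq_0(1) phi_add_shift assms]
    sum_integer_translates[of phi_deriv 0, OF phi_eq_0(2) phi_deriv_add_shift assms]
  by (simp_all add: phi_shift_def phi_shift_deriv_def flip: of_real_sum)

lemma continuous_phi_deriv: "continuous_on S phi_deriv"
  unfolding phi_deriv_def[abs_def] ramp_def by (intro continuous_intros)

lemma ac_deriv_phi_shift: "ac_deriv (phi_shift n) (phi_shift_deriv n)"
proof (rule ac_derivI)
  fix t
  have "((\<lambda>t. phi (t - of_int n)) has_real_derivative phi_deriv (t - of_int n) * 1) (at t)"
    by (rule DERIV_chain'[OF _ phi_has_derivative]) (auto intro!: derivative_eq_intros)
  then show "(phi_shift n has_vector_derivative phi_shift_deriv n t) (at t)"
    unfolding phi_shift_def[abs_def] phi_shift_deriv_def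
    by (intro has_vector_derivative_of_real) (simp add: has_real_derivative_iff_has_vector_derivative)
  show "continuous_on UNIV (phi_shift_deriv n)"
    unfolding phi_shift_deriv_def[abs_def]
    by (intro continuous_intros continuous_on_compose2[OF continuous_phi_deriv[of UNIV]]) auto
qed

lemma phi_shift_eq_0:
  assumes "\<bar>t - of_int n\<bar> \<ge> 1" shows "phi_shift n t = 0" "phi_shift_deriv n t = 0"
  using assms by (auto simp: phi_shift_def phi_shift_deriv_def phi_eq_0)

lemma closure_phi_shift: "closure {t. phi_shift n t \<noteq> 0} = {of_int n - 1..of_int n + 1}"
proof -
  have "{t. phi_shift n t \<noteq> 0} = {of_int n - 1<..<of_int n + 1}"
  proof (intro set_eqI)
    fix t
    show "t \<in> {t. phi_shift n t \<noteq> 0} \<longleftrightarrow> t \<in> {of_int n - 1<..<of_int n + 1}"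
    proof (cases "\<bar>t - of_int n\<bar> < 1")
      case True
      then show ?thesis using phi_pos[OF True] by (auto simp: phi_shift_def)
    next
      case False
      then show ?thesis using phi_shift_eq_0(1)[of t n] by auto
    qed
  qed
  then show ?thesis by simp
qed

lemma cutoff_for_phi_shift: "cutoff_for (phi_shift n) (SOME \<psi>. cutoff_for (phi_shift n) \<psi>)"
proof -
  \<comment> \<open>Dilation by 2 makes the plateau \<open>{n - 2..n + 2}\<close>, a neighbourhood
    of the support \<open>{n - 1..n + 1}\<close>.\<close>
  have "cutoff_for (phi_shift n) (\<lambda>t. bump ((1/2) * t + - (of_int n / 2)))"
    unfolding cutoff_for_def closure_phi_shift
  proof (intro conjI exI[of _ "{of_int n - 2<..<of_int n + 2}"] ballI)
    show "test_fun (\<lambda>t. bump (1 / 2 * t + - (of_int n / 2)))" by (rule test_fun_bump_affine) simp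
    fix t :: real assume "t \<in> {of_int n - 2<..<of_int n + 2}"
    then have "\<bar>1 / 2 * t + - (of_int n / 2)\<bar> \<le> 1" by (simp add: abs_le_iff)
    then show "bump (1 / 2 * t + - (of_int n / 2)) = 1" by (rule bump_eq_1)
  qed auto
  then have "\<exists>\<psi>. cutoff_for (phi_shift n) \<psi>" by blast
  then show ?thesis by (rule someI_ex)
qed

text \<open>Near the support of \<open>phi_shift n\<close> the cutoff is the constant 1. These
  identities make the choice of the cutoff disappear from the product with a distribution.\<close>

lemma cutoff_for_phi_shift_mult:
  assumes "cutoff_for (phi_shift n) \<psi>"
  shows "test_fun \<psi>" "\<psi> t * phi_shift n t = phi_shift n t" "\<psi> t * phi_shift_deriv n t = phi_shift_deriv n t"
    "vderiv \<psi> t * phi_shift n t = 0"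
proof -
  obtain U where U: "open U" "{of_int n - 1..of_int n + 1} \<subseteq> U" "\<And>t. t \<in> U \<Longrightarrow> \<psi> t = 1" and tf: "test_fun \<psi>"
    using assms by (auto simp: cutoff_for_def closure_phi_shift)
  show "test_fun \<psi>" by (rule tf)
  consider "t \<in> U" | "\<bar>t - of_int n\<bar> \<ge> 1" using U(2) by (cases "\<bar>t - of_int n\<bar> \<ge> 1") (auto simp: subset_iff not_le abs_less_iff)
  then have "\<psi> t * phi_shift n t = phi_shift n t \<and> \<psi> t * phi_shift_deriv n t = phi_shift_deriv n t \<and> vderiv \<psi> t * phi_shift n t = 0"
  proof cases
    case 1
    have "((\<lambda>t. 1) has_vector_derivative 0) (at t)" by simp
    then have "(\<psi> has_vector_derivative 0) (at t)"
      by (rule has_vector_derivative_transform_within_open[OF _ U(1) 1]) (simp add: U(3))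
    then show ?thesis using U(3)[OF 1] by (simp add: vderiv_def vector_derivative_at)
  next
    case 2
    then show ?thesis by (simp add: phi_shift_eq_0)
  qed
  then show "\<psi> t * phi_shift n t = phi_shift n t" "\<psi> t * phi_shift_deriv n t = phi_shift_deriv n t"
    "vderiv \<psi> t * phi_shift n t = 0" by auto
qed

section \<open>The uniform norm controls the form locally\<close>

lemma sobolev_pair_mult_compact_support:
  assumes m: "ac_deriv m m'" "L2_loc m'" "\<And>t. \<bar>t\<bar> > a \<Longrightarrow> m t = 0" "\<And>t. \<bar>t\<bar> > a \<Longrightarrow> m' t = 0"
    and y: "ac_deriv y h" "L2_loc h"
  shows "sobolev_pair (\<lambda>t. m t * y t) (\<lambda>t. m' t * y t + m t * h t)"
proof -
  have d: "ac_deriv (\<lambda>t. m t * y t) (\<lambda>t. m' t * y t + m t * h t)" by (rule ac_deriv_mult[OF m(1) y(1)])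
  have "L2_loc (\<lambda>t. y t * m' t + m t * h t)"
    by (intro L2_loc_add L2_loc_continuous_mult ac_deriv_continuous[OF y(1)] ac_deriv_continuous[OF m(1)] m y)
  then have "L2_loc (\<lambda>t. m' t * y t + m t * h t)" by (simp add: mult.commute)
  then have "square_integrable (\<lambda>t. m' t * y t + m t * h t)"
    by (rule L2_loc_compact_support[of _ a]) (simp add: m)
  moreover have "square_integrable (\<lambda>t. m t * y t)"
    by (rule continuous_square_integrable[OF ac_deriv_continuous[OF d], of a]) (simp add: m)
  ultimately show ?thesis using d by (simp add: sobolev_pair_def)
qed

lemma L2_loc_phi_shift_deriv: "L2_loc (phi_shift_deriv n)"
  unfolding phi_shift_deriv_def[abs_def]
  by (intro L2_loc_continuous continuous_intros continuous_on_compose2[OF continuous_phi_deriv[of UNIV]]) auto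

lemma phi_shift_support: "\<bar>t\<bar> \<ge> \<bar>of_int n\<bar> + 1 \<Longrightarrow> phi_shift n t = 0" "\<bar>t\<bar> \<ge> \<bar>of_int n\<bar> + 1 \<Longrightarrow> phi_shift_deriv n t = 0"
  by (auto intro!: phi_shift_eq_0)

lemma sobolev_pair_phi_shift_mult:
  assumes "ac_deriv y h" "L2_loc h"
  shows "sobolev_pair (\<lambda>t. phi_shift n t * y t) (\<lambda>t. phi_shift_deriv n t * y t + phi_shift n t * h t)"
  by (rule sobolev_pair_mult_compact_support[OF ac_deriv_phi_shift L2_loc_phi_shift_deriv _ _ assms, of "\<bar>of_int n\<bar> + 1"])
     (auto intro: phi_shift_support)

text \<open>The extension property of \<open>Wm12_loc\<close> on its own, in a form that passes to
  the difference of two potentials.\<close>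

definition extendable :: "functional \<Rightarrow> bool" where
  "extendable r \<longleftrightarrow> (\<forall>\<psi>. test_fun \<psi> \<longrightarrow> (\<exists>F. extends_to (mult_functional r \<psi>) F))"

lemma Wm12_loc_extendable: "r \<in> Wm12_loc \<Longrightarrow> extendable r"
  by (simp add: Wm12_loc_def extendable_def)

text \<open>Eliminates the two choices hidden in \<open>mult_Wm12_loc\<close>:
  \<open>extension_eq_potential_form\<close> evaluates the chosen extension at
  \<open>phi_shift n * y\<close>, and the chosen cutoff is 1 with zero derivative there.\<close>

lemma mult_Wm12_loc_eq_potential_form:
  assumes ext: "extendable r" and rep: "represents r \<sigma> \<tau>" and y: "sobolev_pair y h"
  shows "mult_Wm12_loc r (phi_shift n) y =
    potential_form \<sigma> \<tau> (\<lambda>t. phi_shift n t * y t) (\<lambda>t. phi_shift_deriv n t * y t + phi_shift n t * h t)"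
proof -
  define \<psi> where "\<psi> = (SOME \<psi>. cutoff_for (phi_shift n) \<psi>)"
  have c: "cutoff_for (phi_shift n) \<psi>" unfolding \<psi>_def by (rule cutoff_for_phi_shift)
  note \<psi> = cutoff_for_phi_shift_mult[OF c]
  define F where "F = dual_extension (mult_functional r \<psi>)"
  have "\<exists>F. extends_to (mult_functional r \<psi>) F" using ext \<psi>(1) by (simp add: extendable_def)
  then have F: "extends_to (mult_functional r \<psi>) F"
    unfolding F_def dual_extension_def by (rule someI_ex)
  have s: "sobolev_pair (\<lambda>t. phi_shift n t * y t) (\<lambda>t. phi_shift_deriv n t * y t + phi_shift n t * h t)"
    using y by (intro sobolev_pair_phi_shift_mult square_integrable_imp_L2_loc) (auto simp: sobolev_pair_def)
  have "mult_Wm12_loc r (phi_shift n) y = F (\<lambda>t. phi_shift n t * y t)"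
    unfolding mult_Wm12_loc_def \<psi>_def[symmetric] F_def[symmetric] by (simp add: mult_functional_def)
  also have "\<dots> = potential_form \<sigma> \<tau> (\<lambda>t. \<psi> t * (phi_shift n t * y t))
      (\<lambda>t. vderiv \<psi> t * (phi_shift n t * y t) + \<psi> t * (phi_shift_deriv n t * y t + phi_shift n t * h t))"
    by (rule extension_eq_potential_form[OF rep \<psi>(1) F, of _ _ "\<bar>of_int n\<bar> + 1"])
       (use s phi_shift_support in \<open>auto simp: sobolev_pair_def\<close>)
  also have "(\<lambda>t. \<psi> t * (phi_shift n t * y t)) = (\<lambda>t. phi_shift n t * y t)"
    by (simp only: mult.assoc[symmetric] \<psi>(2))
  also have "(\<lambda>t. vderiv \<psi> t * (phi_shift n t * y t) + \<psi> t * (phi_shift_deriv n t * y t + phi_shift n t * h t))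
    = (\<lambda>t. phi_shift_deriv n t * y t + phi_shift n t * h t)"
    by (simp only: mult.assoc[symmetric] distrib_left \<psi>(2-4) mult_zero_left add_0_left)
  finally show ?thesis .
qed

lemma mult_Wm12_loc_AE_cong:
  assumes ext: "extendable r" and u: "u \<in> W12" and v: "sobolev_pair v h" and ae: "AE t in lborel. u t = v t"
  shows "mult_Wm12_loc r (phi_shift n) u = mult_Wm12_loc r (phi_shift n) v"
proof -
  define \<psi> where "\<psi> = (SOME \<psi>. cutoff_for (phi_shift n) \<psi>)"
  have c: "cutoff_for (phi_shift n) \<psi>" unfolding \<psi>_def by (rule cutoff_for_phi_shift)
  define F where "F = dual_extension (mult_functional r \<psi>)"
  have "\<exists>F. extends_to (mult_functional r \<psi>) F"
    using ext cutoff_for_phi_shift_mult(1)[OF c] by (simp add: extendable_def)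
  then have "extends_to (mult_functional r \<psi>) F"
    unfolding F_def dual_extension_def by (rule someI_ex)
  then have F: "F \<in> W12_dual" by (simp add: extends_to_def)
  have s: "sobolev_pair (\<lambda>t. phi_shift n t * v t) (\<lambda>t. phi_shift_deriv n t * v t + phi_shift n t * h t)"
    using v by (intro sobolev_pair_phi_shift_mult square_integrable_imp_L2_loc) (auto simp: sobolev_pair_def)
  have ae': "AE t in lborel. phi_shift n t * v t = phi_shift n t * u t" using ae by eventually_elim simp
  have m: "(\<lambda>t. phi_shift n t * u t) \<in> borel_measurable borel"
    using u by (intro borel_measurable_times ac_deriv_measurable(1)[OF ac_deriv_phi_shift]) (auto simp: W12_def dest: square_integrable_measurable)
  have "has_weak_deriv (\<lambda>t. phi_shift n t * u t) (\<lambda>t. phi_shift_deriv n t * v t + phi_shift n t * h t)"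
    using s by (intro has_weak_deriv_AE_cong[OF _ ae' m] ac_deriv_imp_has_weak_deriv) (simp add: sobolev_pair_def)
  then have "(\<lambda>t. phi_shift n t * u t) \<in> W12"
    using s square_integrable_AE_cong(1)[OF _ ae' m] by (auto simp: W12_def sobolev_pair_def)
  then have "F (\<lambda>t. phi_shift n t * v t) = F (\<lambda>t. phi_shift n t * u t)"
    using W12_dual_AE_cong[OF F sobolev_pair_W12(1)[OF s] _ ae'] by simp
  then show ?thesis
    unfolding mult_Wm12_loc_def \<psi>_def[symmetric] F_def[symmetric] by (simp add: mult_functional_def)
qed

lemma dual_norm_bound:
  assumes F: "F \<in> W12_dual" and y: "sobolev_pair y h"
  shows "cmod (F y) \<le> dual_norm F * sobolev_norm y h"
proof -
  obtain C where C: "\<And>u. u \<in> W12 \<Longrightarrow> cmod (F u) \<le> C * W12_norm u" using F unfolding W12_dual_def by blast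
  have W0: "W12_norm u \<ge> 0" for u by (simp add: W12_norm_def)
  have bdd: "bdd_above ((\<lambda>u. cmod (F u)) ` {u \<in> W12. W12_norm u \<le> 1})"
  proof (rule bdd_aboveI2)
    fix u assume "u \<in> {u \<in> W12. W12_norm u \<le> 1}"
    then have "cmod (F u) \<le> C * W12_norm u" "W12_norm u \<le> 1" using C by auto
    moreover have "C * W12_norm u \<le> \<bar>C\<bar> * 1"
      using \<open>W12_norm u \<le> 1\<close> W0[of u] by (intro mult_mono) auto
    ultimately show "cmod (F u) \<le> \<bar>C\<bar>" by simp
  qed
  show ?thesis
  proof (cases "sobolev_norm y h = 0")
    case True
    then show ?thesis using C[OF sobolev_pair_W12(1)[OF y]] sobolev_pair_W12(2)[OF y] by simp
  next
    case False
    then have p: "sobolev_norm y h > 0" using sobolev_norm_nonneg[of y h] by linarith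
    let ?c = "complex_of_real (inverse (sobolev_norm y h))"
    have s: "sobolev_pair (\<lambda>t. ?c * y t) (\<lambda>t. ?c * h t)" by (rule sobolev_pair_cmult[OF y])
    have "cmod ?c * sobolev_norm y h = 1" using p by (simp add: norm_inverse)
    then have "W12_norm (\<lambda>t. ?c * y t) \<le> 1"
      unfolding sobolev_pair_W12(2)[OF s] sobolev_norm_cmult by simp
    then have "cmod (F (\<lambda>t. ?c * y t)) \<le> dual_norm F"
      unfolding dual_norm_def using sobolev_pair_W12(1)[OF s] by (intro cSUP_upper bdd) auto
    moreover have "F (\<lambda>t. ?c * y t) = ?c * F y" by (rule W12_dual_cmult[OF F sobolev_pair_W12(1)[OF y]])
    ultimately have "inverse (sobolev_norm y h) * cmod (F y) \<le> dual_norm F"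
      using p by (simp add: norm_mult norm_inverse)
    then show ?thesis using p by (simp add: field_simps)
  qed
qed

lemma dual_norm_least:
  assumes "\<And>u. u \<in> W12 \<Longrightarrow> W12_norm u \<le> 1 \<Longrightarrow> cmod (F u) \<le> M"
  shows "dual_norm F \<le> M"
proof -
  have z: "sobolev_pair (\<lambda>t. 0) (\<lambda>t. 0)"
    by (simp add: sobolev_pair_def square_integrable_def ac_deriv_def locally_integrable_def set_integrable_def)
  have "(\<lambda>t. 0) \<in> {u \<in> W12. W12_norm u \<le> 1}"
    using sobolev_pair_W12[OF z] by (simp add: sobolev_norm_def L2_norm_def)
  then show ?thesis unfolding dual_norm_def by (intro cSUP_least) (use assms in auto)
qed

section \<open>Differences of potentials\<close>

lemma admissible_diff:
  assumes "admissible \<sigma> \<tau>" "admissible \<sigma>' \<tau>'"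
  shows "admissible (\<lambda>t. \<sigma> t - \<sigma>' t) (\<lambda>t. \<tau> t - \<tau>' t)"
  using assms L2_loc_add[of "\<lambda>t. complex_of_real (\<sigma> t)" "\<lambda>t. (-1) * complex_of_real (\<sigma>' t)"] L2_loc_cmult[of "\<lambda>t. complex_of_real (\<sigma>' t)" "-1"]
    locally_integrable_diff[of "\<lambda>t. complex_of_real (\<tau> t)" "\<lambda>t. complex_of_real (\<tau>' t)"]
  by (simp add: admissible_def)

lemma potential_form_diff:
  assumes "admissible \<sigma> \<tau>" "admissible \<sigma>' \<tau>'" "continuous_on UNIV p" "L2_loc p'"
    and "\<And>t. \<bar>t\<bar> > a \<Longrightarrow> p t = 0" "\<And>t. \<bar>t\<bar> > a \<Longrightarrow> p' t = 0"
  shows "potential_form (\<lambda>t. \<sigma> t - \<sigma>' t) (\<lambda>t. \<tau> t - \<tau>' t) p p' = potential_form \<sigma> \<tau> p p' - potential_form \<sigma>' \<tau>' p p'"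
proof -
  have "potential_form \<sigma> \<tau> p p' - potential_form \<sigma>' \<tau>' p p' =
    (LINT t|lborel. (of_real (\<tau> t) * p t - of_real (\<sigma> t) * p' t) - (of_real (\<tau>' t) * p t - of_real (\<sigma>' t) * p' t))"
    unfolding potential_form_def
    using potential_form_integrable[OF assms(1,3-6)] potential_form_integrable[OF assms(2-6)]
    by (intro Bochner_Integration.integral_diff[symmetric] Bochner_Integration.integrable_diff) auto
  then show ?thesis by (simp add: potential_form_def algebra_simps)
qed

lemma represents_diff:
  assumes "represents q \<sigma> \<tau>" "represents q' \<sigma>' \<tau>'"
  shows "represents (\<lambda>\<psi>. q \<psi> - q' \<psi>) (\<lambda>t. \<sigma> t - \<sigma>' t) (\<lambda>t. \<tau> t - \<tau>' t)"
  unfolding represents_def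
proof (intro conjI allI impI)
  have a: "admissible \<sigma> \<tau>" "admissible \<sigma>' \<tau>'" using assms by (auto simp: represents_def)
  then show "admissible (\<lambda>t. \<sigma> t - \<sigma>' t) (\<lambda>t. \<tau> t - \<tau>' t)" by (rule admissible_diff)
  fix \<psi> assume \<psi>: "test_fun \<psi>"
  then obtain c where c: "\<And>t. \<bar>t\<bar> > c \<Longrightarrow> \<psi> t = 0" and s: "smooth \<psi>" by (auto simp: test_fun_iff)
  have "potential_form (\<lambda>t. \<sigma> t - \<sigma>' t) (\<lambda>t. \<tau> t - \<tau>' t) \<psi> (vderiv \<psi>) = potential_form \<sigma> \<tau> \<psi> (vderiv \<psi>) - potential_form \<sigma>' \<tau>' \<psi> (vderiv \<psi>)"
    by (rule potential_form_diff[OF a, of _ _ c])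
       (use vderiv_compact_support[OF s c] c in \<open>auto intro: smooth_continuous s L2_loc_continuous smooth_deriv(2)\<close>)
  then show "q \<psi> - q' \<psi> = potential_form (\<lambda>t. \<sigma> t - \<sigma>' t) (\<lambda>t. \<tau> t - \<tau>' t) \<psi> (vderiv \<psi>)"
    using assms \<psi> by (simp add: represents_def)
qed

lemma extendable_diff:
  assumes "extendable q" "extendable q'" shows "extendable (\<lambda>\<psi>. q \<psi> - q' \<psi>)"
  unfolding extendable_def
proof (intro allI impI)
  fix \<psi> assume "test_fun \<psi>"
  then obtain F F' where F: "extends_to (mult_functional q \<psi>) F" "extends_to (mult_functional q' \<psi>) F'"
    using assms unfolding extendable_def by blast
  obtain C C' where C: "\<forall>u\<in>W12. cmod (F u) \<le> C * W12_norm u" "\<forall>u\<in>W12. cmod (F' u) \<le> C' * W12_norm u"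
    using F by (auto simp: extends_to_def W12_dual_def)
  have "\<forall>u\<in>W12. cmod (F u - F' u) \<le> (C + C') * W12_norm u"
    using C by (auto intro!: order_trans[OF norm_triangle_ineq4] simp: distrib_right add_mono)
  then have "(\<lambda>u. F u - F' u) \<in> W12_dual"
    using F by (auto simp: extends_to_def W12_dual_def right_diff_distrib)
  then have "extends_to (mult_functional (\<lambda>\<psi>. q \<psi> - q' \<psi>) \<psi>) (\<lambda>u. F u - F' u)"
    using F by (simp add: extends_to_def mult_functional_def)
  then show "\<exists>F. extends_to (mult_functional (\<lambda>\<psi>. q \<psi> - q' \<psi>) \<psi>) F" by blast
qed

text \<open>\<open>Wm12_unif_norm\<close> is a supremum and bounds its members only if they are
  bounded above. For the difference, both this and the membership of the localized products in
  \<open>W12_dual\<close> are derived from the corresponding properties of \<open>q\<close> and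
  \<open>q'\<close>.\<close>

lemma Wm12_unif_norm_diff_bound:
  assumes q: "q \<in> Wm12_unif" "represents q \<sigma> \<tau>" and q': "q' \<in> Wm12_unif" "represents q' \<sigma>' \<tau>'"
    and y: "sobolev_pair y h"
  shows "cmod (potential_form (\<lambda>t. \<sigma> t - \<sigma>' t) (\<lambda>t. \<tau> t - \<tau>' t) (\<lambda>t. phi_shift n t * y t)
      (\<lambda>t. phi_shift_deriv n t * y t + phi_shift n t * h t))
    \<le> Wm12_unif_norm (\<lambda>\<psi>. q \<psi> - q' \<psi>) * sobolev_norm y h"
proof -
  define r where "r \<psi> = q \<psi> - q' \<psi>" for \<psi>
  have e: "extendable q" "extendable q'" "extendable r"
    using q q' Wm12_loc_extendable extendable_diff unfolding r_def[abs_def] by (auto simp: Wm12_unif_def)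
  have rep: "represents r (\<lambda>t. \<sigma> t - \<sigma>' t) (\<lambda>t. \<tau> t - \<tau>' t)"
    unfolding r_def[abs_def] by (rule represents_diff[OF q(2) q'(2)])
  have adm: "admissible \<sigma> \<tau>" "admissible \<sigma>' \<tau>'" using q q' by (auto simp: represents_def)
  \<comment> \<open>Not immediate, because the extensions for \<open>r\<close>, \<open>q\<close> and
    \<open>q'\<close> are chosen independently; all three are evaluated as forms, which are additive
    in the potential.\<close>
  have diff: "mult_Wm12_loc r (phi_shift n) u = mult_Wm12_loc q (phi_shift n) u - mult_Wm12_loc q' (phi_shift n) u"
    if u: "u \<in> W12" for n u
  proof -
    obtain v k where v: "sobolev_pair v k" "AE t in lborel. u t = v t" using W12_sobolev_pair[OF u] by blast
    have s: "sobolev_pair (\<lambda>t. phi_shift n t * v t) (\<lambda>t. phi_shift_deriv n t * v t + phi_shift n t * k t)"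
      using v(1) by (intro sobolev_pair_phi_shift_mult square_integrable_imp_L2_loc) (auto simp: sobolev_pair_def)
    show ?thesis
      unfolding mult_Wm12_loc_AE_cong[OF e(1) u v] mult_Wm12_loc_AE_cong[OF e(2) u v] mult_Wm12_loc_AE_cong[OF e(3) u v]
        mult_Wm12_loc_eq_potential_form[OF e(1) q(2) v(1)] mult_Wm12_loc_eq_potential_form[OF e(2) q'(2) v(1)]
        mult_Wm12_loc_eq_potential_form[OF e(3) rep v(1)]
      by (rule potential_form_diff[OF adm, of _ _ "\<bar>of_int n\<bar> + 1"])
         (use s in \<open>auto simp: sobolev_pair_def phi_shift_support intro: ac_deriv_continuous square_integrable_imp_L2_loc\<close>)
  qed
  have d: "mult_Wm12_loc q (phi_shift n) \<in> W12_dual" "mult_Wm12_loc q' (phi_shift n) \<in> W12_dual" for n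
    using q q' by (auto simp: Wm12_unif_def)
  have dr: "mult_Wm12_loc r (phi_shift n) \<in> W12_dual" for n
  proof -
    obtain C C' where C: "\<forall>u\<in>W12. cmod (mult_Wm12_loc q (phi_shift n) u) \<le> C * W12_norm u" "\<forall>u\<in>W12. cmod (mult_Wm12_loc q' (phi_shift n) u) \<le> C' * W12_norm u"
      using d[of n] by (auto simp: W12_dual_def)
    have "\<forall>u\<in>W12. cmod (mult_Wm12_loc r (phi_shift n) u) \<le> (C + C') * W12_norm u"
      using C by (auto simp: diff distrib_right intro!: order_trans[OF norm_triangle_ineq4] add_mono)
    \<comment> \<open>Additivity is tested at \<open>u + v\<close>, and \<open>diff\<close> applies
      only to elements of \<open>W12\<close>.\<close>
    moreover have "(\<lambda>t. u t + v t) \<in> W12" if uv: "u \<in> W12" "v \<in> W12" for u v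
    proof -
      obtain f g where "square_integrable u" "has_weak_deriv u f" "square_integrable f"
        "square_integrable v" "has_weak_deriv v g" "square_integrable g" using uv by (auto simp: W12_def)
      moreover have "has_weak_deriv (\<lambda>t. u t + v t) (\<lambda>t. f t + g t)"
      proof -
        obtain a where a: "ac_deriv a f" "AE t in lborel. u t = a t" using has_weak_deriv_imp_ac_deriv[OF \<open>has_weak_deriv u f\<close>] by blast
        obtain b where b: "ac_deriv b g" "AE t in lborel. v t = b t" using has_weak_deriv_imp_ac_deriv[OF \<open>has_weak_deriv v g\<close>] by blast
        have "AE t in lborel. a t + b t = u t + v t" using a(2) b(2) by eventually_elim simp
        then show ?thesis
          using \<open>square_integrable u\<close> \<open>square_integrable v\<close>
          by (intro has_weak_deriv_AE_cong[OF ac_deriv_imp_has_weak_deriv[OF ac_deriv_add[OF a(1) b(1)]]] borel_measurable_add)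
             (auto dest: square_integrable_measurable)
      qed
      ultimately show ?thesis unfolding W12_def using square_integrable_add(1) by blast
    qed
    ultimately show ?thesis
      using d[of n] unfolding W12_dual_def
      by (auto simp: diff W12_cmult right_diff_distrib)
  qed
  have bdd: "bdd_above (range (\<lambda>n. dual_norm (mult_Wm12_loc r (phi_shift n))))"
  proof -
    obtain B B' where B: "\<And>n. dual_norm (mult_Wm12_loc q (phi_shift n)) \<le> B" "\<And>n. dual_norm (mult_Wm12_loc q' (phi_shift n)) \<le> B'"
      using q(1) q'(1) by (auto simp: Wm12_unif_def bdd_above_def)
    have "dual_norm (mult_Wm12_loc r (phi_shift n)) \<le> \<bar>B\<bar> + \<bar>B'\<bar>" for n
    proof (rule dual_norm_least)
      fix u assume u: "u \<in> W12" "W12_norm u \<le> 1"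
      obtain v k where v: "sobolev_pair v k" "AE t in lborel. u t = v t" "W12_norm u = sobolev_norm v k" using W12_sobolev_pair[OF u(1)] by blast
      have *: "cmod (F v) \<le> \<bar>b\<bar>" if "F \<in> W12_dual" "dual_norm F \<le> b" for F b
      proof -
        have "cmod (F v) \<le> dual_norm F * sobolev_norm v k" by (rule dual_norm_bound[OF that(1) v(1)])
        also have "\<dots> \<le> \<bar>b\<bar> * 1"
          using that(2) u(2) v(3) sobolev_norm_nonneg[of v k] by (intro mult_mono) auto
        finally show ?thesis by simp
      qed
      have "cmod (mult_Wm12_loc r (phi_shift n) u) = cmod (mult_Wm12_loc q (phi_shift n) v - mult_Wm12_loc q' (phi_shift n) v)"
        unfolding diff[OF u(1)] mult_Wm12_loc_AE_cong[OF e(1) u(1) v(1,2)] mult_Wm12_loc_AE_cong[OF e(2) u(1) v(1,2)] ..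
      also have "\<dots> \<le> \<bar>B\<bar> + \<bar>B'\<bar>"
        by (intro order_trans[OF norm_triangle_ineq4] add_mono * d B)
      finally show "cmod (mult_Wm12_loc r (phi_shift n) u) \<le> \<bar>B\<bar> + \<bar>B'\<bar>" .
    qed
    then show ?thesis by (rule bdd_aboveI2)
  qed
  have "cmod (mult_Wm12_loc r (phi_shift n) y) \<le> dual_norm (mult_Wm12_loc r (phi_shift n)) * sobolev_norm y h"
    by (rule dual_norm_bound[OF dr y])
  also have "\<dots> \<le> Wm12_unif_norm r * sobolev_norm y h"
    unfolding Wm12_unif_norm_def by (intro mult_right_mono cSUP_upper bdd sobolev_norm_nonneg) auto
  finally show ?thesis
    unfolding mult_Wm12_loc_eq_potential_form[OF e(3) rep y] unfolding r_def[abs_def] .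
qed

section \<open>Decompositions\<close>

lemma set_integrable_unit_intervals:
  fixes g :: "real \<Rightarrow> real"
  assumes "\<And>t. set_integrable lborel {t..t+1} g"
  shows "set_integrable lborel {a..b} g"
proof -
  have "set_integrable lborel {a..a + real n} g" for n
  proof (induction n)
    case 0
    show ?case by (rule set_integrable_subset[OF assms[of a]]) auto
  next
    case (Suc n)
    have "set_integrable lborel ({a..a + real n} \<union> {a + real n..a + real n + 1}) g"
      by (intro set_integrable_Un Suc assms) auto
    moreover have "{a..a + real n} \<union> {a + real n..a + real n + 1} = {a..a + real (Suc n)}" by auto
    ultimately show ?case by simp
  qed
  moreover obtain n where "b - a \<le> real n" using real_arch_simple by blast
  ultimately show ?thesis
    by (intro set_integrable_subset[of lborel "{a..a + real n}" g "{a..b}"]) auto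
qed

lemma decomposition_represents:
  assumes "decomposition q \<sigma> \<tau>" shows "represents q \<sigma> \<tau>"
proof -
  have adm: "admissible \<sigma> \<tau>"
    unfolding admissible_def
  proof
    have [measurable]: "\<sigma> \<in> borel_measurable borel" using assms by (simp add: decomposition_def)
    show "L2_loc (\<lambda>t. complex_of_real (\<sigma> t))"
      using assms set_integrable_unit_intervals[of "\<lambda>t. (\<sigma> t)\<^sup>2"]
      by (simp add: L2_loc_def decomposition_def uniformly_locally_integrable_def)
    have i: "set_integrable lborel {a..b} \<tau>" for a b
      by (rule set_integrable_unit_intervals) (use assms in \<open>simp add: decomposition_def uniformly_locally_integrable_def\<close>)
    show "locally_integrable (\<lambda>t. complex_of_real (\<tau> t))"
      unfolding locally_integrable_def
    proof (intro allI)
      fix a b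
      have "integrable lborel (\<lambda>t. complex_of_real (indicator {a..b} t *\<^sub>R \<tau> t))"
        using i[of a b] unfolding set_integrable_def complex_of_real_integrable_eq .
      then show "set_integrable lborel {a..b} (\<lambda>t. complex_of_real (\<tau> t))"
        by (simp add: set_integrable_def scaleR_conv_of_real)
    qed
  qed
  moreover have "q \<psi> = potential_form \<sigma> \<tau> \<psi> (vderiv \<psi>)" if \<psi>: "test_fun \<psi>" for \<psi>
  proof -
    obtain c where c: "\<And>t. \<bar>t\<bar> > c \<Longrightarrow> \<psi> t = 0" and s: "smooth \<psi>" using \<psi> by (auto simp: test_fun_iff)
    note i = potential_form_integrable[OF adm smooth_continuous[OF s] L2_loc_continuous[OF smooth_continuous[OF smooth_deriv(2)[OF s]]] c vderiv_compact_support[OF s c]]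
    have "potential_form \<sigma> \<tau> \<psi> (vderiv \<psi>) = (LINT t|lborel. complex_of_real (\<tau> t) * \<psi> t) - (LINT t|lborel. complex_of_real (\<sigma> t) * vderiv \<psi> t)"
      unfolding potential_form_def by (intro Bochner_Integration.integral_diff i)
    then show ?thesis using assms \<psi> by (simp add: decomposition_def)
  qed
  ultimately show ?thesis by (simp add: represents_def)
qed

section \<open>Form estimates\<close>

lemma ac_deriv_norm_squared:
  assumes "ac_deriv y h"
  shows "ac_deriv (\<lambda>t. of_real ((cmod (y t))\<^sup>2)) (\<lambda>t. h t * cnj (y t) + y t * cnj (h t))"
proof -
  have "(\<lambda>t. complex_of_real ((cmod (y t))\<^sup>2)) = (\<lambda>t. y t * cnj (y t))"
    by (simp add: complex_norm_square fun_eq_iff del: of_real_power)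
  then show ?thesis using ac_deriv_mult[OF assms ac_deriv_cnj[OF assms]] by simp
qed

lemma norm_squared_deriv_le: "cmod (h * cnj y + y * cnj h) \<le> 2 * (cmod y * cmod h)"
  using norm_triangle_ineq[of "h * cnj y" "y * cnj h"] by (simp add: norm_mult mult.commute)

lemma L2_loc_set_integrable: "L2_loc f \<Longrightarrow> set_integrable lborel {a..b} (\<lambda>t. (cmod (f t))\<^sup>2)"
  by (simp add: L2_loc_def)

lemma L2_loc_set_integrable_mult:
  assumes "L2_loc f" "L2_loc g" shows "set_integrable lborel {a..b} (\<lambda>t. cmod (f t) * cmod (g t))"
  using set_integrable_norm[OF locally_integrable_on[OF L2_loc_mult[OF assms]]] by (simp add: norm_mult)

text \<open>Averaging \<open>\<bar>y(t)\<bar>\<^sup>2 \<le> \<bar>y(s)\<bar>\<^sup>2 + 2 \<integral>\<bar>y h\<bar>\<close> over \<open>s\<close>.\<close>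

lemma interval_sup_bound:
  assumes y: "ac_deriv y h" "L2_loc h" and t: "t \<in> {c..d}" and cd: "d - c \<ge> 1" and \<delta>: "\<delta> > 0"
  shows "(cmod (y t))\<^sup>2 \<le> \<delta> * (LINT s:{c..d}|lborel. (cmod (h s))\<^sup>2) + (1 + 1 / \<delta>) * (LINT s:{c..d}|lborel. (cmod (y s))\<^sup>2)"
proof -
  have yc: "continuous_on UNIV y" by (rule ac_deriv_continuous[OF y(1)])
  have yl: "L2_loc y" by (rule L2_loc_continuous[OF yc])
  define Q where "Q = (LINT s:{c..d}|lborel. 2 * (cmod (y s) * cmod (h s)))"
  define A where "A = (LINT s:{c..d}|lborel. (cmod (h s))\<^sup>2)"
  define B where "B = (LINT s:{c..d}|lborel. (cmod (y s))\<^sup>2)"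
  have iQ: "set_integrable lborel {a..b} (\<lambda>s. 2 * (cmod (y s) * cmod (h s)))" for a b
    using L2_loc_set_integrable_mult[OF yl y(2)] by simp
  have iA: "set_integrable lborel {c..d} (\<lambda>s. (cmod (h s))\<^sup>2)" and iB: "set_integrable lborel {c..d} (\<lambda>s. (cmod (y s))\<^sup>2)"
    using L2_loc_set_integrable y(2) yl by auto
  let ?N = "\<lambda>t. complex_of_real ((cmod (y t))\<^sup>2)"
  let ?D = "\<lambda>t. h t * cnj (y t) + y t * cnj (h t)"
  have step: "\<bar>(cmod (y b))\<^sup>2 - (cmod (y a))\<^sup>2\<bar> \<le> Q" if "c \<le> a" "a \<le> b" "b \<le> d" for a b
  proof -
    have D: "ac_deriv ?N ?D" by (rule ac_deriv_norm_squared[OF y(1)])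
    have iD: "set_integrable lborel {a..b} ?D" using D by (simp add: ac_deriv_def locally_integrable_def)
    have "complex_of_real ((cmod (y b))\<^sup>2 - (cmod (y a))\<^sup>2) = (LINT s:{a..b}|lborel. ?D s)"
      using D that by (simp add: ac_deriv_def)
    then have "\<bar>(cmod (y b))\<^sup>2 - (cmod (y a))\<^sup>2\<bar> = cmod (LINT s:{a..b}|lborel. ?D s)"
      by (metis norm_of_real)
    also have "\<dots> \<le> (LINT s:{a..b}|lborel. cmod (?D s))"
      unfolding set_lebesgue_integral_def
      using integral_norm_bound[of lborel "\<lambda>s. indicator {a..b} s *\<^sub>R ?D s"] by simp
    also have "\<dots> \<le> (LINT s:{a..b}|lborel. 2 * (cmod (y s) * cmod (h s)))"
      by (intro set_integral_mono set_integrable_norm iD iQ norm_squared_deriv_le)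
    also have "\<dots> \<le> Q"
      unfolding Q_def set_lebesgue_integral_def
      using iQ[of a b] iQ[of c d] that by (intro integral_mono) (auto simp: set_integrable_def indicator_def)
    finally show ?thesis .
  qed
  have le: "(cmod (y t))\<^sup>2 \<le> (cmod (y s))\<^sup>2 + Q" if "s \<in> {c..d}" for s
    using step[of s t] step[of t s] that t by (cases "s \<le> t") auto
  have "(d - c) * (cmod (y t))\<^sup>2 = (LINT s:{c..d}|lborel. (cmod (y t))\<^sup>2)"
    using cd by (simp add: set_lebesgue_integral_def)
  also have "\<dots> \<le> (LINT s:{c..d}|lborel. (cmod (y s))\<^sup>2 + Q)"
    by (intro set_integral_mono set_integral_add iB le) (auto simp: set_integrable_def emeasure_lborel_Icc_eq)
  also have "\<dots> = B + (d - c) * Q"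
    using cd iB by (subst set_integral_add) (auto simp: B_def set_integrable_def emeasure_lborel_Icc_eq set_lebesgue_integral_def)
  finally have "(d - c) * ((cmod (y t))\<^sup>2 - Q) \<le> B" by (simp add: algebra_simps)
  moreover have B0: "B \<ge> 0"
    unfolding B_def set_lebesgue_integral_def by (intro integral_nonneg_AE) auto
  ultimately have 1: "(cmod (y t))\<^sup>2 \<le> B + Q"
  proof (cases "(cmod (y t))\<^sup>2 \<ge> Q")
    case True
    assume "(d - c) * ((cmod (y t))\<^sup>2 - Q) \<le> B"
    moreover have "1 * ((cmod (y t))\<^sup>2 - Q) \<le> (d - c) * ((cmod (y t))\<^sup>2 - Q)"
      using True cd by (intro mult_right_mono) auto
    ultimately show ?thesis by simp
  qed simp
  \<comment> \<open>Young's inequality with weight \<open>\<delta>\<close> trades the mixed term for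
    a small share of the Dirichlet integral.\<close>
  have "Q \<le> (LINT s:{c..d}|lborel. \<delta> * (cmod (h s))\<^sup>2 + (1 / \<delta>) * (cmod (y s))\<^sup>2)"
    unfolding Q_def
  proof (intro set_integral_mono set_integral_add iQ set_integrable_mult_right iA iB)
    fix s
    have "0 \<le> (\<delta> * cmod (h s) - cmod (y s))\<^sup>2 / \<delta>" using \<delta> by simp
    also have "\<dots> = \<delta> * (cmod (h s))\<^sup>2 + (1 / \<delta>) * (cmod (y s))\<^sup>2 - 2 * (cmod (y s) * cmod (h s))"
      using \<delta> by (simp add: power2_eq_square field_simps)
    finally show "2 * (cmod (y s) * cmod (h s)) \<le> \<delta> * (cmod (h s))\<^sup>2 + (1 / \<delta>) * (cmod (y s))\<^sup>2" by simp
  qed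
  also have "\<dots> = \<delta> * A + (1 / \<delta>) * B"
    using iA iB by (subst set_integral_add) (auto simp: A_def B_def)
  finally show ?thesis using 1 by (simp add: A_def B_def algebra_simps)
qed

lemma integral_eq_sum_unit_intervals:
  fixes f :: "real \<Rightarrow> real"
  assumes "\<And>a b. set_integrable lborel {a..b} f" "\<And>t. \<bar>t\<bar> > real N \<Longrightarrow> f t = 0"
  shows "(LINT t|lborel. f t) = (\<Sum>k<2 * N. LINT t:{real k - real N..real k - real N + 1}|lborel. f t)"
proof -
  have "(LINT t:{c..c + real n}|lborel. f t) = (\<Sum>k<n. LINT t:{c + real k..c + real k + 1}|lborel. f t)" for c n
  proof (induction n)
    case 0
    have "(LINT t:{c}|lborel. f t) = (LINT t|(lborel :: real measure). 0)"
      unfolding set_lebesgue_integral_def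
    proof (rule integral_cong_AE)
      show "AE t in lborel. indicator {c} t *\<^sub>R f t = 0"
        using AE_lborel_singleton[of c] by eventually_elim auto
      have "set_integrable lborel {c} f" by (rule set_integrable_subset[OF assms(1)[of c c]]) auto
      then show "(\<lambda>t. indicator {c} t *\<^sub>R f t) \<in> borel_measurable lborel"
        unfolding set_integrable_def by (rule borel_measurable_integrable)
    qed simp
    then show ?case by simp
  next
    case (Suc n)
    have u: "{c..c + real n} \<union> {c + real n..c + real n + 1} = {c..c + real (Suc n)}" by auto
    have "(LINT t:{c..c + real n} \<union> {c + real n..c + real n + 1}|lborel. f t)
      = (LINT t:{c..c + real n}|lborel. f t) + (LINT t:{c + real n..c + real n + 1}|lborel. f t)"
    proof (rule set_integral_Un_AE)
      show "AE t in lborel. \<not> (t \<in> {c..c + real n} \<and> t \<in> {c + real n..c + real n + 1})"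
        using AE_lborel_singleton[of "c + real n"] by eventually_elim auto
    qed (auto intro: assms)
    then show ?case using Suc unfolding u by simp
  qed
  from this[of "- real N" "2 * N"]
  have "(LINT t:{- real N..real N}|lborel. f t) = (\<Sum>k<2 * N. LINT t:{real k - real N..real k - real N + 1}|lborel. f t)"
    by (simp add: algebra_simps)
  moreover have "(LINT t:{- real N..real N}|lborel. f t) = (LINT t|lborel. f t)"
    unfolding set_lebesgue_integral_def
  proof (rule Bochner_Integration.integral_cong[OF refl])
    show "indicator {- real N..real N} t *\<^sub>R f t = f t" for t
      using assms(2)[of t] by (cases "\<bar>t\<bar> > real N") (auto simp: indicator_def abs_le_iff not_less)
  qed
  ultimately show ?thesis by simp
qed

lemma integrable_compact_support_real:
  fixes f :: "real \<Rightarrow> real"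
  assumes "\<And>a b. set_integrable lborel {a..b} f" "\<And>t. \<bar>t\<bar> > a \<Longrightarrow> f t = 0"
  shows "integrable lborel f"
proof -
  have "(\<lambda>t. indicator {-a..a} t *\<^sub>R f t) = f"
    using assms(2) by (fastforce simp: indicator_def abs_le_iff not_less[symmetric])
  then show ?thesis using assms(1)[of "-a" a] by (simp add: set_integrable_def)
qed

text \<open>On intervals of length 1 the sup norm costs only a small multiple \<open>\<delta>\<close> of the Dirichlet integral.\<close>

lemma potential_form_relative_bound:
  assumes dec: "decomposition q \<sigma> \<tau>"
  obtains K where "K \<ge> 0" "\<And>y h a. ac_deriv y h \<Longrightarrow> L2_loc h \<Longrightarrow> (\<And>t. \<bar>t\<bar> > a \<Longrightarrow> y t = 0) \<Longrightarrow> (\<And>t. \<bar>t\<bar> > a \<Longrightarrow> h t = 0) \<Longrightarrow>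
    cmod (potential_form \<sigma> \<tau> (\<lambda>t. of_real ((cmod (y t))\<^sup>2)) (\<lambda>t. h t * cnj (y t) + y t * cnj (h t)))
      \<le> (L2_norm h)\<^sup>2 / 2 + K * (L2_norm y)\<^sup>2"
proof -
  have adm: "admissible \<sigma> \<tau>" using decomposition_represents[OF dec] by (simp add: represents_def)
  have i\<tau>: "set_integrable lborel {a..b} (\<lambda>t. \<bar>\<tau> t\<bar>)" for a b
  proof -
    have "set_integrable lborel {a..b} \<tau>"
      by (rule set_integrable_unit_intervals) (use dec in \<open>simp add: decomposition_def uniformly_locally_integrable_def\<close>)
    then show ?thesis by (rule set_integrable_abs)
  qed
  have i\<sigma>: "set_integrable lborel {a..b} (\<lambda>t. (\<sigma> t)\<^sup>2)" for a b
    by (rule set_integrable_unit_intervals) (use dec in \<open>simp add: decomposition_def uniformly_locally_integrable_def\<close>)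
  obtain M1 M2 where M12: "\<And>t. (LINT s:{t..t+1}|lborel. \<bar>\<tau> s\<bar>) \<le> M1" "\<And>t. (LINT s:{t..t+1}|lborel. \<bar>(\<sigma> s)\<^sup>2\<bar>) \<le> M2"
    using dec unfolding decomposition_def uniformly_locally_integrable_def bdd_above_def by auto
  define M where "M = \<bar>M1\<bar> + \<bar>M2\<bar>"
  have M: "(LINT s:{t..t+1}|lborel. \<bar>\<tau> s\<bar>) \<le> M" "(LINT s:{t..t+1}|lborel. (\<sigma> s)\<^sup>2) \<le> M" for t
    using M12(1)[of t] M12(2)[of t] by (auto simp: M_def)
  have M0: "M \<ge> 0" by (simp add: M_def)
  \<comment> \<open>The term with \<tau> costs \<open>M\<close> times the squared sup norm. In the
    term with \<sigma>, Young's inequality spends 1/4 of the Dirichlet integral and leaves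
    \<open>4 * M\<close> times the squared sup norm. This choice makes the total
    \<open>5 * M * \<delta>\<close> at most another 1/4, hence 1/2 altogether.\<close>
  define \<delta> where "\<delta> = 1 / (20 * (M + 1))"
  have \<delta>: "\<delta> > 0" "5 * M * \<delta> \<le> 1 / 4" using M0 by (auto simp: \<delta>_def field_simps)
  define K where "K = 5 * M * (1 + 1 / \<delta>)"
  show thesis
  proof (rule that[of K])
    show "K \<ge> 0" using M0 \<delta>(1) by (simp add: K_def)
    fix y h a assume y: "ac_deriv y h" "L2_loc h" and a: "\<And>t. \<bar>t\<bar> > a \<Longrightarrow> y t = 0" "\<And>t. \<bar>t\<bar> > a \<Longrightarrow> h t = 0"
    have yc: "continuous_on S y" for S by (rule ac_deriv_continuous[OF y(1)])
    have yl: "L2_loc y" by (rule L2_loc_continuous[OF yc])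
    define g where "g t = \<bar>\<tau> t\<bar> * (cmod (y t))\<^sup>2 + \<bar>\<sigma> t\<bar> * (2 * (cmod (y t) * cmod (h t)))" for t
    let ?N = "\<lambda>t. complex_of_real ((cmod (y t))\<^sup>2)"
    let ?D = "\<lambda>t. h t * cnj (y t) + y t * cnj (h t)"
    have Dl: "L2_loc ?D"
    proof -
      have "L2_loc (\<lambda>t. cnj (y t) * h t + y t * cnj (h t))"
        by (intro L2_loc_add L2_loc_continuous_mult L2_loc_cnj y continuous_intros yc)
      then show ?thesis by (simp add: mult.commute)
    qed
    have Nc: "continuous_on UNIV ?N" by (intro continuous_intros yc)
    note i = potential_form_integrable[OF adm Nc Dl, of a]
    have ig: "set_integrable lborel {b..c} g" for b c
    proof -
      have "locally_integrable (\<lambda>t. ?N t * complex_of_real (\<tau> t))"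
        using adm by (intro locally_integrable_continuous_mult Nc) (simp add: admissible_def)
      from set_integrable_norm[OF locally_integrable_on[OF this]]
      have 1: "set_integrable lborel {b..c} (\<lambda>t. \<bar>\<tau> t\<bar> * (cmod (y t))\<^sup>2)" by (simp add: norm_mult norm_power mult.commute)
      have "locally_integrable (\<lambda>t. complex_of_real (\<sigma> t) * (y t * h t))"
        using adm by (intro L2_loc_mult L2_loc_continuous_mult yc y) (simp add: admissible_def)
      from set_integrable_norm[OF locally_integrable_on[OF this]]
      have "set_integrable lborel {b..c} (\<lambda>t. \<bar>\<sigma> t\<bar> * (cmod (y t) * cmod (h t)))" by (simp add: norm_mult)
      then have "set_integrable lborel {b..c} (\<lambda>t. 2 * (\<bar>\<sigma> t\<bar> * (cmod (y t) * cmod (h t))))" by simp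
      then have "set_integrable lborel {b..c} (\<lambda>t. \<bar>\<sigma> t\<bar> * (2 * (cmod (y t) * cmod (h t))))" by (simp add: mult.left_commute)
      then show ?thesis unfolding g_def[abs_def] by (intro set_integral_add 1)
    qed
    have g0: "g t = 0" if "\<bar>t\<bar> > a" for t using a that by (simp add: g_def)
    have "cmod (potential_form \<sigma> \<tau> ?N ?D) \<le> (LINT t|lborel. cmod (of_real (\<tau> t) * ?N t - of_real (\<sigma> t) * ?D t))"
      unfolding potential_form_def by (rule integral_norm_bound)
    also have "\<dots> \<le> (LINT t|lborel. g t)"
    proof (rule integral_mono)
      show "integrable lborel (\<lambda>t. cmod (of_real (\<tau> t) * ?N t - of_real (\<sigma> t) * ?D t))"
        by (intro integrable_norm Bochner_Integration.integrable_diff i) (use a in auto)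
      show "integrable lborel g" by (rule integrable_compact_support_real[OF ig g0])
      fix t
      have "cmod (of_real (\<tau> t) * ?N t - of_real (\<sigma> t) * ?D t) \<le> \<bar>\<tau> t\<bar> * (cmod (y t))\<^sup>2 + \<bar>\<sigma> t\<bar> * cmod (?D t)"
        using norm_triangle_ineq4[of "of_real (\<tau> t) * ?N t" "of_real (\<sigma> t) * ?D t"] by (simp add: norm_mult norm_power)
      also have "\<dots> \<le> g t" unfolding g_def by (intro add_left_mono mult_left_mono norm_squared_deriv_le) auto
      finally show "cmod (of_real (\<tau> t) * ?N t - of_real (\<sigma> t) * ?D t) \<le> g t" .
    qed
    finally have 1: "cmod (potential_form \<sigma> \<tau> ?N ?D) \<le> (LINT t|lborel. g t)" .
    obtain N where "a \<le> real N" using real_arch_simple by blast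
    then have N: "y t = 0" "h t = 0" "g t = 0" if "\<bar>t\<bar> > real N" for t using a g0 that by auto
    let ?J = "\<lambda>k. {real k - real N..real k - real N + 1}"
    have J: "(LINT t:{c..c + 1}|lborel. g t) \<le> (LINT t:{c..c + 1}|lborel. (cmod (h t))\<^sup>2 / 2 + K * (cmod (y t))\<^sup>2)" for c
    proof -
      define A where "A = (LINT t:{c..c + 1}|lborel. (cmod (h t))\<^sup>2)"
      define B where "B = (LINT t:{c..c + 1}|lborel. (cmod (y t))\<^sup>2)"
      define s where "s = \<delta> * A + (1 + 1 / \<delta>) * B"
      have sup: "(cmod (y t))\<^sup>2 \<le> s" if "t \<in> {c..c + 1}" for t
        unfolding s_def A_def B_def by (rule interval_sup_bound[OF y that _ \<delta>(1)]) simp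
      have A0: "A \<ge> 0" unfolding A_def set_lebesgue_integral_def by (intro integral_nonneg_AE) auto
      have s0: "s \<ge> 0" using sup[of c] by (simp add: order_trans[OF zero_le_power2])
      have iA: "set_integrable lborel {c..c + 1} (\<lambda>t. (cmod (h t))\<^sup>2)" "set_integrable lborel {c..c + 1} (\<lambda>t. (cmod (y t))\<^sup>2)"
        using L2_loc_set_integrable y(2) yl by auto
      have "(LINT t:{c..c + 1}|lborel. g t) \<le> (LINT t:{c..c + 1}|lborel. (s * \<bar>\<tau> t\<bar> + (1 / 4) * (cmod (h t))\<^sup>2) + (4 * s) * (\<sigma> t)\<^sup>2)"
      proof (intro set_integral_mono set_integral_add(1) set_integrable_mult_right ig i\<tau> i\<sigma> iA)
        fix t assume t: "t \<in> {c..c + 1}"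
        have "\<bar>\<tau> t\<bar> * (cmod (y t))\<^sup>2 \<le> s * \<bar>\<tau> t\<bar>" using mult_left_mono[OF sup[OF t], of "\<bar>\<tau> t\<bar>"] by (simp add: mult.commute)
        moreover have "\<bar>\<sigma> t\<bar> * (2 * (cmod (y t) * cmod (h t))) \<le> (1 / 4) * (cmod (h t))\<^sup>2 + 4 * ((cmod (y t))\<^sup>2 * (\<sigma> t)\<^sup>2)"
          using sum_squares_ge_zero[of "cmod (h t) / 2 - 2 * (\<bar>\<sigma> t\<bar> * cmod (y t))" 0]
          by (simp add: power2_eq_square algebra_simps)
        moreover have "4 * ((cmod (y t))\<^sup>2 * (\<sigma> t)\<^sup>2) \<le> (4 * s) * (\<sigma> t)\<^sup>2"
          using mult_right_mono[OF sup[OF t], of "(\<sigma> t)\<^sup>2"] by simp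
        ultimately show "g t \<le> (s * \<bar>\<tau> t\<bar> + (1 / 4) * (cmod (h t))\<^sup>2) + (4 * s) * (\<sigma> t)\<^sup>2"
          unfolding g_def by linarith
      qed
      also have "\<dots> = (s * (LINT t:{c..c + 1}|lborel. \<bar>\<tau> t\<bar>) + (1 / 4) * A) + (4 * s) * (LINT t:{c..c + 1}|lborel. (\<sigma> t)\<^sup>2)"
        using i\<tau> i\<sigma> iA by (simp add: A_def set_integral_add)
      also have "\<dots> \<le> (s * M + (1 / 4) * A) + (4 * s) * M"
        using s0 by (intro add_mono mult_left_mono M order_refl) auto
      also have "\<dots> = (5 * M * \<delta>) * A + (1 / 4) * A + K * B"
        by (simp add: s_def K_def algebra_simps)
      also have "\<dots> \<le> (1 / 4) * A + (1 / 4) * A + K * B"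
        by (rule add_mono[OF add_mono[OF mult_right_mono[OF \<delta>(2) A0] order_refl] order_refl])
      also have "\<dots> = (LINT t:{c..c + 1}|lborel. (cmod (h t))\<^sup>2 / 2 + K * (cmod (y t))\<^sup>2)"
        using iA by (simp add: A_def B_def set_integral_add)
      finally show ?thesis .
    qed
    have "(LINT t|lborel. g t) = (\<Sum>k<2 * N. LINT t:?J k|lborel. g t)"
      by (rule integral_eq_sum_unit_intervals[OF ig N(3)])
    also have "\<dots> \<le> (\<Sum>k<2 * N. LINT t:?J k|lborel. (cmod (h t))\<^sup>2 / 2 + K * (cmod (y t))\<^sup>2)"
      by (intro sum_mono J)
    also have "\<dots> = (LINT t|lborel. (cmod (h t))\<^sup>2 / 2 + K * (cmod (y t))\<^sup>2)"
      by (rule integral_eq_sum_unit_intervals[symmetric])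
         (use N L2_loc_set_integrable[OF y(2)] L2_loc_set_integrable[OF yl] in \<open>auto intro!: set_integral_add(1)\<close>)
    also have "\<dots> = (L2_norm h)\<^sup>2 / 2 + K * (L2_norm y)\<^sup>2"
    proof -
      have "square_integrable h" "square_integrable y"
        using L2_loc_compact_support[OF y(2) a(2)] L2_loc_compact_support[OF yl a(1)] by auto
      then show ?thesis by (simp add: square_integrable_def L2_norm_squared)
    qed
    finally show "cmod (potential_form \<sigma> \<tau> ?N ?D) \<le> (L2_norm h)\<^sup>2 / 2 + K * (L2_norm y)\<^sup>2" using 1 by linarith
  qed
qed

section \<open>Localization of products by the partition of unity\<close>

lemma potential_form_sum:
  assumes adm: "admissible \<sigma> \<tau>" and "finite I"
    and p: "\<And>k. k \<in> I \<Longrightarrow> continuous_on UNIV (p k)" "\<And>k. k \<in> I \<Longrightarrow> L2_loc (p' k)"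
      "\<And>k t. \<bar>t\<bar> > a \<Longrightarrow> p k t = 0" "\<And>k t. \<bar>t\<bar> > a \<Longrightarrow> p' k t = 0"
  shows "potential_form \<sigma> \<tau> (\<lambda>t. \<Sum>k\<in>I. p k t) (\<lambda>t. \<Sum>k\<in>I. p' k t) = (\<Sum>k\<in>I. potential_form \<sigma> \<tau> (p k) (p' k))"
proof -
  have "L2_loc (\<lambda>t. \<Sum>k\<in>I. p' k t) \<and> potential_form \<sigma> \<tau> (\<lambda>t. \<Sum>k\<in>I. p k t) (\<lambda>t. \<Sum>k\<in>I. p' k t) = (\<Sum>k\<in>I. potential_form \<sigma> \<tau> (p k) (p' k))"
    using \<open>finite I\<close> p(1,2)
  proof (induction I rule: finite_induct)
    case empty
    have "L2_loc (\<lambda>t. 0)" by (rule L2_loc_continuous) (rule continuous_on_const)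
    then show ?case by (simp add: potential_form_def)
  next
    case (insert k I)
    have IH: "L2_loc (\<lambda>t. \<Sum>k\<in>I. p' k t)"
      "potential_form \<sigma> \<tau> (\<lambda>t. \<Sum>k\<in>I. p k t) (\<lambda>t. \<Sum>k\<in>I. p' k t) = (\<Sum>k\<in>I. potential_form \<sigma> \<tau> (p k) (p' k))"
      using insert by auto
    have k: "continuous_on UNIV (p k)" "L2_loc (p' k)" using insert.prems by auto
    have c: "continuous_on UNIV (\<lambda>t. \<Sum>k\<in>I. p k t)" using insert.prems by (intro continuous_intros) auto
    have "potential_form \<sigma> \<tau> (\<lambda>t. p k t + (\<Sum>k\<in>I. p k t)) (\<lambda>t. p' k t + (\<Sum>k\<in>I. p' k t))
      = potential_form \<sigma> \<tau> (p k) (p' k) + potential_form \<sigma> \<tau> (\<lambda>t. \<Sum>k\<in>I. p k t) (\<lambda>t. \<Sum>k\<in>I. p' k t)"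
      by (rule potential_form_add[OF adm k _ _ c IH(1), of a]) (simp_all add: p(3,4))
    then show ?case using insert.hyps L2_loc_add[OF k(2) IH(1)] IH(2) by simp
  qed
  then show ?thesis by blast
qed

text \<open>One number for both the plateau function and its derivative, fixed once; the constants
  built from it are the same for all potentials.\<close>

definition bump_bound :: real where
  "bump_bound = (SOME D. D \<ge> 0 \<and> (\<forall>t. cmod (bump t) \<le> D \<and> cmod (vderiv bump t) \<le> D))"

lemma bump_bound: "bump_bound \<ge> 0" "cmod (bump t) \<le> bump_bound" "cmod (vderiv bump t) \<le> bump_bound"
proof -
  have t: "test_fun bump" using test_fun_bump_affine[of 1 0] by simp
  obtain D where D: "\<And>t. cmod (bump t) \<le> D" "D \<ge> 0" by (rule test_fun_bounded[OF t]) blast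
  obtain D' where D': "\<And>t. cmod (vderiv bump t) \<le> D'" "D' \<ge> 0" by (rule test_fun_bounded[OF test_fun_vderiv[OF t]]) blast
  have "max D D' \<ge> 0 \<and> (\<forall>t. cmod (bump t) \<le> max D D' \<and> cmod (vderiv bump t) \<le> max D D')"
    using D D' by (auto simp: le_max_iff_disj)
  then have "\<exists>D. D \<ge> 0 \<and> (\<forall>t. cmod (bump t) \<le> D \<and> cmod (vderiv bump t) \<le> D)" by blast
  from someI_ex[OF this] show "bump_bound \<ge> 0" "cmod (bump t) \<le> bump_bound" "cmod (vderiv bump t) \<le> bump_bound"
    unfolding bump_bound_def by auto
qed

lemma vderiv_bump_affine: "vderiv (\<lambda>t. bump (a * t + b)) = (\<lambda>t. of_real a * vderiv bump (a * t + b))"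
  by (rule vderiv_eqI) (rule has_vector_derivative_affine[OF smooth_deriv(1)[OF smooth_bump]])

lemma vderiv_bump_eq_0:
  assumes "\<bar>t\<bar> < 1 \<or> \<bar>t\<bar> \<ge> 2" shows "vderiv bump t = 0"
proof (cases "\<bar>t\<bar> < 1")
  case True
  have "((\<lambda>t. 1) has_vector_derivative 0) (at t)" by simp
  then have "(bump has_vector_derivative 0) (at t)"
    by (rule has_vector_derivative_transform_within_open[of _ _ _ "{-1<..<1}"]) (use True in \<open>auto simp: bump_eq_1 abs_le_iff\<close>)
  then show ?thesis by (simp add: vderiv_def vector_derivative_at)
next
  case False
  then have t: "\<bar>t\<bar> \<ge> 2" using assms by auto
  have d: "(bump has_vector_derivative vderiv bump t) (at t)" by (rule smooth_deriv(1)[OF smooth_bump])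
  have z: "vderiv bump s = 0" if "\<bar>s\<bar> > 2" for s
    by (rule vderiv_compact_support[OF smooth_bump _ that]) (simp add: bump_eq_0)
  show ?thesis
  proof (cases "\<bar>t\<bar> > 2")
    case True then show ?thesis by (rule z)
  next
    case False
    then have t2: "\<bar>t\<bar> = 2" using t by simp
    have c: "continuous_on UNIV (vderiv bump)" by (rule smooth_continuous[OF smooth_deriv(2)[OF smooth_bump]])
    \<comment> \<open>At the edge the derivative is the limit of its values at points slightly
      further out, which are zero.\<close>
    define s where "s n = t * (1 + inverse (real (Suc n)))" for n
    have "s \<longlonglongrightarrow> t * (1 + 0)" unfolding s_def by (intro tendsto_intros LIMSEQ_inverse_real_of_nat)
    then have "(\<lambda>n. vderiv bump (s n)) \<longlonglongrightarrow> vderiv bump t"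
      using continuous_on_tendsto_compose[OF c] by auto
    moreover have "vderiv bump (s n) = 0" for n
      by (rule z) (use t2 in \<open>simp add: s_def abs_mult\<close>)
    ultimately show ?thesis using LIMSEQ_unique[OF _ tendsto_const] by force
  qed
qed

text \<open>Bounded overlap: an interval containing \<open>t\<close> has its centre between
  \<open>\<lfloor>t\<rfloor> - 2\<close> and \<open>\<lfloor>t\<rfloor> + 3\<close>. This range is
  slightly generous and has 6 elements.\<close>

lemma overlap_sum_le:
  fixes f :: "real \<Rightarrow> real"
  assumes f: "integrable lborel f" "\<And>t. f t \<ge> 0" and I: "finite I"
  shows "(\<Sum>k\<in>I. LINT t:{of_int k - 2..of_int k + 2}|lborel. f t) \<le> 6 * (LINT t|lborel. f t)"
proof -
  have i: "integrable lborel (\<lambda>t. indicator {of_int k - 2..of_int k + 2} t *\<^sub>R f t)" for k :: int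
    by (rule integrable_mult_indicator[OF _ f(1)]) simp
  have "(\<Sum>k\<in>I. LINT t:{of_int k - 2..of_int k + 2}|lborel. f t) = (LINT t|lborel. (\<Sum>k\<in>I. indicator {of_int k - 2..of_int k + 2} t *\<^sub>R f t))"
    unfolding set_lebesgue_integral_def by (rule Bochner_Integration.integral_sum[symmetric]) (rule i)
  also have "\<dots> \<le> (LINT t|lborel. 6 * f t)"
  proof (rule integral_mono)
    fix t :: real
    have "(\<Sum>k\<in>I. indicator {of_int k - 2..of_int k + 2} t :: real) = (\<Sum>k\<in>I \<inter> {\<lfloor>t\<rfloor> - 2..\<lfloor>t\<rfloor> + 3}. indicator {of_int k - 2..of_int k + 2} t)"
    proof (rule sum.mono_neutral_right)
      show "\<forall>k\<in>I - I \<inter> {\<lfloor>t\<rfloor> - 2..\<lfloor>t\<rfloor> + 3}. indicator {of_int k - 2..of_int k + 2} t = (0::real)"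
      proof
        fix k assume "k \<in> I - I \<inter> {\<lfloor>t\<rfloor> - 2..\<lfloor>t\<rfloor> + 3}"
        then have "k \<le> \<lfloor>t\<rfloor> - 3 \<or> k \<ge> \<lfloor>t\<rfloor> + 4" by auto
        then have "of_int k \<le> (of_int \<lfloor>t\<rfloor> - 3 :: real) \<or> of_int k \<ge> (of_int \<lfloor>t\<rfloor> + 4 :: real)" by linarith
        then have "t \<notin> {of_int k - 2..of_int k + 2}" by (auto; linarith)
        then show "indicator {of_int k - 2..of_int k + 2} t = (0::real)" by simp
      qed
    qed (use I in auto)
    also have "\<dots> \<le> (\<Sum>k\<in>I \<inter> {\<lfloor>t\<rfloor> - 2..\<lfloor>t\<rfloor> + 3}. 1)" by (intro sum_mono) (simp add: indicator_def)
    also have "\<dots> \<le> 6"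
      using card_mono[of "{\<lfloor>t\<rfloor> - 2..\<lfloor>t\<rfloor> + 3}" "I \<inter> {\<lfloor>t\<rfloor> - 2..\<lfloor>t\<rfloor> + 3}"] by simp
    finally have "(\<Sum>k\<in>I. indicator {of_int k - 2..of_int k + 2} t) * f t \<le> 6 * f t"
      by (rule mult_right_mono[OF _ f(2)])
    then show "(\<Sum>k\<in>I. indicator {of_int k - 2..of_int k + 2} t *\<^sub>R f t) \<le> 6 * f t"
      by (simp add: sum_distrib_right)
  qed (use i f(1) in auto)
  also have "\<dots> = 6 * (LINT t|lborel. f t)" by simp
  finally show ?thesis .
qed

lemma set_integral_nonneg_real: "(\<And>t. f t \<ge> 0) \<Longrightarrow> (LINT t:A|M. f t) \<ge> (0::real)"
  unfolding set_lebesgue_integral_def by (intro integral_nonneg_AE AE_I2) simp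

lemma norm_add3_squared_le: "(cmod (x + y + z))\<^sup>2 \<le> 3 * ((cmod x)\<^sup>2 + (cmod y)\<^sup>2 + (cmod z)\<^sup>2)"
proof -
  have "(cmod (x + y + z))\<^sup>2 \<le> (cmod x + cmod y + cmod z)\<^sup>2"
    by (intro power_mono order_trans[OF norm_triangle_ineq] add_right_mono norm_triangle_ineq) auto
  also have "\<dots> \<le> 3 * ((cmod x)\<^sup>2 + (cmod y)\<^sup>2 + (cmod z)\<^sup>2)"
    using sum_squares_ge_zero[of "cmod x - cmod y" "cmod y - cmod z"] sum_squares_ge_zero[of "cmod x - cmod z" 0]
    by (simp add: power2_eq_square algebra_simps)
  finally show ?thesis .
qed

text \<open>On \<open>[k - 2, k + 2]\<close> the Sobolev functions form an algebra, which bounds the norm of the localized product.\<close>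

lemma sobolev_norm_localized_product:
  fixes k :: int
  assumes p: "ac_deriv p p'" "L2_loc p'" and v: "ac_deriv v v'" "L2_loc v'"
  defines "J \<equiv> {of_int k - 2..of_int k + 2 :: real}"
  defines "B \<equiv> \<lambda>t. bump (t - of_int k)" and "B' \<equiv> \<lambda>t. vderiv bump (t - of_int k)"
  shows "sobolev_pair (\<lambda>t. B t * (p t * v t)) (\<lambda>t. B' t * (p t * v t) + B t * (p' t * v t + p t * v' t))"
    "sobolev_norm (\<lambda>t. B t * (p t * v t)) (\<lambda>t. B' t * (p t * v t) + B t * (p' t * v t + p t * v' t))
      \<le> 4 * bump_bound * (sqrt (LINT t:J|lborel. (cmod (p t))\<^sup>2 + (cmod (p' t))\<^sup>2) * sqrt (LINT t:J|lborel. (cmod (v t))\<^sup>2 + (cmod (v' t))\<^sup>2))"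
proof -
  have Be: "B = (\<lambda>t. bump (1 * t + - of_int k))" "B' = vderiv B"
    unfolding B_def B'_def using vderiv_bump_affine[of 1 "- of_int k"] by (auto simp: fun_eq_iff)
  have sB: "smooth B" unfolding Be(1) by (intro smooth_affine smooth_bump)
  have acB: "ac_deriv B B'" unfolding Be(2) by (rule ac_deriv_smooth[OF sB])
  have B0: "B t = 0" "B' t = 0" if "t \<notin> J" for t
  proof -
    have "\<bar>t - of_int k\<bar> \<ge> 2" using that by (auto simp: J_def)
    then show "B t = 0" "B' t = 0" by (simp_all add: B_def B'_def bump_eq_0 vderiv_bump_eq_0)
  qed
  have B0': "B t = 0" "B' t = 0" if "\<bar>t\<bar> > \<bar>of_int k\<bar> + 2" for t
    using that by (intro B0; auto simp: J_def)+
  have pc: "continuous_on UNIV p" and vc: "continuous_on UNIV v" using ac_deriv_continuous p v by auto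
  have pl: "L2_loc p" and vl: "L2_loc v" using L2_loc_continuous pc vc by auto
  have "L2_loc (\<lambda>t. v t * p' t + p t * v' t)"
    by (intro L2_loc_add L2_loc_continuous_mult pc vc p v)
  then have pvl: "L2_loc (\<lambda>t. p' t * v t + p t * v' t)" by (simp add: mult.commute)
  have B'l: "L2_loc B'" unfolding Be(2) by (intro L2_loc_continuous smooth_continuous smooth_deriv(2) sB)
  show s: "sobolev_pair (\<lambda>t. B t * (p t * v t)) (\<lambda>t. B' t * (p t * v t) + B t * (p' t * v t + p t * v' t))"
    by (rule sobolev_pair_mult_compact_support[OF acB B'l B0' ac_deriv_mult[OF p(1) v(1)] pvl])
  let ?D = "bump_bound"
  define P where "P = (LINT t:J|lborel. (cmod (p t))\<^sup>2 + (cmod (p' t))\<^sup>2)"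
  define V where "V = (LINT t:J|lborel. (cmod (v t))\<^sup>2 + (cmod (v' t))\<^sup>2)"
  have iP: "set_integrable lborel J (\<lambda>t. (cmod (p t))\<^sup>2)" "set_integrable lborel J (\<lambda>t. (cmod (p' t))\<^sup>2)"
    "set_integrable lborel J (\<lambda>t. (cmod (v t))\<^sup>2)" "set_integrable lborel J (\<lambda>t. (cmod (v' t))\<^sup>2)"
    unfolding J_def using L2_loc_set_integrable pl p(2) vl v(2) by auto
  have nn: "(LINT t:J|lborel. (cmod (f t))\<^sup>2) \<ge> 0" for f :: "real \<Rightarrow> complex"
    unfolding set_lebesgue_integral_def by (intro integral_nonneg_AE) auto
  have P0: "P \<ge> 0" and V0: "V \<ge> 0" unfolding P_def V_def set_lebesgue_integral_def by (auto intro!: integral_nonneg_AE)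
  \<comment> \<open>With weight 1 the bound is the integral of \<open>\<bar>p'\<bar>\<^sup>2\<close>
    plus twice that of \<open>\<bar>p\<bar>\<^sup>2\<close>.\<close>
  have supP: "(cmod (p t))\<^sup>2 \<le> 2 * P" if "t \<in> J" for t
    using interval_sup_bound[OF p, of t "of_int k - 2" "of_int k + 2" 1] that iP nn[of p']
    by (simp add: P_def J_def[symmetric] set_integral_add)
  have supV: "(cmod (v t))\<^sup>2 \<le> 2 * V" if "t \<in> J" for t
    using interval_sup_bound[OF v, of t "of_int k - 2" "of_int k + 2" 1] that iP nn[of v']
    by (simp add: V_def J_def[symmetric] set_integral_add)
  let ?y = "\<lambda>t. B t * (p t * v t)" and ?h = "\<lambda>t. B' t * (p t * v t) + B t * (p' t * v t + p t * v' t)"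
  \<comment> \<open>One share from the function, three from the three-term square of its
    derivative.\<close>
  define c where "c = 4 * ?D\<^sup>2"
  have c0: "c \<ge> 0" by (simp add: c_def)
  have pw: "(cmod (?y t))\<^sup>2 + (cmod (?h t))\<^sup>2 \<le> c * (2 * P * ((cmod (v t))\<^sup>2 + (cmod (v' t))\<^sup>2) + 2 * V * (cmod (p' t))\<^sup>2)" if t: "t \<in> J" for t
  proof -
    have b: "(cmod (B t))\<^sup>2 \<le> ?D\<^sup>2" "(cmod (B' t))\<^sup>2 \<le> ?D\<^sup>2" unfolding B_def B'_def by (intro power_mono bump_bound norm_ge_zero)+
    define X where "X = (cmod (p t))\<^sup>2 * (cmod (v t))\<^sup>2"
    define Y where "Y = (cmod (p' t))\<^sup>2 * (cmod (v t))\<^sup>2"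
    define Z where "Z = (cmod (p t))\<^sup>2 * (cmod (v' t))\<^sup>2"
    have nn: "X \<ge> 0" "Y \<ge> 0" "Z \<ge> 0" by (auto simp: X_def Y_def Z_def)
    have 1: "(cmod (?y t))\<^sup>2 \<le> ?D\<^sup>2 * X"
      using mult_right_mono[OF b(1) nn(1)] by (simp add: X_def norm_mult power_mult_distrib)
    have "(cmod (?h t))\<^sup>2 \<le> 3 * ((cmod (B' t * (p t * v t)))\<^sup>2 + (cmod (B t * (p' t * v t)))\<^sup>2 + (cmod (B t * (p t * v' t)))\<^sup>2)"
      using norm_add3_squared_le[of "B' t * (p t * v t)" "B t * (p' t * v t)" "B t * (p t * v' t)"] by (simp add: distrib_left add.assoc)
    also have "\<dots> = 3 * ((cmod (B' t))\<^sup>2 * X + (cmod (B t))\<^sup>2 * Y + (cmod (B t))\<^sup>2 * Z)"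
      by (simp add: X_def Y_def Z_def norm_mult power_mult_distrib)
    also have "\<dots> \<le> 3 * (?D\<^sup>2 * X + ?D\<^sup>2 * Y + ?D\<^sup>2 * Z)"
      by (intro mult_left_mono add_mono mult_right_mono b nn) auto
    finally have "(cmod (?y t))\<^sup>2 + (cmod (?h t))\<^sup>2 \<le> ?D\<^sup>2 * X + 3 * (?D\<^sup>2 * X + ?D\<^sup>2 * Y + ?D\<^sup>2 * Z)" using 1 by linarith
    also have "\<dots> \<le> c * (X + Z + Y)" using nn by (simp add: c_def algebra_simps)
    also have "X + Z \<le> 2 * P * ((cmod (v t))\<^sup>2 + (cmod (v' t))\<^sup>2)"
      using mult_right_mono[OF supP[OF t], of "(cmod (v t))\<^sup>2 + (cmod (v' t))\<^sup>2"] by (simp add: X_def Z_def algebra_simps)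
    also have "Y \<le> 2 * V * (cmod (p' t))\<^sup>2"
      using mult_left_mono[OF supV[OF t], of "(cmod (p' t))\<^sup>2"] by (simp add: Y_def algebra_simps)
    finally show ?thesis using c0 by (simp add: mult_left_mono)
  qed
  have sq: "square_integrable ?y" "square_integrable ?h" using s by (auto simp: sobolev_pair_def)
  have "(sobolev_norm ?y ?h)\<^sup>2 = (LINT t|lborel. (cmod (?y t))\<^sup>2 + (cmod (?h t))\<^sup>2)"
    using sq by (simp add: sobolev_norm_squared L2_norm_squared square_integrable_def)
  also have "\<dots> = (LINT t:J|lborel. (cmod (?y t))\<^sup>2 + (cmod (?h t))\<^sup>2)"
    unfolding set_lebesgue_integral_def
  proof (rule Bochner_Integration.integral_cong[OF refl])
    show "(cmod (?y t))\<^sup>2 + (cmod (?h t))\<^sup>2 = indicator J t *\<^sub>R ((cmod (?y t))\<^sup>2 + (cmod (?h t))\<^sup>2)" for t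
      using B0[of t] by (cases "t \<in> J") auto
  qed
  also have "\<dots> \<le> (LINT t:J|lborel. c * (2 * P * ((cmod (v t))\<^sup>2 + (cmod (v' t))\<^sup>2) + 2 * V * (cmod (p' t))\<^sup>2))"
  proof (intro set_integral_mono pw set_integral_add(1) set_integrable_mult_right iP)
    show "set_integrable lborel J (\<lambda>t. (cmod (?y t))\<^sup>2)" "set_integrable lborel J (\<lambda>t. (cmod (?h t))\<^sup>2)"
      unfolding J_def by (intro L2_loc_set_integrable square_integrable_imp_L2_loc sq)+
  qed
  also have "\<dots> = c * (2 * P * V + 2 * V * (LINT t:J|lborel. (cmod (p' t))\<^sup>2))"
    using iP by (simp add: V_def set_integral_add)
  also have "\<dots> \<le> c * (2 * P * V + 2 * V * P)"
    using c0 V0 nn[of p] iP by (intro mult_left_mono add_left_mono) (auto simp: P_def set_integral_add)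
  also have "\<dots> = (4 * ?D * (sqrt P * sqrt V))\<^sup>2"
    using P0 V0 by (simp add: c_def power_mult_distrib)
  finally show "sobolev_norm ?y ?h \<le> 4 * ?D * (sqrt (LINT t:J|lborel. (cmod (p t))\<^sup>2 + (cmod (p' t))\<^sup>2) * sqrt (LINT t:J|lborel. (cmod (v t))\<^sup>2 + (cmod (v' t))\<^sup>2))"
    unfolding P_def[symmetric] V_def[symmetric]
    by (rule power2_le_imp_le) (use P0 V0 bump_bound(1) in auto)
qed

text \<open>The form splits into the pieces cut out by \<open>phi_shift k\<close>. Inserting
  \<open>bump (t - k)\<close>, which is 1 on the support of the piece, changes nothing but makes the
  product a local Sobolev function with norm at most a constant times the product of the two local
  norms. A sum of such products is handled by Cauchy-Schwarz over \<open>k\<close>, so that only a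
  supremum over \<open>k\<close> of the local bounds of the potential is needed. The factor 24 is 4
  from the local algebra property times 6 from the overlap.\<close>

lemma potential_form_product_bound:
  assumes adm: "admissible \<sigma> \<tau>" and e: "e \<ge> 0"
    and loc: "\<And>k y h. sobolev_pair y h \<Longrightarrow> cmod (potential_form \<sigma> \<tau> (\<lambda>t. phi_shift k t * y t)
      (\<lambda>t. phi_shift_deriv k t * y t + phi_shift k t * h t)) \<le> e * sobolev_norm y h"
    and p: "ac_deriv p p'" "L2_loc p'" "\<And>t. \<bar>t\<bar> > a \<Longrightarrow> p t = 0" "\<And>t. \<bar>t\<bar> > a \<Longrightarrow> p' t = 0"
    and v: "sobolev_pair v v'"
  shows "cmod (potential_form \<sigma> \<tau> (\<lambda>t. p t * v t) (\<lambda>t. p' t * v t + p t * v' t))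
    \<le> 24 * bump_bound * e * sobolev_norm p p' * sobolev_norm v v'"
proof -
  have v': "ac_deriv v v'" "L2_loc v'" using v by (auto simp: sobolev_pair_def square_integrable_imp_L2_loc)
  let ?z = "\<lambda>t. p t * v t" and ?w = "\<lambda>t. p' t * v t + p t * v' t"
  have zac: "ac_deriv ?z ?w" by (rule ac_deriv_mult[OF p(1) v'(1)])
  have "L2_loc (\<lambda>t. v t * p' t + p t * v' t)"
    by (intro L2_loc_add L2_loc_continuous_mult ac_deriv_continuous[OF p(1)] ac_deriv_continuous[OF v'(1)] p v')
  then have wl: "L2_loc ?w" by (simp add: mult.commute)
  \<comment> \<open>Strict, because the finite partition sums to 1 for
    \<open>\<bar>t\<bar> < n\<close> while the product may live on all of
    \<open>{-a..a}\<close>.\<close>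
  obtain n where n: "a < real n" using reals_Archimedean2 by blast
  define I where "I = {- int n..int n}"
  define y where "y k t = bump (t - of_int k) * ?z t" for k :: int and t
  define h where "h k t = vderiv bump (t - of_int k) * ?z t + bump (t - of_int k) * ?w t" for k :: int and t
  let ?J = "\<lambda>k::int. {of_int k - 2..of_int k + 2 :: real}"
  let ?P = "\<lambda>k. LINT t:?J k|lborel. (cmod (p t))\<^sup>2 + (cmod (p' t))\<^sup>2"
  let ?V = "\<lambda>k. LINT t:?J k|lborel. (cmod (v t))\<^sup>2 + (cmod (v' t))\<^sup>2"
  have s: "sobolev_pair (y k) (h k)" "sobolev_norm (y k) (h k) \<le> 4 * bump_bound * (sqrt (?P k) * sqrt (?V k))" for k
    using sobolev_norm_localized_product[OF p(1,2) v', of k] unfolding y_def[abs_def] h_def[abs_def] by auto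
  have loc_eq: "phi_shift k t * y k t = phi_shift k t * ?z t"
    "phi_shift_deriv k t * y k t + phi_shift k t * h k t = phi_shift_deriv k t * ?z t + phi_shift k t * ?w t" for k t
  proof -
    have "phi_shift k t * y k t = phi_shift k t * ?z t \<and>
      phi_shift_deriv k t * y k t + phi_shift k t * h k t = phi_shift_deriv k t * ?z t + phi_shift k t * ?w t"
    proof (cases "\<bar>t - of_int k\<bar> < 1")
      case True
      then have "bump (t - of_int k) = 1" "vderiv bump (t - of_int k) = 0" by (auto simp: bump_eq_1 vderiv_bump_eq_0)
      then show ?thesis by (simp add: y_def h_def)
    next
      case False
      then have "\<bar>t - of_int k\<bar> \<ge> 1" by simp
      then show ?thesis by (simp add: phi_shift_eq_0)
    qed
    then show "phi_shift k t * y k t = phi_shift k t * ?z t"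
      "phi_shift_deriv k t * y k t + phi_shift k t * h k t = phi_shift_deriv k t * ?z t + phi_shift k t * ?w t" by auto
  qed
  have z0: "?z t = 0" "?w t = 0" if "\<bar>t\<bar> > a" for t using p that by auto
  have sums: "(\<Sum>k\<in>I. phi_shift k t * ?z t) = ?z t" "(\<Sum>k\<in>I. phi_shift_deriv k t * ?z t + phi_shift k t * ?w t) = ?w t" for t
  proof -
    have "(\<Sum>k\<in>I. phi_shift k t * ?z t) = ?z t \<and> (\<Sum>k\<in>I. phi_shift_deriv k t * ?z t + phi_shift k t * ?w t) = ?w t"
    proof (cases "\<bar>t\<bar> > a")
      case True then show ?thesis using z0[OF True] by (simp only: mult_zero_right add_0_left sum.neutral_const)
    next
      case False
      then have "\<bar>t\<bar> < of_int (int n)" using n by simp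
      from sum_phi_shift[OF this] show ?thesis
        by (simp only: sum.distrib sum_distrib_right[symmetric] I_def) simp
    qed
    then show "(\<Sum>k\<in>I. phi_shift k t * ?z t) = ?z t" "(\<Sum>k\<in>I. phi_shift_deriv k t * ?z t + phi_shift k t * ?w t) = ?w t" by auto
  qed
  have "potential_form \<sigma> \<tau> ?z ?w = potential_form \<sigma> \<tau> (\<lambda>t. \<Sum>k\<in>I. phi_shift k t * ?z t) (\<lambda>t. \<Sum>k\<in>I. phi_shift_deriv k t * ?z t + phi_shift k t * ?w t)"
    unfolding sums ..
  also have "\<dots> = (\<Sum>k\<in>I. potential_form \<sigma> \<tau> (\<lambda>t. phi_shift k t * ?z t) (\<lambda>t. phi_shift_deriv k t * ?z t + phi_shift k t * ?w t))"
  proof (rule potential_form_sum[OF adm])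
    show "finite I" by (simp add: I_def)
    fix k
    have "sobolev_pair (\<lambda>t. phi_shift k t * ?z t) (\<lambda>t. phi_shift_deriv k t * ?z t + phi_shift k t * ?w t)"
      by (rule sobolev_pair_phi_shift_mult[OF zac wl])
    then show "continuous_on UNIV (\<lambda>t. phi_shift k t * ?z t)" "L2_loc (\<lambda>t. phi_shift_deriv k t * ?z t + phi_shift k t * ?w t)"
      by (auto simp: sobolev_pair_def intro: ac_deriv_continuous square_integrable_imp_L2_loc)
    fix t assume "\<bar>t\<bar> > a"
    from z0[OF this] show "phi_shift k t * ?z t = 0" "phi_shift_deriv k t * ?z t + phi_shift k t * ?w t = 0" by simp_all
  qed
  finally have E: "potential_form \<sigma> \<tau> ?z ?w = (\<Sum>k\<in>I. potential_form \<sigma> \<tau> (\<lambda>t. phi_shift k t * ?z t) (\<lambda>t. phi_shift_deriv k t * ?z t + phi_shift k t * ?w t))" .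
  have "cmod (potential_form \<sigma> \<tau> ?z ?w) \<le> (\<Sum>k\<in>I. e * (4 * bump_bound * (sqrt (?P k) * sqrt (?V k))))"
    unfolding E
  proof (rule order_trans[OF norm_sum], rule sum_mono)
    fix k
    show "cmod (potential_form \<sigma> \<tau> (\<lambda>t. phi_shift k t * ?z t) (\<lambda>t. phi_shift_deriv k t * ?z t + phi_shift k t * ?w t)) \<le> e * (4 * bump_bound * (sqrt (?P k) * sqrt (?V k)))"
      using loc[OF s(1), of k k] mult_left_mono[OF s(2) e, of k] unfolding loc_eq by linarith
  qed
  also have "\<dots> = e * (4 * bump_bound) * (\<Sum>k\<in>I. \<bar>sqrt (?P k)\<bar> * \<bar>sqrt (?V k)\<bar>)"
  proof -
    have "?P k \<ge> 0" "?V k \<ge> 0" for k by (rule set_integral_nonneg_real; simp)+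
    then show ?thesis by (simp only: abs_of_nonneg real_sqrt_ge_zero sum_distrib_left mult.assoc)
  qed
  also have "\<dots> \<le> e * (4 * bump_bound) * (L2_set (\<lambda>k. sqrt (?P k)) I * L2_set (\<lambda>k. sqrt (?V k)) I)"
    using e bump_bound(1) by (intro mult_left_mono L2_set_mult_ineq) auto
  also have "\<dots> \<le> e * (4 * bump_bound) * (sqrt (6 * (sobolev_norm p p')\<^sup>2) * sqrt (6 * (sobolev_norm v v')\<^sup>2))"
  proof -
    have *: "L2_set (\<lambda>k. sqrt (LINT t:?J k|lborel. (cmod (f t))\<^sup>2 + (cmod (g t))\<^sup>2)) I \<le> sqrt (6 * (sobolev_norm f g)\<^sup>2)"
      if "square_integrable f" "square_integrable g" for f g
    proof -
      have nn: "(LINT t:?J k|lborel. (cmod (f t))\<^sup>2 + (cmod (g t))\<^sup>2) \<ge> 0" for k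
        unfolding set_lebesgue_integral_def by (intro integral_nonneg_AE) auto
      have "(\<Sum>k\<in>I. LINT t:?J k|lborel. (cmod (f t))\<^sup>2 + (cmod (g t))\<^sup>2) \<le> 6 * (LINT t|lborel. (cmod (f t))\<^sup>2 + (cmod (g t))\<^sup>2)"
        by (rule overlap_sum_le) (use that in \<open>auto simp: square_integrable_def I_def\<close>)
      also have "(LINT t|lborel. (cmod (f t))\<^sup>2 + (cmod (g t))\<^sup>2) = (sobolev_norm f g)\<^sup>2"
        using that by (simp add: sobolev_norm_squared L2_norm_squared square_integrable_def)
      finally show ?thesis using nn by (simp add: L2_set_def)
    qed
    have "square_integrable p" "square_integrable p'"
      using continuous_square_integrable[OF ac_deriv_continuous[OF p(1)] p(3)] L2_loc_compact_support[OF p(2,4)] by auto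
    moreover have "square_integrable v" "square_integrable v'" using v by (auto simp: sobolev_pair_def)
    ultimately show ?thesis
      using e bump_bound(1) by (intro mult_left_mono mult_mono *) (auto simp: L2_set_nonneg sobolev_norm_nonneg)
  qed
  also have "\<dots> = 24 * bump_bound * e * sobolev_norm p p' * sobolev_norm v v'"
  proof -
    have "sqrt (6 * (sobolev_norm p p')\<^sup>2) * sqrt (6 * (sobolev_norm v v')\<^sup>2) = 6 * (sobolev_norm p p' * sobolev_norm v v')"
      using sobolev_norm_nonneg[of p p'] sobolev_norm_nonneg[of v v'] by (simp add: real_sqrt_mult)
    then show ?thesis by simp
  qed
  finally show ?thesis .
qed

section \<open>Weak form of the Schroedinger equation\<close>

text \<open>The functions used for testing are compactly supported with square-integrable derivative
  rather than smooth, so that a cutoff times a solution is allowed. The pairing has no conjugation,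
  and \<open>h\<close> is only \<open>L2_loc\<close> here: its square integrability is the content
  of \<open>energy_estimate\<close>.\<close>

definition weak_solution ::
  "(real \<Rightarrow> real) \<Rightarrow> (real \<Rightarrow> real) \<Rightarrow> (real \<Rightarrow> complex) \<Rightarrow> (real \<Rightarrow> complex) \<Rightarrow> (real \<Rightarrow> complex) \<Rightarrow> bool" where
  "weak_solution \<sigma> \<tau> y h v \<longleftrightarrow> ac_deriv y h \<and> L2_loc h \<and> square_integrable y \<and> square_integrable v \<and>
     (\<forall>p p' a. ac_deriv p p' \<longrightarrow> L2_loc p' \<longrightarrow> (\<forall>t. \<bar>t\<bar> > a \<longrightarrow> p t = 0 \<and> p' t = 0) \<longrightarrow>
        (LINT t|lborel. v t * p t) = (LINT t|lborel. h t * p' t) + potential_form \<sigma> \<tau> (\<lambda>t. y t * p t) (\<lambda>t. h t * p t + y t * p' t))"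

lemma weak_solutionD:
  assumes "weak_solution \<sigma> \<tau> y h v" "ac_deriv p p'" "L2_loc p'" "\<And>t. \<bar>t\<bar> > a \<Longrightarrow> p t = 0 \<and> p' t = 0"
  shows "(LINT t|lborel. v t * p t) = (LINT t|lborel. h t * p' t) + potential_form \<sigma> \<tau> (\<lambda>t. y t * p t) (\<lambda>t. h t * p t + y t * p' t)"
  using assms unfolding weak_solution_def by blast

lemma ac_deriv_AE_cong:
  assumes "ac_deriv y g" "AE t in lborel. g t = h t" "locally_integrable h"
  shows "ac_deriv y h"
  unfolding ac_deriv_def
proof (intro conjI allI impI assms)
  fix a b :: real assume ab: "a \<le> b"
  have "(LINT t:{a..b}|lborel. h t) = (LINT t:{a..b}|lborel. g t)"
    unfolding set_lebesgue_integral_def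
  proof (rule integral_cong_AE)
    show "(\<lambda>t. indicator {a..b} t *\<^sub>R h t) \<in> borel_measurable lborel" "(\<lambda>t. indicator {a..b} t *\<^sub>R g t) \<in> borel_measurable lborel"
      using locally_integrable_on[OF assms(3), of a b] locally_integrable_on[OF ac_deriv_locally_integrable(1)[OF assms(1)], of a b]
      unfolding set_integrable_def by (auto dest: borel_measurable_integrable)
    show "AE t in lborel. indicator {a..b} t *\<^sub>R h t = indicator {a..b} t *\<^sub>R g t"
      using assms(2) by eventually_elim simp
  qed
  then show "(LINT t:{a..b}|lborel. h t) = y b - y a" using assms(1) ab by (simp add: ac_deriv_def)
qed

text \<open>Let \<open>W\<close> be the continuous representative of the quasi-derivative
  \<open>u' - \<sigma> u\<close>. Then \<open>W + \<sigma> y\<close> represents \<open>u'\<close>,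
  and it is locally square integrable because \<open>W\<close> and \<open>y\<close> are continuous
  and \<sigma> is in \<open>L2_loc\<close>. This is the only source of regularity for the
  derivative.\<close>

lemma schroedinger_graph_weak_solution:
  assumes adm: "admissible \<sigma> \<tau>" and uv: "(u, v) \<in> schroedinger_graph \<sigma> \<tau>"
  obtains y h where "AE t in lborel. u t = y t" "weak_solution \<sigma> \<tau> y h v"
proof -
  obtain u' w' where sq: "square_integrable u" "square_integrable v"
    and u': "has_weak_deriv u u'" and w': "has_weak_deriv (\<lambda>t. u' t - of_real (\<sigma> t) * u t) w'"
    and v: "AE t in lborel. v t = - w' t - of_real (\<sigma> t) * u' t + of_real (\<tau> t) * u t"
    using uv by (auto simp: schroedinger_graph_def)
  obtain y where y: "ac_deriv y u'" "AE t in lborel. u t = y t" using has_weak_deriv_imp_ac_deriv[OF u'] by blast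
  obtain W where W: "ac_deriv W w'" "AE t in lborel. u' t - of_real (\<sigma> t) * u t = W t" using has_weak_deriv_imp_ac_deriv[OF w'] by blast
  define h where "h t = W t + y t * of_real (\<sigma> t)" for t
  have \<sigma>: "L2_loc (\<lambda>t. complex_of_real (\<sigma> t))" and \<tau>: "locally_integrable (\<lambda>t. complex_of_real (\<tau> t))"
    using adm by (auto simp: admissible_def)
  have yc: "continuous_on UNIV y" and Wc: "continuous_on UNIV W" using ac_deriv_continuous y W by auto
  have hl: "L2_loc h" unfolding h_def[abs_def]
    by (intro L2_loc_add L2_loc_continuous_mult L2_loc_continuous[OF Wc] yc \<sigma>)
  have u'h: "AE t in lborel. u' t = h t"
    using y(2) W(2) by eventually_elim (simp add: h_def algebra_simps)
  have yh: "ac_deriv y h" by (rule ac_deriv_AE_cong[OF y(1) u'h L2_loc_imp_locally_integrable[OF hl]])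
  have ysq: "square_integrable y" by (rule square_integrable_AE_cong(1)[OF sq(1) y(2) ac_deriv_measurable(1)[OF yh]])
  have vh: "AE t in lborel. v t = - w' t - of_real (\<sigma> t) * h t + of_real (\<tau> t) * y t"
    using v u'h y(2) by eventually_elim simp
  have "weak_solution \<sigma> \<tau> y h v"
    unfolding weak_solution_def
  proof (intro conjI allI impI yh hl ysq sq)
    fix p p' a
    assume p: "ac_deriv p p'" "L2_loc p'" and s: "\<forall>t. \<bar>t\<bar> > a \<longrightarrow> p t = 0 \<and> p' t = 0"
    have pc: "continuous_on UNIV p" by (rule ac_deriv_continuous[OF p(1)])
    have yp: "ac_deriv (\<lambda>t. y t * p t) (\<lambda>t. h t * p t + y t * p' t)" by (rule ac_deriv_mult[OF yh p(1)])
    have "L2_loc (\<lambda>t. p t * h t + y t * p' t)" by (intro L2_loc_add L2_loc_continuous_mult pc yc hl p)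
    then have ypl: "L2_loc (\<lambda>t. h t * p t + y t * p' t)" by (simp add: mult.commute)
    have i1: "integrable lborel (\<lambda>t. h t * p' t)"
      by (rule integrable_compact_support(1)[OF L2_loc_mult[OF hl p(2)], of a]) (simp add: s)
    note i2 = potential_form_integrable[OF adm ac_deriv_continuous[OF yp] ypl, of a]
    have i2: "integrable lborel (\<lambda>t. of_real (\<tau> t) * (y t * p t) - of_real (\<sigma> t) * (h t * p t + y t * p' t))"
      by (intro Bochner_Integration.integrable_diff i2) (use s in auto)
    have Wp: "ac_deriv (\<lambda>t. W t * p t) (\<lambda>t. w' t * p t + W t * p' t)" by (rule ac_deriv_mult[OF W(1) p(1)])
    note i3 = ac_deriv_integral_zero[OF Wp, of a]
    have i3: "integrable lborel (\<lambda>t. w' t * p t + W t * p' t)" "(LINT t|lborel. w' t * p t + W t * p' t) = 0"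
      by (intro i3; use s in simp)+
    \<comment> \<open>The integrand of the weak form minus the derivative of \<open>W p\<close>,
      whose integral is zero. Since \<open>h = W + \<sigma> y\<close>, all terms with
      \<open>p'\<close> cancel.\<close>
    let ?R = "\<lambda>t. (h t * p' t + (of_real (\<tau> t) * (y t * p t) - of_real (\<sigma> t) * (h t * p t + y t * p' t))) - (w' t * p t + W t * p' t)"
    have "(LINT t|lborel. v t * p t) = (LINT t|lborel. ?R t)"
    proof (rule integral_cong_AE)
      show "(\<lambda>t. v t * p t) \<in> borel_measurable lborel"
        using square_integrable_measurable[OF sq(2)] borel_measurable_continuous_onI[OF pc] by simp
      show "?R \<in> borel_measurable lborel"
        by (intro borel_measurable_integrable Bochner_Integration.integrable_diff Bochner_Integration.integrable_add i1 i2 i3)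
      show "AE t in lborel. v t * p t = ?R t"
        using vh
      proof eventually_elim
        case (elim t)
        show ?case unfolding elim by (simp add: h_def algebra_simps)
      qed
    qed
    also have "\<dots> = (LINT t|lborel. h t * p' t) + (LINT t|lborel. of_real (\<tau> t) * (y t * p t) - of_real (\<sigma> t) * (h t * p t + y t * p' t)) - 0"
      unfolding i3(2)[symmetric]
      by (subst Bochner_Integration.integral_diff[OF Bochner_Integration.integrable_add[OF i1 i2] i3(1)])
         (subst Bochner_Integration.integral_add[OF i1 i2], rule refl)
    finally show "(LINT t|lborel. v t * p t) = (LINT t|lborel. h t * p' t) + potential_form \<sigma> \<tau> (\<lambda>t. y t * p t) (\<lambda>t. h t * p t + y t * p' t)"
      by (simp add: potential_form_def)
  qed
  with y(2) show thesis by (rule that)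
qed

section \<open>Cutoffs at infinity\<close>

text \<open>\<open>bump\<close> is chosen among complex functions and is not known to be real; the
  energy identity needs a real cutoff. The dilation makes the derivative of order
  \<open>1 / R\<close>.\<close>

definition cutoff :: "real \<Rightarrow> real \<Rightarrow> real" where
  "cutoff R t = Re (bump (t / R))"

definition cutoff_deriv :: "real \<Rightarrow> real \<Rightarrow> real" where
  "cutoff_deriv R t = Re (vderiv bump (t / R)) / R"

lemma of_real_Re: "complex_of_real (Re w) = (1 / 2) * w + (1 / 2) * cnj w"
  by (simp add: complex_eq_iff)

lemma cutoff:
  assumes R: "R \<ge> 1"
  shows "ac_deriv (\<lambda>t. of_real (cutoff R t)) (\<lambda>t. of_real (cutoff_deriv R t))"
    "L2_loc (\<lambda>t. of_real (cutoff_deriv R t))"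
    "\<bar>cutoff R t\<bar> \<le> bump_bound" "\<bar>cutoff_deriv R t\<bar> \<le> bump_bound / R"
    "\<bar>t\<bar> \<le> R \<Longrightarrow> cutoff R t = 1" "\<bar>t\<bar> < R \<Longrightarrow> cutoff_deriv R t = 0"
    "\<bar>t\<bar> > 2 * R \<Longrightarrow> cutoff R t = 0" "\<bar>t\<bar> > 2 * R \<Longrightarrow> cutoff_deriv R t = 0"
    "\<bar>cutoff_deriv R t\<bar> \<le> bump_bound"
proof -
  have s: "smooth (\<lambda>t. bump ((1 / R) * t + 0))" by (intro smooth_affine smooth_bump)
  have "ac_deriv (\<lambda>t. bump ((1 / R) * t + 0)) (\<lambda>t. of_real (1 / R) * vderiv bump ((1 / R) * t + 0))"
    using ac_deriv_smooth[OF s] unfolding vderiv_bump_affine .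
  then have d: "ac_deriv (\<lambda>t. bump (t / R)) (\<lambda>t. of_real (1 / R) * vderiv bump (t / R))" by simp
  have e1: "(\<lambda>t. complex_of_real (cutoff R t)) = (\<lambda>t. (1 / 2) * bump (t / R) + (1 / 2) * cnj (bump (t / R)))"
    by (simp add: cutoff_def of_real_Re)
  have e2: "(\<lambda>t. complex_of_real (cutoff_deriv R t)) = (\<lambda>t. (1 / 2) * (of_real (1 / R) * vderiv bump (t / R)) + (1 / 2) * cnj (of_real (1 / R) * vderiv bump (t / R)))"
  proof
    fix t
    have "complex_of_real (cutoff_deriv R t) = complex_of_real (1 / R) * complex_of_real (Re (vderiv bump (t / R)))"
      by (simp add: cutoff_deriv_def)
    then show "complex_of_real (cutoff_deriv R t) = (1 / 2) * (of_real (1 / R) * vderiv bump (t / R)) + (1 / 2) * cnj (of_real (1 / R) * vderiv bump (t / R))"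
      unfolding of_real_Re by (simp add: algebra_simps)
  qed
  show "ac_deriv (\<lambda>t. of_real (cutoff R t)) (\<lambda>t. of_real (cutoff_deriv R t))"
    unfolding e1 e2 by (intro ac_deriv_add ac_deriv_cmult ac_deriv_cnj d)
  have vc: "continuous_on UNIV (vderiv bump)" by (intro smooth_continuous smooth_deriv smooth_bump)
  have "continuous_on UNIV (\<lambda>t. vderiv bump (t / R))"
    using R by (intro continuous_on_compose2[OF vc] continuous_intros) auto
  then show "L2_loc (\<lambda>t. of_real (cutoff_deriv R t))"
    unfolding e2 by (intro L2_loc_continuous continuous_intros)
  show "\<bar>cutoff R t\<bar> \<le> bump_bound"
    unfolding cutoff_def using abs_Re_le_cmod[of "bump (t / R)"] bump_bound(2)[of "t / R"] by linarith
  have "\<bar>Re (vderiv bump (t / R))\<bar> \<le> bump_bound"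
    using abs_Re_le_cmod[of "vderiv bump (t / R)"] bump_bound(3)[of "t / R"] by linarith
  then show d': "\<bar>cutoff_deriv R t\<bar> \<le> bump_bound / R"
    using R by (simp add: cutoff_deriv_def divide_right_mono)
  have "bump_bound / R \<le> bump_bound"
    using R bump_bound(1) mult_left_mono[of 1 R bump_bound] by (simp add: divide_le_eq)
  then show "\<bar>cutoff_deriv R t\<bar> \<le> bump_bound" using d' by linarith
  have ab: "\<bar>t / R\<bar> = \<bar>t\<bar> / R" using R by simp
  show "\<bar>t\<bar> \<le> R \<Longrightarrow> cutoff R t = 1" using R by (simp add: cutoff_def bump_eq_1 ab)
  show "\<bar>t\<bar> < R \<Longrightarrow> cutoff_deriv R t = 0" using R by (simp add: cutoff_deriv_def vderiv_bump_eq_0 ab)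
  show "\<bar>t\<bar> > 2 * R \<Longrightarrow> cutoff R t = 0" using R by (simp add: cutoff_def bump_eq_0 ab le_divide_eq)
  show "\<bar>t\<bar> > 2 * R \<Longrightarrow> cutoff_deriv R t = 0" using R by (simp add: cutoff_deriv_def vderiv_bump_eq_0 ab le_divide_eq)
qed

section \<open>The energy estimate\<close>

text \<open>A relative form bound below 1, so that the Dirichlet integral can be absorbed. The value
  3/4 is 1/2 for the limit potential plus 1/4 for a small perturbation.\<close>

definition form_bounded :: "(real \<Rightarrow> real) \<Rightarrow> (real \<Rightarrow> real) \<Rightarrow> real \<Rightarrow> bool" where
  "form_bounded \<sigma> \<tau> K \<longleftrightarrow> (\<forall>y h a. ac_deriv y h \<longrightarrow> L2_loc h \<longrightarrow> (\<forall>t. \<bar>t\<bar> > a \<longrightarrow> y t = 0 \<and> h t = 0) \<longrightarrow>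
    cmod (potential_form \<sigma> \<tau> (\<lambda>t. of_real ((cmod (y t))\<^sup>2)) (\<lambda>t. h t * cnj (y t) + y t * cnj (h t)))
      \<le> (3 / 4) * (L2_norm h)\<^sup>2 + K * (L2_norm y)\<^sup>2)"

lemma form_boundedD:
  assumes "form_bounded \<sigma> \<tau> K" "ac_deriv y h" "L2_loc h" "\<And>t. \<bar>t\<bar> > a \<Longrightarrow> y t = 0 \<and> h t = 0"
  shows "cmod (potential_form \<sigma> \<tau> (\<lambda>t. of_real ((cmod (y t))\<^sup>2)) (\<lambda>t. h t * cnj (y t) + y t * cnj (h t)))
    \<le> (3 / 4) * (L2_norm h)\<^sup>2 + K * (L2_norm y)\<^sup>2"
  using assms unfolding form_bounded_def by blast

text \<open>Absorbing 3/4 of the Dirichlet integral multiplies the remaining terms by 4: half the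
  squared norm of the tested function gives \<open>2 * bump_bound ^ 4\<close>, the error of the
  cutoff gives \<open>4 * bump_bound\<^sup>2\<close>, and the lower order part of the form bound
  gives the last term.\<close>

definition energy_constant :: "real \<Rightarrow> real" where
  "energy_constant K = 2 * bump_bound ^ 4 + 4 * bump_bound\<^sup>2 + 4 * K * bump_bound\<^sup>2"

text \<open>
  Testing with \<open>\<chi>\<^sup>2\<close> times the conjugate of \<open>y\<close> gives, in the real part, the form of \<open>\<chi> y\<close> up to
  \<open>\<integral>\<bar>\<chi>' y\<bar>\<^sup>2\<close>; no decay of the derivative \<open>h\<close> has to be known in advance.
\<close>

lemma localized_energy_estimate:
  assumes w: "weak_solution \<sigma> \<tau> y h v" and fb: "form_bounded \<sigma> \<tau> K" and K: "K \<ge> 0" and R: "R \<ge> 1"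
  defines "z' \<equiv> \<lambda>t. of_real (cutoff_deriv R t) * y t + of_real (cutoff R t) * h t"
  shows "square_integrable z'" "(L2_norm z')\<^sup>2 \<le> 2 * (L2_norm v)\<^sup>2 + energy_constant K * (L2_norm y)\<^sup>2"
proof -
  have yh: "ac_deriv y h" "L2_loc h" "square_integrable y" "square_integrable v"
    using w by (auto simp: weak_solution_def)
  let ?c = "\<lambda>t. complex_of_real (cutoff R t)" and ?c' = "\<lambda>t. complex_of_real (cutoff_deriv R t)"
  note c = cutoff[OF R]
  define z where "z t = ?c t * y t" for t
  have c0: "?c t = 0" "?c' t = 0" if "\<bar>t\<bar> > 2 * R" for t using c(7,8)[OF that] by auto
  have zs: "sobolev_pair z z'"
    unfolding z_def[abs_def] z'_def by (rule sobolev_pair_mult_compact_support[OF c(1,2) c0 yh(1,2)])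
  then show z'sq: "square_integrable z'" by (simp add: sobolev_pair_def)
  have zsq: "square_integrable z" and zac: "ac_deriv z z'" using zs by (auto simp: sobolev_pair_def)
  have z'l: "L2_loc z'" by (rule square_integrable_imp_L2_loc[OF z'sq])
  define p where "p t = ?c t * cnj (z t)" for t
  define p' where "p' t = ?c' t * cnj (z t) + ?c t * cnj (z' t)" for t
  have ps: "sobolev_pair p p'"
    unfolding p_def[abs_def] p'_def[abs_def]
    by (rule sobolev_pair_mult_compact_support[OF c(1,2) c0 ac_deriv_cnj[OF zac] L2_loc_cnj[OF z'l]])
  have p: "ac_deriv p p'" "L2_loc p'" "square_integrable p"
    using ps by (auto simp: sobolev_pair_def square_integrable_imp_L2_loc)
  have p0: "p t = 0 \<and> p' t = 0" if "\<bar>t\<bar> > 2 * R" for t using c0[OF that] by (simp add: p_def p'_def)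
  have z0: "z t = 0 \<and> z' t = 0" if "\<bar>t\<bar> > 2 * R" for t using c0[OF that] by (simp add: z_def z'_def)
  have eq: "(LINT t|lborel. v t * p t) = (LINT t|lborel. h t * p' t) + potential_form \<sigma> \<tau> (\<lambda>t. y t * p t) (\<lambda>t. h t * p t + y t * p' t)"
    by (rule weak_solutionD[OF w p(1,2) p0])
  have yp1: "(\<lambda>t. y t * p t) = (\<lambda>t. of_real ((cmod (z t))\<^sup>2))"
    by (simp add: p_def z_def complex_norm_square fun_eq_iff mult.assoc mult.left_commute del: of_real_power)
  have yp2: "(\<lambda>t. h t * p t + y t * p' t) = (\<lambda>t. z' t * cnj (z t) + z t * cnj (z' t))"
    by (simp add: p_def p'_def z_def z'_def fun_eq_iff algebra_simps)
  have pf: "cmod (potential_form \<sigma> \<tau> (\<lambda>t. y t * p t) (\<lambda>t. h t * p t + y t * p' t)) \<le> (3 / 4) * (L2_norm z')\<^sup>2 + K * (L2_norm z)\<^sup>2"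
    unfolding yp1 yp2 by (rule form_boundedD[OF fb zac z'l z0])
  let ?D = bump_bound
  have D0: "?D \<ge> 0" by (rule bump_bound(1))
  have cb: "\<bar>cutoff R t\<bar> \<le> ?D" "\<bar>cutoff_deriv R t\<bar> \<le> ?D" for t by (rule c(3,9))+
  have cm: "?c \<in> borel_measurable borel" "?c' \<in> borel_measurable borel" using ac_deriv_measurable[OF c(1)] by auto
  have c'y: "square_integrable (\<lambda>t. ?c' t * y t)" "(L2_norm (\<lambda>t. ?c' t * y t))\<^sup>2 \<le> ?D\<^sup>2 * (L2_norm y)\<^sup>2"
    by (rule square_integrable_bounded_mult[OF yh(3) cm(2), of ?D]; simp add: cb)+
  have zn: "(L2_norm z)\<^sup>2 \<le> ?D\<^sup>2 * (L2_norm y)\<^sup>2"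
    unfolding z_def[abs_def] by (rule square_integrable_bounded_mult(2)[OF yh(3) cm(1)]) (simp add: cb)
  define Y2 where "Y2 = ?D\<^sup>2 * (L2_norm y)\<^sup>2"
  define Y4 where "Y4 = ?D ^ 4 * (L2_norm y)\<^sup>2"
  have ec: "energy_constant K * (L2_norm y)\<^sup>2 = 2 * Y4 + 4 * Y2 + 4 * (K * Y2)"
    by (simp add: energy_constant_def Y2_def Y4_def algebra_simps)
  have "(L2_norm p)\<^sup>2 \<le> ?D\<^sup>2 * (L2_norm (\<lambda>t. cnj (z t)))\<^sup>2"
    unfolding p_def[abs_def] by (rule square_integrable_bounded_mult(2)[OF square_integrable_cnj[OF zsq] cm(1)]) (simp add: cb)
  also have "\<dots> \<le> ?D\<^sup>2 * (?D\<^sup>2 * (L2_norm y)\<^sup>2)" unfolding L2_norm_cnj by (rule mult_left_mono[OF zn]) simp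
  finally have pn: "(L2_norm p)\<^sup>2 \<le> Y4" by (simp add: Y4_def power2_eq_square power4_eq_xxxx mult.assoc)
  have "cmod (LINT t|lborel. v t * p t) \<le> L2_norm v * L2_norm p" by (rule L2_Cauchy_Schwarz_integral[OF yh(4) p(3)])
  also have "\<dots> \<le> ((L2_norm v)\<^sup>2 + (L2_norm p)\<^sup>2) / 2" by (rule mult_le_sum_squares)
  also have "\<dots> \<le> ((L2_norm v)\<^sup>2 + Y4) / 2" by (intro divide_right_mono add_left_mono pn) simp
  finally have vp: "cmod (LINT t|lborel. v t * p t) \<le> ((L2_norm v)\<^sup>2 + Y4) / 2" .
  have hp'i: "integrable lborel (\<lambda>t. h t * p' t)"
    by (rule integrable_compact_support(1)[OF L2_loc_mult[OF yh(2) p(2)], of "2 * R"]) (simp add: p0)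
  \<comment> \<open>For a real cutoff, the cross term of the left side has the same real part as the
    cross term of \<open>\<bar>z'\<bar>\<^sup>2\<close>.\<close>
  have Re_hp': "Re (h t * p' t) = (cmod (z' t))\<^sup>2 - (cmod (?c' t * y t))\<^sup>2" for t
    unfolding p'_def z_def z'_def cmod_power2 by (simp add: power2_eq_square algebra_simps)
  have "Re (LINT t|lborel. h t * p' t) = (LINT t|lborel. (cmod (z' t))\<^sup>2 - (cmod (?c' t * y t))\<^sup>2)"
    using integral_Re[OF hp'i] unfolding Re_hp' by simp
  also have "\<dots> = (L2_norm z')\<^sup>2 - (L2_norm (\<lambda>t. ?c' t * y t))\<^sup>2"
    unfolding L2_norm_squared by (intro Bochner_Integration.integral_diff square_integrable_integrable z'sq c'y)
  finally have "(L2_norm z')\<^sup>2 - (L2_norm (\<lambda>t. ?c' t * y t))\<^sup>2 = Re (LINT t|lborel. v t * p t) - Re (potential_form \<sigma> \<tau> (\<lambda>t. y t * p t) (\<lambda>t. h t * p t + y t * p' t))"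
    using arg_cong[OF eq, of Re] by simp
  also have "\<dots> \<le> cmod (LINT t|lborel. v t * p t) + cmod (potential_form \<sigma> \<tau> (\<lambda>t. y t * p t) (\<lambda>t. h t * p t + y t * p' t))"
    using abs_Re_le_cmod[of "LINT t|lborel. v t * p t"] abs_Re_le_cmod[of "potential_form \<sigma> \<tau> (\<lambda>t. y t * p t) (\<lambda>t. h t * p t + y t * p' t)"]
    by linarith
  also have "\<dots> \<le> ((L2_norm v)\<^sup>2 + Y4) / 2 + ((3 / 4) * (L2_norm z')\<^sup>2 + K * Y2)"
    by (rule add_mono[OF vp order_trans[OF pf add_left_mono[OF mult_left_mono[OF zn[folded Y2_def] K]]]])
  finally have "(L2_norm z')\<^sup>2 \<le> ((L2_norm v)\<^sup>2 + Y4) / 2 + ((3 / 4) * (L2_norm z')\<^sup>2 + K * Y2) + Y2"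
    using c'y(2)[folded Y2_def] by linarith
  then show "(L2_norm z')\<^sup>2 \<le> 2 * (L2_norm v)\<^sup>2 + energy_constant K * (L2_norm y)\<^sup>2"
    unfolding ec by argo
qed

text \<open>Inside \<open>\<bar>t\<bar> < R\<close> the localized derivative coincides with
  \<open>h\<close>, and the bound of \<open>localized_energy_estimate\<close> does not depend on
  \<open>R\<close>. Monotone convergence gives both square integrability of \<open>h\<close> and the
  estimate.\<close>

lemma energy_estimate:
  assumes w: "weak_solution \<sigma> \<tau> y h v" and fb: "form_bounded \<sigma> \<tau> K" and K: "K \<ge> 0"
  shows "sobolev_pair y h" "(L2_norm h)\<^sup>2 \<le> 2 * (L2_norm v)\<^sup>2 + energy_constant K * (L2_norm y)\<^sup>2"
proof -
  have yh: "ac_deriv y h" "L2_loc h" "square_integrable y" using w by (auto simp: weak_solution_def)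
  define B where "B = 2 * (L2_norm v)\<^sup>2 + energy_constant K * (L2_norm y)\<^sup>2"
  define f where "f n t = indicator {-real (Suc n)<..<real (Suc n)} t * (cmod (h t))\<^sup>2" for n t
  have fi: "integrable lborel (f n)" for n
  proof -
    have "set_integrable lborel {-real (Suc n)<..<real (Suc n)} (\<lambda>t. (cmod (h t))\<^sup>2)"
      by (rule set_integrable_subset[OF L2_loc_set_integrable[OF yh(2), of "-real (Suc n)" "real (Suc n)"]]) auto
    then show ?thesis by (simp add: set_integrable_def f_def[abs_def])
  qed
  have fB: "(LINT t|lborel. f n t) \<le> B" for n
  proof -
    have R: "real (Suc n) \<ge> 1" by simp
    let ?z = "\<lambda>t. of_real (cutoff_deriv (real (Suc n)) t) * y t + of_real (cutoff (real (Suc n)) t) * h t"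
    note l = localized_energy_estimate[OF w fb K R]
    have "(LINT t|lborel. f n t) \<le> (LINT t|lborel. (cmod (?z t))\<^sup>2)"
    proof (rule integral_mono[OF fi square_integrable_integrable[OF l(1)]])
      show "f n t \<le> (cmod (?z t))\<^sup>2" for t
      proof (cases "\<bar>t\<bar> < real (Suc n)")
        case True
        then have "?z t = h t" using cutoff(5,6)[OF R, of t] by simp
        then show ?thesis by (simp add: f_def indicator_def)
      next
        case False
        then show ?thesis by (auto simp: f_def indicator_def)
      qed
    qed
    also have "\<dots> \<le> B" using l(2) unfolding L2_norm_squared[of ?z] B_def .
    finally show ?thesis .
  qed
  have mono: "f m t \<le> f n t" if "m \<le> n" for m n t
    using that by (auto simp: f_def indicator_def)
  have lim: "(\<lambda>n. f n t) \<longlonglongrightarrow> (cmod (h t))\<^sup>2" for t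
  proof -
    obtain N where N: "\<bar>t\<bar> < real N" using reals_Archimedean2 by blast
    have "f n t = (cmod (h t))\<^sup>2" if "n \<ge> N" for n
    proof -
      have "\<bar>t\<bar> < real (Suc n)" using N that by linarith
      then show ?thesis by (auto simp: f_def indicator_def)
    qed
    then show ?thesis by (intro tendsto_eventually) (auto simp: eventually_sequentially)
  qed
  have inc: "incseq (\<lambda>n. LINT t|lborel. f n t)"
    by (intro monoI integral_mono fi mono)
  then obtain x where x: "(\<lambda>n. LINT t|lborel. f n t) \<longlonglongrightarrow> x"
    using incseq_convergent[of "\<lambda>n. LINT t|lborel. f n t" B] fB by blast
  have hm: "(\<lambda>t. (cmod (h t))\<^sup>2) \<in> borel_measurable lborel"
    using L2_loc_measurable[OF yh(2)] by simp
  have mono': "AE t in lborel. mono (\<lambda>n. f n t)" by (intro AE_I2 monoI mono)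
  have lim': "AE t in lborel. (\<lambda>n. f n t) \<longlonglongrightarrow> (cmod (h t))\<^sup>2" by (intro AE_I2 lim)
  have i: "integrable lborel (\<lambda>t. (cmod (h t))\<^sup>2)"
    by (rule integrable_monotone_convergence[OF fi mono' lim' x hm])
  have "(L2_norm h)\<^sup>2 = x"
    unfolding L2_norm_squared by (rule integral_monotone_convergence[OF fi mono' lim' x hm])
  also have "x \<le> B" by (rule LIMSEQ_le_const2[OF x]) (use fB in auto)
  finally show "(L2_norm h)\<^sup>2 \<le> 2 * (L2_norm v)\<^sup>2 + energy_constant K * (L2_norm y)\<^sup>2" by (simp add: B_def)
  show "sobolev_pair y h"
    using i yh L2_loc_measurable[OF yh(2)] by (simp add: sobolev_pair_def square_integrable_def)
qed

section \<open>Comparison of two equations\<close>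

text \<open>Testing each equation with the solution of the other one: only the difference of the potentials survives.\<close>

lemma weak_solutions_difference:
  assumes w1: "weak_solution \<sigma> \<tau> y h v" "sobolev_pair y h" and w2: "weak_solution \<sigma>' \<tau>' y' h' v'" "sobolev_pair y' h'"
    and adm: "admissible \<sigma> \<tau>" "admissible \<sigma>' \<tau>'" and e: "e \<ge> 0"
    and pert: "\<And>p p' a. ac_deriv p p' \<Longrightarrow> L2_loc p' \<Longrightarrow> (\<And>t. \<bar>t\<bar> > a \<Longrightarrow> p t = 0) \<Longrightarrow> (\<And>t. \<bar>t\<bar> > a \<Longrightarrow> p' t = 0) \<Longrightarrow>
      cmod (potential_form (\<lambda>t. \<sigma>' t - \<sigma> t) (\<lambda>t. \<tau>' t - \<tau> t) (\<lambda>t. p t * y t) (\<lambda>t. p' t * y t + p t * h t)) \<le> e * sobolev_norm p p' * sobolev_norm y h"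
  shows "cmod (LINT t|lborel. v t * y' t - v' t * y t) \<le> 2 * bump_bound * e * sobolev_norm y' h' * sobolev_norm y h"
proof -
  let ?D = bump_bound
  have D0: "?D \<ge> 0" by (rule bump_bound(1))
  have s: "ac_deriv y h" "square_integrable y" "square_integrable h" "ac_deriv y' h'" "square_integrable y'" "square_integrable h'"
    using w1(2) w2(2) by (auto simp: sobolev_pair_def)
  have sv: "square_integrable v" "square_integrable v'" using w1(1) w2(1) by (auto simp: weak_solution_def)
  have hl: "L2_loc h" "L2_loc h'" using s by (auto intro: square_integrable_imp_L2_loc)
  have iw: "integrable lborel (\<lambda>t. v t * y' t - v' t * y t)"
    by (intro Bochner_Integration.integrable_diff square_integrable_mult s sv)
  have ig: "integrable lborel (\<lambda>t. h t * y' t - h' t * y t)"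
    by (intro Bochner_Integration.integrable_diff square_integrable_mult s)
  define M where "M = (LINT t|lborel. cmod (h t * y' t - h' t * y t))"
  define E where "E = 2 * ?D * e * sobolev_norm y' h' * sobolev_norm y h"
  define R where "R n = real (Suc n)" for n
  let ?c = "\<lambda>n t. complex_of_real (cutoff (R n) t)" and ?c' = "\<lambda>n t. complex_of_real (cutoff_deriv (R n) t)"
  \<comment> \<open>Green's formula with a cutoff: the principal parts cancel except for the
    boundary term \<open>cutoff_deriv * (h y' - h' y)\<close>, of order \<open>1 / R n\<close>;
    \<open>E\<close> bounds the perturbation independently of \<open>n\<close>.\<close>
  have bound: "cmod (LINT t|lborel. ?c n t * (v t * y' t - v' t * y t)) \<le> ?D * M * inverse (real (Suc n)) + E" for n
  proof -
    have R1: "R n \<ge> 1" by (simp add: R_def)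
    note c = cutoff[OF R1]
    have c0: "?c n t = 0" "?c' n t = 0" if "\<bar>t\<bar> > 2 * R n" for t using c(7,8)[OF that] by auto
    have cb: "\<bar>cutoff (R n) t\<bar> \<le> ?D" "\<bar>cutoff_deriv (R n) t\<bar> \<le> ?D" for t by (rule c(3,9))+
    have cm: "?c n \<in> borel_measurable borel" "?c' n \<in> borel_measurable borel" using ac_deriv_measurable[OF c(1)] by auto
    define p where "p t = ?c n t * y' t" for t
    define p' where "p' t = ?c' n t * y' t + ?c n t * h' t" for t
    define r where "r t = ?c n t * y t" for t
    define r' where "r' t = ?c' n t * y t + ?c n t * h t" for t
    have ps: "sobolev_pair p p'" unfolding p_def[abs_def] p'_def[abs_def]
      by (rule sobolev_pair_mult_compact_support[OF c(1,2) c0 s(4) hl(2)])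
    have rs: "sobolev_pair r r'" unfolding r_def[abs_def] r'_def[abs_def]
      by (rule sobolev_pair_mult_compact_support[OF c(1,2) c0 s(1) hl(1)])
    have p: "ac_deriv p p'" "L2_loc p'" "square_integrable p" and r: "ac_deriv r r'" "L2_loc r'" "square_integrable r"
      using ps rs by (auto simp: sobolev_pair_def square_integrable_imp_L2_loc)
    have p0: "p t = 0" "p' t = 0" "r t = 0" "r' t = 0" if "\<bar>t\<bar> > 2 * R n" for t using c0[OF that] by (auto simp: p_def p'_def r_def r'_def)
    have e1: "(LINT t|lborel. v t * p t) = (LINT t|lborel. h t * p' t) + potential_form \<sigma> \<tau> (\<lambda>t. y t * p t) (\<lambda>t. h t * p t + y t * p' t)"
      by (rule weak_solutionD[OF w1(1) p(1,2), of "2 * R n"]) (simp add: p0)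
    have e2: "(LINT t|lborel. v' t * r t) = (LINT t|lborel. h' t * r' t) + potential_form \<sigma>' \<tau>' (\<lambda>t. y' t * r t) (\<lambda>t. h' t * r t + y' t * r' t)"
      by (rule weak_solutionD[OF w2(1) r(1,2), of "2 * R n"]) (simp add: p0)
    let ?P = "\<lambda>t. p t * y t" and ?P' = "\<lambda>t. p' t * y t + p t * h t"
    have f1: "(\<lambda>t. y t * p t) = ?P" "(\<lambda>t. h t * p t + y t * p' t) = ?P'" by (auto simp: algebra_simps)
    \<comment> \<open>Both products are the cutoff times \<open>y * y'\<close>, so the two potential
      forms are evaluated at the same pair and can be subtracted.\<close>
    have f2: "(\<lambda>t. y' t * r t) = ?P" "(\<lambda>t. h' t * r t + y' t * r' t) = ?P'"
      by (auto simp: p_def p'_def r_def r'_def algebra_simps)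
    have Ps: "sobolev_pair ?P ?P'"
      by (rule sobolev_pair_mult_compact_support[OF p(1,2) p0(1,2) s(1) hl(1)])
    have pd: "potential_form (\<lambda>t. \<sigma>' t - \<sigma> t) (\<lambda>t. \<tau>' t - \<tau> t) ?P ?P' = potential_form \<sigma>' \<tau>' ?P ?P' - potential_form \<sigma> \<tau> ?P ?P'"
      by (rule potential_form_diff[OF adm(2,1), of _ _ "2 * R n"])
         (use Ps p0 in \<open>auto simp: sobolev_pair_def intro: ac_deriv_continuous square_integrable_imp_L2_loc\<close>)
    have "(LINT t|lborel. ?c n t * (v t * y' t - v' t * y t)) = (LINT t|lborel. v t * p t - v' t * r t)"
      by (simp add: p_def r_def algebra_simps)
    also have "\<dots> = (LINT t|lborel. v t * p t) - (LINT t|lborel. v' t * r t)"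
      by (intro Bochner_Integration.integral_diff square_integrable_mult sv p r)
    also have "\<dots> = ((LINT t|lborel. h t * p' t) - (LINT t|lborel. h' t * r' t)) - potential_form (\<lambda>t. \<sigma>' t - \<sigma> t) (\<lambda>t. \<tau>' t - \<tau> t) ?P ?P'"
      unfolding e1 e2 f1 f2 pd by simp
    also have "(LINT t|lborel. h t * p' t) - (LINT t|lborel. h' t * r' t) = (LINT t|lborel. h t * p' t - h' t * r' t)"
      using ps rs by (intro Bochner_Integration.integral_diff[symmetric] square_integrable_mult s) (auto simp: sobolev_pair_def)
    also have "(\<lambda>t. h t * p' t - h' t * r' t) = (\<lambda>t. ?c' n t * (h t * y' t - h' t * y t))"
      by (simp add: p'_def r'_def algebra_simps fun_eq_iff)
    finally have eq: "(LINT t|lborel. ?c n t * (v t * y' t - v' t * y t)) = (LINT t|lborel. ?c' n t * (h t * y' t - h' t * y t))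
      - potential_form (\<lambda>t. \<sigma>' t - \<sigma> t) (\<lambda>t. \<tau>' t - \<tau> t) ?P ?P'" .
    have "cmod (LINT t|lborel. ?c' n t * (h t * y' t - h' t * y t)) \<le> (LINT t|lborel. cmod (?c' n t * (h t * y' t - h' t * y t)))"
      by (rule integral_norm_bound)
    also have "\<dots> \<le> (LINT t|lborel. (?D / R n) * cmod (h t * y' t - h' t * y t))"
    proof (rule integral_mono)
      have "integrable lborel (\<lambda>t. (?c' n t * h t) * y' t - (?c' n t * h' t) * y t)"
        by (intro Bochner_Integration.integrable_diff square_integrable_mult square_integrable_bounded_mult(1)[OF _ cm(2), of _ ?D] s)
           (simp_all add: cb)
      then have "integrable lborel (\<lambda>t. ?c' n t * (h t * y' t - h' t * y t))" by (simp add: algebra_simps)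
      then show "integrable lborel (\<lambda>t. cmod (?c' n t * (h t * y' t - h' t * y t)))" by (rule integrable_norm)
      show "integrable lborel (\<lambda>t. (?D / R n) * cmod (h t * y' t - h' t * y t))"
        by (intro integrable_mult_right integrable_norm ig)
      show "cmod (?c' n t * (h t * y' t - h' t * y t)) \<le> (?D / R n) * cmod (h t * y' t - h' t * y t)" for t
        unfolding norm_mult using c(4)[of t] by (intro mult_right_mono) auto
    qed
    also have "\<dots> = ?D * M * inverse (real (Suc n))" by (simp add: M_def R_def field_simps)
    finally have b1: "cmod (LINT t|lborel. ?c' n t * (h t * y' t - h' t * y t)) \<le> ?D * M * inverse (real (Suc n))" .
    \<comment> \<open>Since \<open>R n\<close> is at least 1, cutting off costs a factor independent
      of \<open>n\<close>.\<close>
    have "(sobolev_norm p p')\<^sup>2 \<le> (2 * ?D * sobolev_norm y' h')\<^sup>2"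
    proof -
      have n1: "(L2_norm p)\<^sup>2 \<le> ?D\<^sup>2 * (L2_norm y')\<^sup>2"
        unfolding p_def[abs_def] by (rule square_integrable_bounded_mult(2)[OF s(5) cm(1)]) (simp add: cb)
      have "(L2_norm p')\<^sup>2 \<le> 2 * (L2_norm (\<lambda>t. ?c' n t * y' t))\<^sup>2 + 2 * (L2_norm (\<lambda>t. ?c n t * h' t))\<^sup>2"
        unfolding p'_def[abs_def]
        by (intro square_integrable_add(2) square_integrable_bounded_mult(1)[OF s(5) cm(2), of ?D] square_integrable_bounded_mult(1)[OF s(6) cm(1), of ?D])
           (simp_all add: cb)
      moreover have "(L2_norm (\<lambda>t. ?c' n t * y' t))\<^sup>2 \<le> ?D\<^sup>2 * (L2_norm y')\<^sup>2"
        by (rule square_integrable_bounded_mult(2)[OF s(5) cm(2)]) (simp add: cb)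
      moreover have "(L2_norm (\<lambda>t. ?c n t * h' t))\<^sup>2 \<le> ?D\<^sup>2 * (L2_norm h')\<^sup>2"
        by (rule square_integrable_bounded_mult(2)[OF s(6) cm(1)]) (simp add: cb)
      moreover have "0 \<le> ?D\<^sup>2 * (L2_norm y')\<^sup>2" "0 \<le> ?D\<^sup>2 * (L2_norm h')\<^sup>2" by auto
      ultimately have "(L2_norm p)\<^sup>2 + (L2_norm p')\<^sup>2 \<le> 4 * (?D\<^sup>2 * (L2_norm y')\<^sup>2) + 4 * (?D\<^sup>2 * (L2_norm h')\<^sup>2)" using n1 by linarith
      then show ?thesis by (simp add: power_mult_distrib sobolev_norm_squared distrib_left mult.assoc)
    qed
    then have "sobolev_norm p p' \<le> 2 * ?D * sobolev_norm y' h'"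
      by (rule power2_le_imp_le) (use D0 sobolev_norm_nonneg in auto)
    then have "e * sobolev_norm p p' * sobolev_norm y h \<le> e * (2 * ?D * sobolev_norm y' h') * sobolev_norm y h"
      using e sobolev_norm_nonneg[of y h] by (intro mult_right_mono mult_left_mono) auto
    also have "\<dots> = E" by (simp add: E_def)
    finally have b2: "cmod (potential_form (\<lambda>t. \<sigma>' t - \<sigma> t) (\<lambda>t. \<tau>' t - \<tau> t) ?P ?P') \<le> E"
      using pert[OF p(1,2) p0(1,2)] by (rule order_trans[rotated])
    show ?thesis
      unfolding eq by (rule order_trans[OF norm_triangle_ineq4 add_mono[OF b1 b2]])
  qed
  have "(\<lambda>n. LINT t|lborel. ?c n t * (v t * y' t - v' t * y t)) \<longlonglongrightarrow> (LINT t|lborel. v t * y' t - v' t * y t)"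
  proof (rule integral_dominated_convergence[where w="\<lambda>t. ?D * cmod (v t * y' t - v' t * y t)"])
    show "integrable lborel (\<lambda>t. ?D * cmod (v t * y' t - v' t * y t))" by (intro integrable_mult_right integrable_norm iw)
    show "(\<lambda>t. v t * y' t - v' t * y t) \<in> borel_measurable lborel" by (rule borel_measurable_integrable[OF iw])
    show "(\<lambda>t. ?c n t * (v t * y' t - v' t * y t)) \<in> borel_measurable lborel" for n
      using ac_deriv_measurable(1)[OF cutoff(1)[of "R n"]] borel_measurable_integrable[OF iw]
      by (intro borel_measurable_times) (simp_all add: R_def)
    show "AE t in lborel. cmod (?c n t * (v t * y' t - v' t * y t)) \<le> ?D * cmod (v t * y' t - v' t * y t)" for n
      using cutoff(3)[of "R n"] by (intro AE_I2) (simp add: norm_mult R_def mult_right_mono)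
    show "AE t in lborel. (\<lambda>n. ?c n t * (v t * y' t - v' t * y t)) \<longlonglongrightarrow> v t * y' t - v' t * y t"
    proof (intro AE_I2)
      fix t
      obtain N where N: "\<bar>t\<bar> \<le> real N" using real_arch_simple by blast
      have "?c n t = 1" if "n \<ge> N" for n
      proof -
        have "\<bar>t\<bar> \<le> R n" using N that by (simp add: R_def)
        then show ?thesis using cutoff(5)[of "R n" t] by (simp add: R_def)
      qed
      then show "(\<lambda>n. ?c n t * (v t * y' t - v' t * y t)) \<longlonglongrightarrow> v t * y' t - v' t * y t"
        by (intro tendsto_eventually) (auto simp: eventually_sequentially)
    qed
  qed
  then have lim: "(\<lambda>n. cmod (LINT t|lborel. ?c n t * (v t * y' t - v' t * y t))) \<longlonglongrightarrow> cmod (LINT t|lborel. v t * y' t - v' t * y t)"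
    by (rule tendsto_norm)
  have "(\<lambda>n. ?D * M * inverse (real (Suc n)) + E) \<longlonglongrightarrow> ?D * M * 0 + E"
    by (intro tendsto_intros LIMSEQ_inverse_real_of_nat)
  then have "cmod (LINT t|lborel. v t * y' t - v' t * y t) \<le> ?D * M * 0 + E"
    by (rule LIMSEQ_le[OF lim]) (use bound in auto)
  then show ?thesis by (simp add: E_def)
qed

section \<open>Resolvents\<close>

text \<open>With \<open>f + z y\<close> as right-hand side, the energy estimate has the coefficients
  \<open>1 + energy_constant K + 4 * (cmod z)\<^sup>2\<close> at the solution and 4 at
  \<open>f\<close>; the sum of the two dominates both.\<close>

definition resolvent_constant :: "real \<Rightarrow> complex \<Rightarrow> real" where
  "resolvent_constant K z = sqrt (5 + energy_constant K + 4 * (cmod z)\<^sup>2)"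

lemma energy_constant_nonneg: "K \<ge> 0 \<Longrightarrow> energy_constant K \<ge> 0"
  using bump_bound(1) by (simp add: energy_constant_def)

lemma resolvent_constant_nonneg: "K \<ge> 0 \<Longrightarrow> resolvent_constant K z \<ge> 0"
  using energy_constant_nonneg[of K] by (simp add: resolvent_constant_def)

text \<open>Upgrades \<open>L2\<close> bounds on a solution to Sobolev bounds. The constant sees the
  potential only through \<open>K\<close>, which is what makes it uniform along the
  sequence.\<close>

lemma resolvent_eq_weak_solution:
  assumes adm: "admissible \<sigma> \<tau>" and fb: "form_bounded \<sigma> \<tau> K" and K: "K \<ge> 0" and f: "square_integrable f"
    and u: "solves_resolvent_eq (schroedinger_graph \<sigma> \<tau>) z f u"
  obtains y h v where "AE t in lborel. u t = y t" "square_integrable u" "weak_solution \<sigma> \<tau> y h v" "sobolev_pair y h"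
    "AE t in lborel. v t = f t + z * y t" "sobolev_norm y h \<le> resolvent_constant K z * (L2_norm y + L2_norm f)"
proof -
  obtain v where uv: "(u, v) \<in> schroedinger_graph \<sigma> \<tau>" and v: "AE t in lborel. v t - z * u t = f t"
    using u by (auto simp: solves_resolvent_eq_def)
  obtain y h where y: "AE t in lborel. u t = y t" and w: "weak_solution \<sigma> \<tau> y h v"
    by (rule schroedinger_graph_weak_solution[OF adm uv])
  note en = energy_estimate[OF w fb K]
  have vy: "AE t in lborel. v t = f t + z * y t" using v y by eventually_elim (simp add: algebra_simps)
  have ysq: "square_integrable y" using en(1) by (simp add: sobolev_pair_def)
  have vm: "v \<in> borel_measurable borel" using w by (auto simp: weak_solution_def dest: square_integrable_measurable)
  have "L2_norm v = L2_norm (\<lambda>t. f t + z * y t)"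
  proof (rule square_integrable_AE_cong(2)[OF square_integrable_add(1)[OF f square_integrable_cmult[OF ysq]] _ vm])
    show "AE t in lborel. f t + z * y t = v t" using vy by eventually_elim simp
  qed
  then have "(L2_norm v)\<^sup>2 \<le> 2 * (L2_norm f)\<^sup>2 + 2 * (L2_norm (\<lambda>t. z * y t))\<^sup>2"
    using square_integrable_add(2)[OF f square_integrable_cmult[OF ysq, of z]] by simp
  then have "(L2_norm v)\<^sup>2 \<le> 2 * (L2_norm f)\<^sup>2 + 2 * ((cmod z)\<^sup>2 * (L2_norm y)\<^sup>2)"
    by (simp add: L2_norm_cmult power_mult_distrib)
  with en(2) have "(sobolev_norm y h)\<^sup>2 \<le> (L2_norm y)\<^sup>2 + 2 * (2 * (L2_norm f)\<^sup>2 + 2 * ((cmod z)\<^sup>2 * (L2_norm y)\<^sup>2)) + energy_constant K * (L2_norm y)\<^sup>2"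
    unfolding sobolev_norm_squared by argo
  also have "\<dots> = (1 + energy_constant K + 4 * (cmod z)\<^sup>2) * (L2_norm y)\<^sup>2 + 4 * (L2_norm f)\<^sup>2"
    by (simp add: algebra_simps)
  also have "\<dots> \<le> (resolvent_constant K z)\<^sup>2 * (L2_norm y)\<^sup>2 + (resolvent_constant K z)\<^sup>2 * (L2_norm f)\<^sup>2"
    using energy_constant_nonneg[OF K] by (intro add_mono mult_right_mono) (auto simp: resolvent_constant_def)
  also have "\<dots> \<le> (resolvent_constant K z * (L2_norm y + L2_norm f))\<^sup>2"
  proof -
    have le: "(L2_norm y)\<^sup>2 + (L2_norm f)\<^sup>2 \<le> (L2_norm y + L2_norm f)\<^sup>2" by (simp add: power2_sum L2_norm_nonneg)
    show ?thesis
      unfolding power_mult_distrib distrib_left[symmetric] by (rule mult_left_mono[OF le]) simp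
  qed
  finally have n: "sobolev_norm y h \<le> resolvent_constant K z * (L2_norm y + L2_norm f)"
    by (rule power2_le_imp_le) (use resolvent_constant_nonneg[OF K] L2_norm_nonneg in auto)
  have "square_integrable u" using uv by (simp add: schroedinger_graph_def)
  from that[OF y this w en(1) vy n] show thesis .
qed

lemma resolvent_solves:
  assumes "z \<in> resolvent_set S" "square_integrable f"
  shows "solves_resolvent_eq S z f (resolvent S z f)"
proof -
  have "\<exists>u. solves_resolvent_eq S z f u" using assms by (simp add: resolvent_set_def)
  then show ?thesis unfolding resolvent_def by (rule someI_ex)
qed

lemma resolvent_set_bound:
  assumes "z \<in> resolvent_set S"
  obtains C where "C \<ge> 0" "\<And>f u. square_integrable f \<Longrightarrow> solves_resolvent_eq S z f u \<Longrightarrow> L2_norm u \<le> C * L2_norm f"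
proof -
  obtain C where C: "\<And>f u. square_integrable f \<Longrightarrow> solves_resolvent_eq S z f u \<Longrightarrow> L2_norm u \<le> C * L2_norm f"
    using assms unfolding resolvent_set_def by blast
  have "L2_norm u \<le> \<bar>C\<bar> * L2_norm f" if "square_integrable f" "solves_resolvent_eq S z f u" for f u
    using C[OF that] mult_right_mono[OF abs_ge_self[of C] L2_norm_nonneg[of f]] by linarith
  then show thesis using that[of "\<bar>C\<bar>"] by simp
qed

text \<open>
  The difference \<open>w\<close> of the two resolvents applied to \<open>f\<close> is tested with its own conjugate \<open>g\<close>:
  the solution \<open>v\<close> of the unperturbed equation with right-hand side \<open>g\<close> turns
  \<open>\<parallel>w\<parallel>\<^sup>2\<close> into the form of the perturbation. The pairing is bilinear, so the adjoint is not needed.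
\<close>

lemma resolvent_difference_bound:
  assumes adm: "admissible \<sigma> \<tau>" "admissible \<sigma>' \<tau>'"
    and fb: "form_bounded \<sigma> \<tau> K" "form_bounded \<sigma>' \<tau>' K" and K: "K \<ge> 0" and e: "e \<ge> 0"
    and pert: "\<And>p p' y h a. ac_deriv p p' \<Longrightarrow> L2_loc p' \<Longrightarrow> (\<And>t. \<bar>t\<bar> > a \<Longrightarrow> p t = 0) \<Longrightarrow> (\<And>t. \<bar>t\<bar> > a \<Longrightarrow> p' t = 0) \<Longrightarrow>
      sobolev_pair y h \<Longrightarrow>
      cmod (potential_form (\<lambda>t. \<sigma>' t - \<sigma> t) (\<lambda>t. \<tau>' t - \<tau> t) (\<lambda>t. p t * y t) (\<lambda>t. p' t * y t + p t * h t)) \<le> e * sobolev_norm p p' * sobolev_norm y h"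
    and z: "z \<in> resolvent_set (schroedinger_graph \<sigma> \<tau>)" "z \<in> resolvent_set (schroedinger_graph \<sigma>' \<tau>')"
    and C: "C \<ge> 0" "\<And>f u. square_integrable f \<Longrightarrow> solves_resolvent_eq (schroedinger_graph \<sigma> \<tau>) z f u \<Longrightarrow> L2_norm u \<le> C * L2_norm f"
  defines "G \<equiv> resolvent_constant K z"
  defines "B \<equiv> 2 * bump_bound * (G * (C + 1))"
  assumes small: "2 * G * B * e \<le> 1 / 2" and f: "square_integrable f" "L2_norm f \<le> 1"
  shows "L2_norm (\<lambda>t. resolvent (schroedinger_graph \<sigma>' \<tau>') z f t - resolvent (schroedinger_graph \<sigma> \<tau>) z f t) \<le> B * e * (2 * G * (2 * C + 1))"
proof -
  let ?S = "schroedinger_graph \<sigma> \<tau>" and ?S' = "schroedinger_graph \<sigma>' \<tau>'"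
  define u where "u = resolvent ?S z f"
  define u' where "u' = resolvent ?S' z f"
  have G0: "G \<ge> 0" unfolding G_def by (rule resolvent_constant_nonneg[OF K])
  have B0: "B \<ge> 0" using G0 C(1) bump_bound(1) by (simp add: B_def)
  have su: "solves_resolvent_eq ?S z f u" unfolding u_def by (rule resolvent_solves[OF z(1) f(1)])
  have su': "solves_resolvent_eq ?S' z f u'" unfolding u'_def by (rule resolvent_solves[OF z(2) f(1)])
  obtain y h v where y: "AE t in lborel. u t = y t" "square_integrable u" "weak_solution \<sigma> \<tau> y h v" "sobolev_pair y h"
    "AE t in lborel. v t = f t + z * y t" "sobolev_norm y h \<le> G * (L2_norm y + L2_norm f)"
    unfolding G_def by (rule resolvent_eq_weak_solution[OF adm(1) fb(1) K f(1) su])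
  obtain y' h' v' where y': "AE t in lborel. u' t = y' t" "square_integrable u'" "weak_solution \<sigma>' \<tau>' y' h' v'" "sobolev_pair y' h'"
    "AE t in lborel. v' t = f t + z * y' t" "sobolev_norm y' h' \<le> G * (L2_norm y' + L2_norm f)"
    unfolding G_def by (rule resolvent_eq_weak_solution[OF adm(2) fb(2) K f(1) su'])
  have sq: "square_integrable y" "square_integrable y'" using y(4) y'(4) by (auto simp: sobolev_pair_def)
  define w where "w t = y' t - y t" for t
  have wsq: "square_integrable w" unfolding w_def[abs_def] by (rule square_integrable_diff[OF sq(2,1)])
  define g where "g t = cnj (w t)" for t
  have gsq: "square_integrable g" and gn: "L2_norm g = L2_norm w"
    unfolding g_def[abs_def] using square_integrable_cnj[OF wsq] L2_norm_cnj by auto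
  have sx: "solves_resolvent_eq ?S z g (resolvent ?S z g)" by (rule resolvent_solves[OF z(1) gsq])
  obtain x k b where x: "AE t in lborel. resolvent ?S z g t = x t" "square_integrable (resolvent ?S z g)" "weak_solution \<sigma> \<tau> x k b" "sobolev_pair x k"
    "AE t in lborel. b t = g t + z * x t" "sobolev_norm x k \<le> G * (L2_norm x + L2_norm g)"
    unfolding G_def by (rule resolvent_eq_weak_solution[OF adm(1) fb(1) K gsq sx])
  have xsq: "square_integrable x" using x(4) by (simp add: sobolev_pair_def)
  have "L2_norm x \<le> C * L2_norm w"
    using square_integrable_AE_cong(2)[OF x(2,1) square_integrable_measurable[OF xsq]] C(2)[OF gsq sx] gn by simp
  then have "G * (L2_norm x + L2_norm g) \<le> G * ((C + 1) * L2_norm w)"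
    using G0 gn by (intro mult_left_mono) (auto simp: algebra_simps)
  then have xn: "sobolev_norm x k \<le> G * (C + 1) * L2_norm w" using x(6) by (simp add: mult.assoc)
  have yn: "L2_norm y \<le> C"
    using square_integrable_AE_cong(2)[OF y(2,1) square_integrable_measurable[OF sq(1)]] C(2)[OF f(1) su] mult_left_mono[OF f(2) C(1)] by simp
  have vm: "b \<in> borel_measurable borel" "v \<in> borel_measurable borel" "v' \<in> borel_measurable borel"
    using x(3) y(3) y'(3) by (auto simp: weak_solution_def dest: square_integrable_measurable)
  have m: "f \<in> borel_measurable borel" "g \<in> borel_measurable borel" "x \<in> borel_measurable borel" "y \<in> borel_measurable borel" "y' \<in> borel_measurable borel"
    using square_integrable_measurable f(1) gsq xsq sq by auto
  have 1: "(LINT t|lborel. b t * y' t - v' t * x t) = (LINT t|lborel. g t * y' t - f t * x t)"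
  proof (rule integral_cong_AE)
    show "AE t in lborel. b t * y' t - v' t * x t = g t * y' t - f t * x t"
      using x(5) y'(5) by eventually_elim (simp add: algebra_simps)
  qed (use vm m in auto)
  have 2: "(LINT t|lborel. b t * y t - v t * x t) = (LINT t|lborel. g t * y t - f t * x t)"
  proof (rule integral_cong_AE)
    show "AE t in lborel. b t * y t - v t * x t = g t * y t - f t * x t"
      using x(5) y(5) by eventually_elim (simp add: algebra_simps)
  qed (use vm m in auto)
  \<comment> \<open>Comparing the unperturbed operator with itself, with perturbation 0: this is the
    symmetry of its resolvent in the bilinear pairing.\<close>
  have "cmod (LINT t|lborel. b t * y t - v t * x t) \<le> 2 * bump_bound * 0 * sobolev_norm y h * sobolev_norm x k"
    by (rule weak_solutions_difference[OF x(3,4) y(3,4) adm(1,1)]) (simp_all add: potential_form_def)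
  then have z0: "(LINT t|lborel. g t * y t - f t * x t) = 0" using 2 by simp
  have d: "cmod (LINT t|lborel. b t * y' t - v' t * x t) \<le> 2 * bump_bound * e * sobolev_norm y' h' * sobolev_norm x k"
    by (rule weak_solutions_difference[OF x(3,4) y'(3,4) adm e pert[OF _ _ _ _ x(4)]])
  have i: "integrable lborel (\<lambda>t. g t * y' t - f t * x t)" "integrable lborel (\<lambda>t. g t * y t - f t * x t)"
    by (intro Bochner_Integration.integrable_diff square_integrable_mult gsq f(1) sq xsq)+
  have "complex_of_real ((L2_norm w)\<^sup>2) = (LINT t|lborel. g t * w t)"
    unfolding L2_norm_squared integral_complex_of_real[symmetric]
    by (intro Bochner_Integration.integral_cong refl) (simp add: g_def complex_norm_square mult.commute del: of_real_power)
  also have "\<dots> = (LINT t|lborel. (g t * y' t - f t * x t) - (g t * y t - f t * x t))"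
    by (simp add: w_def algebra_simps)
  also have "\<dots> = (LINT t|lborel. b t * y' t - v' t * x t)"
    unfolding 1 Bochner_Integration.integral_diff[OF i] z0 by simp
  finally have "(L2_norm w)\<^sup>2 = cmod (LINT t|lborel. b t * y' t - v' t * x t)"
    by (metis norm_of_real abs_of_nonneg zero_le_power2)
  also have "\<dots> \<le> 2 * bump_bound * e * sobolev_norm y' h' * (G * (C + 1) * L2_norm w)"
    using e bump_bound(1) sobolev_norm_nonneg[of y' h'] by (intro order_trans[OF d] mult_left_mono xn) auto
  also have "\<dots> = (B * e * sobolev_norm y' h') * L2_norm w" by (simp add: B_def)
  finally have "L2_norm w * L2_norm w \<le> (B * e * sobolev_norm y' h') * L2_norm w" by (simp add: power2_eq_square)
  \<comment> \<open>One factor \<open>L2_norm w\<close> on the right came from the size of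
    \<open>x\<close>, the solution for the datum \<open>g\<close>, and cancels.\<close>
  then have wn: "L2_norm w \<le> B * e * sobolev_norm y' h'"
    using L2_norm_nonneg[of w] B0 e sobolev_norm_nonneg[of y' h'] by (cases "L2_norm w = 0") auto
  have "(L2_norm y')\<^sup>2 \<le> (2 * (L2_norm w + L2_norm y))\<^sup>2"
  proof -
    have "y' = (\<lambda>t. w t + y t)" by (simp add: w_def)
    then have "(L2_norm y')\<^sup>2 \<le> 2 * (L2_norm w)\<^sup>2 + 2 * (L2_norm y)\<^sup>2" using square_integrable_add(2)[OF wsq sq(1)] by simp
    also have "\<dots> \<le> (2 * (L2_norm w + L2_norm y))\<^sup>2"
      using mult_nonneg_nonneg[OF L2_norm_nonneg[of w] L2_norm_nonneg[of y]] by (simp add: power2_eq_square algebra_simps)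
    finally show ?thesis .
  qed
  then have "L2_norm y' \<le> 2 * (L2_norm w + L2_norm y)"
    by (rule power2_le_imp_le) (simp add: L2_norm_nonneg)
  \<comment> \<open>No a priori bound on \<open>y'\<close> is available. It is split as
    \<open>w + y\<close>, \<open>w\<close> is estimated by \<open>wn\<close> in terms of
    \<open>y'\<close> again, and \<open>small\<close> allows half of the Sobolev norm of
    \<open>y'\<close> to be absorbed.\<close>
  then have "sobolev_norm y' h' \<le> G * (2 * (L2_norm w + C) + 1)"
    using y'(6) yn f(2) G0 by (elim order_trans) (intro mult_left_mono; simp)
  also have "\<dots> \<le> G * (2 * (B * e * sobolev_norm y' h' + C) + 1)"
    using wn G0 by (intro mult_left_mono) auto
  also have "\<dots> = (2 * G * B * e) * sobolev_norm y' h' + G * (2 * C + 1)" by (simp add: algebra_simps)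
  also have "\<dots> \<le> (1 / 2) * sobolev_norm y' h' + G * (2 * C + 1)"
    by (intro add_right_mono mult_right_mono small sobolev_norm_nonneg)
  finally have "sobolev_norm y' h' \<le> 2 * G * (2 * C + 1)" by simp
  then have "B * e * sobolev_norm y' h' \<le> B * e * (2 * G * (2 * C + 1))"
    using B0 e by (intro mult_left_mono) auto
  moreover have "L2_norm (\<lambda>t. u' t - u t) = L2_norm w"
  proof (rule square_integrable_AE_cong(2)[OF wsq])
    show "AE t in lborel. w t = u' t - u t" using y(1) y'(1) by eventually_elim (simp add: w_def)
    show "(\<lambda>t. u' t - u t) \<in> borel_measurable borel"
      using y(2) y'(2) by (auto dest!: square_integrable_measurable)
  qed
  ultimately show ?thesis using wn by (simp add: u_def u'_def)
qed

text \<open>The common bound \<open>M\<close> also makes the supremum a genuine one; comparing with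
  the value at the zero function then gives nonnegativity.\<close>

lemma L2_op_norm_bound:
  assumes "\<And>f. square_integrable f \<Longrightarrow> L2_norm f \<le> 1 \<Longrightarrow> L2_norm (T f) \<le> M"
  shows "0 \<le> L2_op_norm T" "L2_op_norm T \<le> M"
proof -
  let ?A = "{f. square_integrable f \<and> L2_norm f \<le> 1}"
  have z: "(\<lambda>t. 0) \<in> ?A" by (simp add: square_integrable_def L2_norm_def)
  have le: "L2_norm (T f) \<le> M" if "f \<in> ?A" for f using that assms[of f] by simp
  have bdd: "bdd_above ((\<lambda>f. L2_norm (T f)) ` ?A)" by (rule bdd_aboveI2[OF le])
  have "0 \<le> L2_norm (T (\<lambda>t. 0))" by (rule L2_norm_nonneg)
  also have "\<dots> \<le> L2_op_norm T" unfolding L2_op_norm_def by (rule cSUP_upper[OF z bdd])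
  finally show "0 \<le> L2_op_norm T" .
  show "L2_op_norm T \<le> M" unfolding L2_op_norm_def
  proof (rule cSUP_least)
    show "?A \<noteq> {}" using z by blast
  qed (rule le)
qed

theorem theorem4p1:
  fixes q :: functional and qn :: "nat \<Rightarrow> functional"
    and S :: L2_operator and Sn :: "nat \<Rightarrow> L2_operator"
    and z :: complex
  assumes "\<And>n. qn n \<in> Wm12_unif" and "\<And>n. real_distribution (qn n)"
    and "q \<in> Wm12_unif" and "real_distribution q"
    and "(\<lambda>n. Wm12_unif_norm (\<lambda>\<psi>. qn n \<psi> - q \<psi>)) \<longlonglongrightarrow> 0"
    and "\<And>n. schroedinger_operator (qn n) (Sn n)" and "schroedinger_operator q S"
    and "z \<in> resolvent_set S" and "\<And>n. z \<in> resolvent_set (Sn n)"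
  shows "(\<lambda>n. L2_op_norm (\<lambda>f t. resolvent (Sn n) z f t - resolvent S z f t)) \<longlonglongrightarrow> 0"
proof -
  obtain \<sigma> \<tau> where dec: "decomposition q \<sigma> \<tau>" and S: "S = schroedinger_graph \<sigma> \<tau>"
    using assms(7) by (auto simp: schroedinger_operator_def)
  have "\<forall>n. \<exists>\<sigma>' \<tau>'. decomposition (qn n) \<sigma>' \<tau>' \<and> Sn n = schroedinger_graph \<sigma>' \<tau>'"
    using assms(6) by (simp add: schroedinger_operator_def)
  then obtain \<sigma>n \<tau>n where decn: "\<And>n. decomposition (qn n) (\<sigma>n n) (\<tau>n n)" and Sn: "\<And>n. Sn n = schroedinger_graph (\<sigma>n n) (\<tau>n n)"
    by metis
  have rep: "represents q \<sigma> \<tau>" "represents (qn n) (\<sigma>n n) (\<tau>n n)" for n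
    using decomposition_represents dec decn by auto
  have adm: "admissible \<sigma> \<tau>" "admissible (\<sigma>n n) (\<tau>n n)" for n using rep by (auto simp: represents_def)
  define c where "c = 24 * bump_bound"
  have c0: "c \<ge> 0" using bump_bound(1) by (simp add: c_def)
  \<comment> \<open>The absolute value supplies the nonnegativity that the estimates ask for and
    does not affect the limit.\<close>
  define e where "e n = c * \<bar>Wm12_unif_norm (\<lambda>\<psi>. qn n \<psi> - q \<psi>)\<bar>" for n
  have e0: "e n \<ge> 0" for n using c0 by (simp add: e_def)
  have "e \<longlonglongrightarrow> c * \<bar>0\<bar>" unfolding e_def[abs_def] by (intro tendsto_intros assms(5))
  then have e_lim: "e \<longlonglongrightarrow> 0" by simp
  have loc: "cmod (potential_form (\<lambda>t. \<sigma>n n t - \<sigma> t) (\<lambda>t. \<tau>n n t - \<tau> t) (\<lambda>t. phi_shift k t * y t)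
      (\<lambda>t. phi_shift_deriv k t * y t + phi_shift k t * h t)) \<le> \<bar>Wm12_unif_norm (\<lambda>\<psi>. qn n \<psi> - q \<psi>)\<bar> * sobolev_norm y h"
    if "sobolev_pair y h" for n k y h
    using Wm12_unif_norm_diff_bound[OF assms(1)[of n] rep(2) assms(3) rep(1) that, of k]
      mult_right_mono[OF abs_ge_self sobolev_norm_nonneg] by (rule order_trans)
  have pert: "cmod (potential_form (\<lambda>t. \<sigma>n n t - \<sigma> t) (\<lambda>t. \<tau>n n t - \<tau> t) (\<lambda>t. p t * y t) (\<lambda>t. p' t * y t + p t * h t))
      \<le> e n * sobolev_norm p p' * sobolev_norm y h"
    if "ac_deriv p p'" "L2_loc p'" "\<And>t. \<bar>t\<bar> > a \<Longrightarrow> p t = 0" "\<And>t. \<bar>t\<bar> > a \<Longrightarrow> p' t = 0" "sobolev_pair y h" for n p p' y h a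
    using potential_form_product_bound[OF admissible_diff[OF adm(2,1)] abs_ge_zero loc that] by (simp add: e_def c_def)
  obtain K0 where K0: "K0 \<ge> 0" "\<And>y h a. ac_deriv y h \<Longrightarrow> L2_loc h \<Longrightarrow> (\<And>t. \<bar>t\<bar> > a \<Longrightarrow> y t = 0) \<Longrightarrow> (\<And>t. \<bar>t\<bar> > a \<Longrightarrow> h t = 0) \<Longrightarrow>
    cmod (potential_form \<sigma> \<tau> (\<lambda>t. of_real ((cmod (y t))\<^sup>2)) (\<lambda>t. h t * cnj (y t) + y t * cnj (h t))) \<le> (L2_norm h)\<^sup>2 / 2 + K0 * (L2_norm y)\<^sup>2"
    using potential_form_relative_bound[OF dec] by blast
  \<comment> \<open>The perturbation is bounded by 1/4 of the full Sobolev norm squared: one part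
    goes to the Dirichlet integral, the other to the lower order term.\<close>
  define K where "K = K0 + 1 / 4"
  have K: "K \<ge> 0" using K0(1) by (simp add: K_def)
  have fb: "form_bounded \<sigma> \<tau> K"
    unfolding form_bounded_def
  proof (intro allI impI)
    fix y h a assume "ac_deriv y h" "L2_loc h" "\<forall>t. \<bar>t\<bar> > a \<longrightarrow> y t = 0 \<and> h t = 0"
    then have "cmod (potential_form \<sigma> \<tau> (\<lambda>t. of_real ((cmod (y t))\<^sup>2)) (\<lambda>t. h t * cnj (y t) + y t * cnj (h t))) \<le> (L2_norm h)\<^sup>2 / 2 + K0 * (L2_norm y)\<^sup>2"
      using K0(2)[of y h a] by blast
    also have "\<dots> \<le> (3 / 4) * (L2_norm h)\<^sup>2 + K * (L2_norm y)\<^sup>2" by (intro add_mono) (auto simp: K_def mult_right_mono)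
    finally show "cmod (potential_form \<sigma> \<tau> (\<lambda>t. of_real ((cmod (y t))\<^sup>2)) (\<lambda>t. h t * cnj (y t) + y t * cnj (h t))) \<le> (3 / 4) * (L2_norm h)\<^sup>2 + K * (L2_norm y)\<^sup>2" .
  qed
  \<comment> \<open>The form of \<open>qn n\<close> is that of \<open>q\<close> plus the
    perturbation, estimated by \<open>pert\<close> for the factors \<open>y\<close> and its
    conjugate; the same \<open>K\<close> thus serves all large \<open>n\<close>.\<close>
  have fbn: "form_bounded (\<sigma>n n) (\<tau>n n) K" if en: "e n \<le> 1 / 4" for n
    unfolding form_bounded_def
  proof (intro allI impI)
    fix y h a assume y: "ac_deriv y h" "L2_loc h" and "\<forall>t. \<bar>t\<bar> > a \<longrightarrow> y t = 0 \<and> h t = 0"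
    then have s: "\<And>t. \<bar>t\<bar> > a \<Longrightarrow> y t = 0" "\<And>t. \<bar>t\<bar> > a \<Longrightarrow> h t = 0" by auto
    let ?N = "\<lambda>t. complex_of_real ((cmod (y t))\<^sup>2)" and ?D = "\<lambda>t. h t * cnj (y t) + y t * cnj (h t)"
    have ysq: "square_integrable y" "square_integrable h"
      using continuous_square_integrable[OF ac_deriv_continuous[OF y(1)] s(1)] L2_loc_compact_support[OF y(2) s(2)] by auto
    have cp: "sobolev_pair (\<lambda>t. cnj (y t)) (\<lambda>t. cnj (h t))"
      using ac_deriv_cnj[OF y(1)] square_integrable_cnj ysq by (simp add: sobolev_pair_def)
    have N: "?N = (\<lambda>t. y t * cnj (y t))" by (simp add: complex_norm_square fun_eq_iff del: of_real_power)
    have sN: "sobolev_pair ?N ?D"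
      unfolding N using cp by (intro sobolev_pair_mult_compact_support[OF y s]) (auto simp: sobolev_pair_def intro: square_integrable_imp_L2_loc)
    have eq: "potential_form (\<sigma>n n) (\<tau>n n) ?N ?D = potential_form (\<lambda>t. \<sigma>n n t - \<sigma> t) (\<lambda>t. \<tau>n n t - \<tau> t) ?N ?D + potential_form \<sigma> \<tau> ?N ?D"
    proof -
      have d: "ac_deriv ?N ?D" "L2_loc ?D" using sN by (auto simp: sobolev_pair_def square_integrable_imp_L2_loc)
      have "potential_form (\<lambda>t. \<sigma>n n t - \<sigma> t) (\<lambda>t. \<tau>n n t - \<tau> t) ?N ?D = potential_form (\<sigma>n n) (\<tau>n n) ?N ?D - potential_form \<sigma> \<tau> ?N ?D"
        by (rule potential_form_diff[OF adm(2,1) ac_deriv_continuous[OF d(1)] d(2), of a]) (simp_all add: s)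
      then show ?thesis by simp
    qed
    have le1: "cmod (potential_form (\<lambda>t. \<sigma>n n t - \<sigma> t) (\<lambda>t. \<tau>n n t - \<tau> t) ?N ?D) \<le> (1 / 4) * ((L2_norm y)\<^sup>2 + (L2_norm h)\<^sup>2)"
    proof -
      have "cmod (potential_form (\<lambda>t. \<sigma>n n t - \<sigma> t) (\<lambda>t. \<tau>n n t - \<tau> t) ?N ?D) \<le> e n * sobolev_norm y h * sobolev_norm (\<lambda>t. cnj (y t)) (\<lambda>t. cnj (h t))"
        unfolding N by (rule pert[OF y s cp])
      also have "\<dots> = e n * (sobolev_norm y h)\<^sup>2" by (simp add: sobolev_norm_def L2_norm_cnj power2_eq_square)
      also have "\<dots> \<le> (1 / 4) * (sobolev_norm y h)\<^sup>2" by (intro mult_right_mono en) auto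
      finally show ?thesis by (simp add: sobolev_norm_squared)
    qed
    have le2: "cmod (potential_form \<sigma> \<tau> ?N ?D) \<le> (L2_norm h)\<^sup>2 / 2 + K0 * (L2_norm y)\<^sup>2" by (rule K0(2)[OF y s])
    have "cmod (potential_form (\<sigma>n n) (\<tau>n n) ?N ?D) \<le> (1 / 4) * ((L2_norm y)\<^sup>2 + (L2_norm h)\<^sup>2) + ((L2_norm h)\<^sup>2 / 2 + K0 * (L2_norm y)\<^sup>2)"
      unfolding eq by (rule norm_triangle_mono[OF le1 le2])
    also have "\<dots> = (3 / 4) * (L2_norm h)\<^sup>2 + K * (L2_norm y)\<^sup>2" by (simp add: K_def algebra_simps)
    finally show "cmod (potential_form (\<sigma>n n) (\<tau>n n) ?N ?D) \<le> (3 / 4) * (L2_norm h)\<^sup>2 + K * (L2_norm y)\<^sup>2" .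
  qed
  \<comment> \<open>Taken from the limit operator, so \<open>G\<close>, \<open>B\<close> and
    \<open>M\<close> below are independent of \<open>n\<close>.\<close>
  obtain C where C: "C \<ge> 0" "\<And>f u. square_integrable f \<Longrightarrow> solves_resolvent_eq S z f u \<Longrightarrow> L2_norm u \<le> C * L2_norm f"
    using resolvent_set_bound[OF assms(8)] by blast
  define G where "G = resolvent_constant K z"
  define B where "B = 2 * bump_bound * (G * (C + 1))"
  define M where "M = 2 * G * (2 * C + 1)"
  have bound: "0 \<le> L2_op_norm (\<lambda>f t. resolvent (Sn n) z f t - resolvent S z f t)"
    "L2_op_norm (\<lambda>f t. resolvent (Sn n) z f t - resolvent S z f t) \<le> B * e n * M"
    if n: "e n \<le> 1 / 4" "2 * G * B * e n \<le> 1 / 2" for n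
  proof -
    have "L2_norm (\<lambda>t. resolvent (Sn n) z f t - resolvent S z f t) \<le> B * e n * M" if f: "square_integrable f" "L2_norm f \<le> 1" for f
      unfolding Sn S B_def G_def M_def
      by (rule resolvent_difference_bound[OF adm fb fbn[OF n(1)] K e0 pert _ _ C(1) _ _ f])
         (use assms(8) assms(9)[of n] C(2) n(2) in \<open>auto simp: S Sn B_def G_def\<close>)
    from L2_op_norm_bound[OF this]
    show "0 \<le> L2_op_norm (\<lambda>f t. resolvent (Sn n) z f t - resolvent S z f t)"
      "L2_op_norm (\<lambda>f t. resolvent (Sn n) z f t - resolvent S z f t) \<le> B * e n * M" by auto
  qed
  \<comment> \<open>Two smallness conditions: 1/4 transfers the form bound, 1/2 permits the
    absorption in \<open>resolvent_difference_bound\<close>.\<close>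
  have ev1: "\<forall>\<^sub>F n in sequentially. e n < 1 / 4" by (rule order_tendstoD(2)[OF e_lim]) simp
  have "(\<lambda>n. 2 * G * B * e n) \<longlonglongrightarrow> 2 * G * B * 0" by (intro tendsto_intros e_lim)
  then have ev2: "\<forall>\<^sub>F n in sequentially. 2 * G * B * e n < 1 / 2" by (intro order_tendstoD(2)) auto
  have ev: "\<forall>\<^sub>F n in sequentially. norm (L2_op_norm (\<lambda>f t. resolvent (Sn n) z f t - resolvent S z f t)) \<le> B * e n * M"
    using ev1 ev2
  proof eventually_elim
    case (elim n)
    then show ?case using bound[of n] by simp
  qed
  have "(\<lambda>n. B * e n * M) \<longlonglongrightarrow> B * 0 * M" by (intro tendsto_intros e_lim)
  then show ?thesis using Lim_null_comparison[OF ev] by simp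
qed

end
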